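(* Let $\mathcal{G}$ be a non-empty set of finite groups, $R$ a commutative unital ring in which $\mathbb{Q}$ embeds (every positive integer is invertible in $R$), $A$ a multiplicatively written abelian group, and $\ell : \mathbb{N}\setminus\{0\} \to R^\times$ a homomorphism of multiplicative monoids. Let $R_\ell\mathcal{B}^A$ and $\overline{R_\ell\mathcal{S}^A}$ be as defined in the context. For $F, G \in \mathcal{G}$ let $$\nu_{F,G} : R_\ell\mathcal{B}^A(F,G) \to \overline{R_\ell\mathcal{S}^A}(F,G)$$ be the $R$-linear map given by $\nu_{F,G}(d^{F,G}_{U,\mu}) = |G|\,\overline{s}^{F,G}_{U,\mu}/|U|$. Then the composition for $R_\ell\mathcal{B}^A$ is associative and $R_\ell\mathcal{B}^A$ is an $R$-linear category on $\mathcal{G}$. Moreover, the maps $\nu_{F,G}$, for $F,G\in\mathcal{G}$, determine an object-identical isomorphism of $R$-linear categories $\nu : R_\ell\mathcal{B}^A \to \overline{R_\ell\mathcal{S}^A}$.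
   Context: Conventions. $F,G,H$ denote arbitrary elements of $\mathcal{G}$; elements of $F\times G$ are written $f\times g$. For a category with object set $\mathcal{G}$, $\mathcal{L}(F,G)$ denotes the set of morphisms to $F$ from $G$, so composition is a map $\mathcal{L}(F,G)\times\mathcal{L}(G,H)\to\mathcal{L}(F,H)$. A category is $R$-linear if its morphism sets are $R$-modules and composition is $R$-bilinear; functors between $R$-linear categories are $R$-linear on morphisms. A functor between categories on the same object set is object-identical if it is the identity on objects. For $g\in G$, ${}^g y=gyg^{-1}$. Subgroups. For $U\le F\times G$ and $V\le G\times H$: $U*V=\{f\times h : \exists g\in G,\ f\times g\in U,\ g\times h\in V\}\le F\times H$; $p_2(U)\le G$ and $p_1(V)\le G$ are the images of the projections of $U$ and $V$ to $G$; $\Gamma_\cap(U,V)=\{g\in G : 1\times g\in U,\ g\times 1\in V\}$. $A$-subcharacters. An $A$-subcharacter of a finite group $E$ is a pair $(T,\tau)$ with $T\le E$ and $\tau:T\to A$ a homomorphism. $E$ acts on the set of these by ${}^g(T,\tau)=({}^gT,{}^g\tau)$, ${}^g\tau({}^gt)=\tau(t)$; $[T,\tau]$ denotes the $E$-orbit. $\mathcal{S}^A(F,G)$ is the set of $A$-subcharacters of $F\times G$ and $\mathcal{S}^A[F,G]$ its set of $F\times G$-orbits. For $(U,\mu)\in\mathcal{S}^A(F,G)$ and $(V,\nu)\in\mathcal{S}^A(G,H)$, write $(U,\mu)\sim(V,\nu)$ if $\mu(1\times g)\nu(g\times 1)=1$ for all $g\in\Gamma_\cap(U,V)$; in that case $\mu*\nu:U*V\to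 A$ is the homomorphism $(\mu*\nu)(f\times h)=\mu(f\times g)\nu(g\times h)$ for any $g$ with $f\times g\in U$, $g\times h\in V$. For $g\in G$, ${}^g(V,\nu)=({}^gV,{}^g\nu)$ means ${}^{g\times 1}(V,\nu)$. The category $R_\ell\mathcal{S}^A$. This is the $R$-linear category on $\mathcal{G}$ where $R_\ell\mathcal{S}^A(F,G)$ is the free $R$-module on symbols $s^{F,G}_{U,\mu}$, $(U,\mu)\in\mathcal{S}^A(F,G)$, with $R$-bilinear composition $s^{F,G}_{U,\mu}s^{G,H}_{V,\nu}=\ell(|\Gamma_\cap(U,V)|)\,s^{F,H}_{U*V,\mu*\nu}$ if $(U,\mu)\sim(V,\nu)$ and $0$ otherwise. The identity on $G$ is $s^{G,G}_{\Delta(G),1}$, where $\Delta(G)=\{y\times y:y\in G\}$ and $1$ is the trivial homomorphism. There is an algebra map $\sigma_G: RG\to R_\ell\mathcal{S}^A(G,G)$ with $\sigma_G(g)=s^{G,G}_{\Delta(G,g,G),1}$, where $\Delta(G,g,G)=\{{}^gy\times y:y\in G\}$. $F\times G$ acts on $R_\ell\mathcal{S}^A(F,G)$ by ${}^{f\times g}\phi=\sigma_F(f)\,\phi\,\sigma_G(g)^{-1}$. The invariant category $\overline{R_\ell\mathcal{S}^A}$. It is the $R$-linear category on $\mathcal{G}$ with $\overline{R_\ell\mathcal{S}^A}(F,G)=R_\ell\mathcal{S}^A(F,G)^{F\times G}$ (the fixed submodule), with composition restricted from that of $R_\ell\mathcal{S}^A$, and with identities $\sigma_G(e_G)$, where $e_G=\frac{1}{|G|}\sum_{g\in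 G}g$. Put $\overline{s}^{F,G}_{U,\mu}=\sigma_F(e_F)\,s^{F,G}_{U,\mu}\,\sigma_G(e_G)$; this depends only on $F$, $G$ and $[U,\mu]$, and these elements, for $[U,\mu]\in\mathcal{S}^A[F,G]$, form an $R$-basis of $\overline{R_\ell\mathcal{S}^A}(F,G)$. The structure $R_\ell\mathcal{B}^A$. $R_\ell\mathcal{B}^A(F,G)$ is the free $R$-module on formal symbols $d^{F,G}_{U,\mu}$, one for each $[U,\mu]\in\mathcal{S}^A[F,G]$ (the symbol depends only on $F,G$ and the orbit $[U,\mu]$). Composition is the $R$-bilinear map with $$d^{F,G}_{U,\mu}\cdot d^{G,H}_{V,\nu}=\sum_g\frac{\ell(|\Gamma_\cap(U,{}^gV)|)}{|\Gamma_\cap(U,{}^gV)|}\,d^{F,H}_{U*{}^gV,\ \mu*{}^g\nu},$$ where $g$ runs over representatives of the double cosets $p_2(U)\,g\,p_1(V)\subseteq G$ such that $(U,\mu)\sim{}^g(V,\nu)$. (The right-hand side does not depend on the choices of double coset representatives and orbit representatives.) *)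

theory Defs
  imports "HOL-Algebra.Module" "HOL-Algebra.Group_Action"
begin

section \<open>Linear categories\<close>

text \<open>Following the source, \<open>Hom C F G\<close> is the module of morphisms \<^emph>\<open>to\<close> \<open>F\<close> \<^emph>\<open>from\<close> \<open>G\<close>, and
  \<open>Comp C F G H\<close> maps \<open>Hom C F G \<times> Hom C G H\<close> to \<open>Hom C F H\<close>.  Only the additive structure and the
  scalar multiplication of the module records are used.\<close>

record ('o, 'r, 'm) lincat =
  Ob :: "'o set"
  Hom :: "'o \<Rightarrow> 'o \<Rightarrow> ('r, 'm) module"
  Comp :: "'o \<Rightarrow> 'o \<Rightarrow> 'o \<Rightarrow> 'm \<Rightarrow> 'm \<Rightarrow> 'm"
  Ident :: "'o \<Rightarrow> 'm"

definition associative_comp :: "('o, 'r, 'm) lincat \<Rightarrow> bool" where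
  "associative_comp C \<longleftrightarrow>
    (\<forall>F\<in>Ob C. \<forall>G\<in>Ob C. \<forall>H\<in>Ob C. \<forall>K\<in>Ob C.
      \<forall>\<phi>\<in>carrier (Hom C F G). \<forall>\<psi>\<in>carrier (Hom C G H). \<forall>\<chi>\<in>carrier (Hom C H K).
        Comp C F H K (Comp C F G H \<phi> \<psi>) \<chi> = Comp C F G K \<phi> (Comp C G H K \<psi> \<chi>))"

definition linear_maps ::
    "('r, 'x) ring_scheme \<Rightarrow> ('r, 'm) module \<Rightarrow> ('r, 'n) module \<Rightarrow> ('m \<Rightarrow> 'n) set" where
  "linear_maps R M N = {f \<in> carrier M \<rightarrow> carrier N.
     (\<forall>x\<in>carrier M. \<forall>y\<in>carrier M. f (x \<oplus>\<^bsub>M\<^esub> y) = f x \<oplus>\<^bsub>N\<^esub> f y) \<and>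
     (\<forall>r\<in>carrier R. \<forall>x\<in>carrier M. f (r \<odot>\<^bsub>M\<^esub> x) = r \<odot>\<^bsub>N\<^esub> f x)}"

locale linear_category = cring R for R :: "('r, 'x) ring_scheme" (structure) +
  fixes C :: "('o, 'r, 'm) lincat"
  assumes hom_module: "\<lbrakk>F \<in> Ob C; G \<in> Ob C\<rbrakk> \<Longrightarrow> module R (Hom C F G)"
    and comp_linear_left: "\<lbrakk>F \<in> Ob C; G \<in> Ob C; H \<in> Ob C; \<psi> \<in> carrier (Hom C G H)\<rbrakk>
      \<Longrightarrow> (\<lambda>\<phi>. Comp C F G H \<phi> \<psi>) \<in> linear_maps R (Hom C F G) (Hom C F H)"
    and comp_linear_right: "\<lbrakk>F \<in> Ob C; G \<in> Ob C; H \<in> Ob C; \<phi> \<in> carrier (Hom C F G)\<rbrakk>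
      \<Longrightarrow> (\<lambda>\<psi>. Comp C F G H \<phi> \<psi>) \<in> linear_maps R (Hom C G H) (Hom C F H)"
    and comp_assoc: "associative_comp C"
    and ident_closed: "G \<in> Ob C \<Longrightarrow> Ident C G \<in> carrier (Hom C G G)"
    and ident_left: "\<lbrakk>F \<in> Ob C; G \<in> Ob C; \<phi> \<in> carrier (Hom C F G)\<rbrakk>
      \<Longrightarrow> Comp C F F G (Ident C F) \<phi> = \<phi>"
    and ident_right: "\<lbrakk>F \<in> Ob C; G \<in> Ob C; \<phi> \<in> carrier (Hom C F G)\<rbrakk>
      \<Longrightarrow> Comp C F G G \<phi> (Ident C G) = \<phi>"

text \<open>An object-identical functor is given by its maps \<open>\<Phi> F G\<close> on morphism modules.\<close>

locale object_identical_functor =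
  source: linear_category R C + target: linear_category R D
  for R :: "('r, 'x) ring_scheme" (structure)
    and C :: "('o, 'r, 'm) lincat" and D :: "('o, 'r, 'n) lincat" +
  fixes \<Phi> :: "'o \<Rightarrow> 'o \<Rightarrow> 'm \<Rightarrow> 'n"
  assumes same_objects: "Ob D = Ob C"
    and map_linear: "\<lbrakk>F \<in> Ob C; G \<in> Ob C\<rbrakk> \<Longrightarrow> \<Phi> F G \<in> linear_maps R (Hom C F G) (Hom D F G)"
    and map_comp: "\<lbrakk>F \<in> Ob C; G \<in> Ob C; H \<in> Ob C;
        \<phi> \<in> carrier (Hom C F G); \<psi> \<in> carrier (Hom C G H)\<rbrakk>
      \<Longrightarrow> \<Phi> F H (Comp C F G H \<phi> \<psi>) = Comp D F G H (\<Phi> F G \<phi>) (\<Phi> G H \<psi>)"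
    and map_ident: "G \<in> Ob C \<Longrightarrow> \<Phi> G G (Ident C G) = Ident D G"

definition object_identical_isomorphism ::
    "('r, 'x) ring_scheme \<Rightarrow> ('o, 'r, 'm) lincat \<Rightarrow> ('o, 'r, 'n) lincat \<Rightarrow>
      ('o \<Rightarrow> 'o \<Rightarrow> 'm \<Rightarrow> 'n) \<Rightarrow> bool" where
  "object_identical_isomorphism R C D \<Phi> \<longleftrightarrow>
     object_identical_functor R C D \<Phi> \<and>
     (\<exists>\<Psi>. object_identical_functor R D C \<Psi> \<and>
       (\<forall>F\<in>Ob C. \<forall>G\<in>Ob C.
         (\<forall>\<phi>\<in>carrier (Hom C F G). \<Psi> F G (\<Phi> F G \<phi>) = \<phi>) \<and>
         (\<forall>\<psi>\<in>carrier (Hom D F G). \<Phi> F G (\<Psi> F G \<psi>) = \<psi>)))"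


section \<open>Free modules\<close>

definition of_nat_in :: "('r, 'x) ring_scheme \<Rightarrow> nat \<Rightarrow> 'r" where
  "of_nat_in R n = [n] \<cdot>\<^bsub>R\<^esub> \<one>\<^bsub>R\<^esub>"

text \<open>Elements are the finitely supported coefficient functions on \<open>S\<close>, normalised outside \<open>S\<close> so
  that equality is equality of functions.  The ring multiplication of the record is irrelevant.\<close>

definition support :: "('r, 'x) ring_scheme \<Rightarrow> 's set \<Rightarrow> ('s \<Rightarrow> 'r) \<Rightarrow> 's set" where
  "support R S \<phi> = {s \<in> S. \<phi> s \<noteq> \<zero>\<^bsub>R\<^esub>}"

definition free_module :: "('r, 'x) ring_scheme \<Rightarrow> 's set \<Rightarrow> ('r, 's \<Rightarrow> 'r) module" where
  "free_module R S =
    \<lparr>carrier = {\<phi> \<in> S \<rightarrow>\<^sub>E carrier R. finite (support R S \<phi>)},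
     mult = undefined, one = undefined,
     zero = (\<lambda>s\<in>S. \<zero>\<^bsub>R\<^esub>),
     add = (\<lambda>\<phi> \<psi>. \<lambda>s\<in>S. \<phi> s \<oplus>\<^bsub>R\<^esub> \<psi> s),
     smult = (\<lambda>r \<phi>. \<lambda>s\<in>S. r \<otimes>\<^bsub>R\<^esub> \<phi> s)\<rparr>"

definition symbol :: "('r, 'x) ring_scheme \<Rightarrow> 's set \<Rightarrow> 's \<Rightarrow> ('s \<Rightarrow> 'r)" where
  "symbol R S s = (\<lambda>t\<in>S. if t = s then \<one>\<^bsub>R\<^esub> else \<zero>\<^bsub>R\<^esub>)"

definition linear_ext ::
    "('r, 'x) ring_scheme \<Rightarrow> 's set \<Rightarrow> ('r, 'm) module \<Rightarrow> ('s \<Rightarrow> 'm) \<Rightarrow> ('s \<Rightarrow> 'r) \<Rightarrow> 'm" where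
  "linear_ext R S M f \<phi> = finsum M (\<lambda>s. \<phi> s \<odot>\<^bsub>M\<^esub> f s) (support R S \<phi>)"

definition bilinear_ext ::
    "('r, 'x) ring_scheme \<Rightarrow> 's set \<Rightarrow> 't set \<Rightarrow> ('r, 'm) module \<Rightarrow>
      ('s \<Rightarrow> 't \<Rightarrow> 'm) \<Rightarrow> ('s \<Rightarrow> 'r) \<Rightarrow> ('t \<Rightarrow> 'r) \<Rightarrow> 'm" where
  "bilinear_ext R S T M f \<phi> \<psi> = linear_ext R S M (\<lambda>s. linear_ext R T M (f s) \<psi>) \<phi>"


section \<open>Subcharacters\<close>

text \<open>The function component is extensional, so that a homomorphism on \<open>T\<close> is determined by its
  values on \<open>T\<close>.\<close>

type_synonym ('e, 'a) subchar = "'e set \<times> ('e \<Rightarrow> 'a)"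

definition subchars :: "('a, 'z) monoid_scheme \<Rightarrow> 'e monoid \<Rightarrow> ('e, 'a) subchar set" where
  "subchars A E = {(T, \<tau>). subgroup T E \<and> \<tau> \<in> hom (E\<lparr>carrier := T\<rparr>) A \<and> \<tau> \<in> extensional T}"

definition conj_elt :: "'e monoid \<Rightarrow> 'e \<Rightarrow> 'e \<Rightarrow> 'e" where
  "conj_elt E g y = g \<otimes>\<^bsub>E\<^esub> y \<otimes>\<^bsub>E\<^esub> inv\<^bsub>E\<^esub> g"

definition conj_subchar :: "'e monoid \<Rightarrow> 'e \<Rightarrow> ('e, 'a) subchar \<Rightarrow> ('e, 'a) subchar" where
  "conj_subchar E g = (\<lambda>(T, \<tau>).
     (conj_elt E g ` T, \<lambda>y \<in> conj_elt E g ` T. \<tau> (conj_elt E (inv\<^bsub>E\<^esub> g) y)))"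

definition SA :: "('a, 'z) monoid_scheme \<Rightarrow> 'g monoid \<Rightarrow> 'g monoid \<Rightarrow> ('g \<times> 'g, 'a) subchar set"
  where "SA A F G = subchars A (F \<times>\<times> G)"

abbreviation orbit_of :: "'g monoid \<Rightarrow> 'g monoid \<Rightarrow> ('g \<times> 'g, 'a) subchar \<Rightarrow>
    ('g \<times> 'g, 'a) subchar set" where
  "orbit_of F G \<equiv> orbit (F \<times>\<times> G) (conj_subchar (F \<times>\<times> G))"

definition SA_orbits ::
    "('a, 'z) monoid_scheme \<Rightarrow> 'g monoid \<Rightarrow> 'g monoid \<Rightarrow> ('g \<times> 'g, 'a) subchar set set" where
  "SA_orbits A F G = orbits (F \<times>\<times> G) (SA A F G) (conj_subchar (F \<times>\<times> G))"

text \<open>The subgroup \<open>U * V\<close> is the relational composition \<open>U O V\<close>.\<close>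

definition Gamma_cap ::
    "'g monoid \<Rightarrow> 'g monoid \<Rightarrow> 'g monoid \<Rightarrow> ('g \<times> 'g) set \<Rightarrow> ('g \<times> 'g) set \<Rightarrow> 'g set" where
  "Gamma_cap F G H U V = {g \<in> carrier G. (\<one>\<^bsub>F\<^esub>, g) \<in> U \<and> (g, \<one>\<^bsub>H\<^esub>) \<in> V}"

definition compatible ::
    "('a, 'z) monoid_scheme \<Rightarrow> 'g monoid \<Rightarrow> 'g monoid \<Rightarrow> 'g monoid \<Rightarrow>
      ('g \<times> 'g, 'a) subchar \<Rightarrow> ('g \<times> 'g, 'a) subchar \<Rightarrow> bool" where
  "compatible A F G H = (\<lambda>(U, \<mu>) (V, \<nu>).
     \<forall>g \<in> Gamma_cap F G H U V. \<mu> (\<one>\<^bsub>F\<^esub>, g) \<otimes>\<^bsub>A\<^esub> \<nu> (g, \<one>\<^bsub>H\<^esub>) = \<one>\<^bsub>A\<^esub>)"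

text \<open>For compatible arguments the value described by \<open>THE\<close> is the common one for all
  intermediate \<open>g\<close>.\<close>

definition star ::
    "('a, 'z) monoid_scheme \<Rightarrow>
      ('g \<times> 'g, 'a) subchar \<Rightarrow> ('g \<times> 'g, 'a) subchar \<Rightarrow> ('g \<times> 'g, 'a) subchar" where
  "star A = (\<lambda>(U, \<mu>) (V, \<nu>).
     (U O V, \<lambda>(f, h) \<in> U O V.
        THE a. \<forall>g. (f, g) \<in> U \<and> (g, h) \<in> V \<longrightarrow> a = \<mu> (f, g) \<otimes>\<^bsub>A\<^esub> \<nu> (g, h)))"


section \<open>The category of subcharacters\<close>

definition RS_hom ::
    "('r, 'x) ring_scheme \<Rightarrow> ('a, 'z) monoid_scheme \<Rightarrow> 'g monoid \<Rightarrow> 'g monoid \<Rightarrow>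
      ('r, ('g \<times> 'g, 'a) subchar \<Rightarrow> 'r) module" where
  "RS_hom R A F G = free_module R (SA A F G)"

definition s_sym ::
    "('r, 'x) ring_scheme \<Rightarrow> ('a, 'z) monoid_scheme \<Rightarrow> 'g monoid \<Rightarrow> 'g monoid \<Rightarrow>
      ('g \<times> 'g, 'a) subchar \<Rightarrow> (('g \<times> 'g, 'a) subchar \<Rightarrow> 'r)" where
  "s_sym R A F G = symbol R (SA A F G)"

definition RS_comp ::
    "('r, 'x) ring_scheme \<Rightarrow> (nat \<Rightarrow> 'r) \<Rightarrow> ('a, 'z) monoid_scheme \<Rightarrow>
      'g monoid \<Rightarrow> 'g monoid \<Rightarrow> 'g monoid \<Rightarrow>
      (('g \<times> 'g, 'a) subchar \<Rightarrow> 'r) \<Rightarrow> (('g \<times> 'g, 'a) subchar \<Rightarrow> 'r) \<Rightarrow>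
      (('g \<times> 'g, 'a) subchar \<Rightarrow> 'r)" where
  "RS_comp R l A F G H = bilinear_ext R (SA A F G) (SA A G H) (RS_hom R A F H)
     (\<lambda>u v. if compatible A F G H u v
        then l (card (Gamma_cap F G H (fst u) (fst v))) \<odot>\<^bsub>RS_hom R A F H\<^esub> s_sym R A F H (star A u v)
        else \<zero>\<^bsub>RS_hom R A F H\<^esub>)"

text \<open>\<open>Delta A G g\<close> is the subgroup \<open>{(g y g\<inverse>, y) | y \<in> G}\<close> together with its trivial character.\<close>

definition Delta :: "('a, 'z) monoid_scheme \<Rightarrow> 'g monoid \<Rightarrow> 'g \<Rightarrow> ('g \<times> 'g, 'a) subchar" where
  "Delta A G g = (let D = {(conj_elt G g y, y) | y. y \<in> carrier G} in (D, \<lambda>_ \<in> D. \<one>\<^bsub>A\<^esub>))"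

definition RS ::
    "('r, 'x) ring_scheme \<Rightarrow> (nat \<Rightarrow> 'r) \<Rightarrow> ('a, 'z) monoid_scheme \<Rightarrow> 'g monoid set \<Rightarrow>
      ('g monoid, 'r, ('g \<times> 'g, 'a) subchar \<Rightarrow> 'r) lincat" where
  "RS R l A \<G> = \<lparr>Ob = \<G>, Hom = RS_hom R A, Comp = RS_comp R l A,
     Ident = (\<lambda>G. s_sym R A G G (Delta A G \<one>\<^bsub>G\<^esub>))\<rparr>"


section \<open>The invariant category\<close>

text \<open>The underlying module of the group algebra \<open>RG\<close> is \<open>free_module R (carrier G)\<close>.\<close>

definition grp_sym :: "('r, 'x) ring_scheme \<Rightarrow> 'g monoid \<Rightarrow> 'g \<Rightarrow> ('g \<Rightarrow> 'r)" where
  "grp_sym R G = symbol R (carrier G)"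

definition sigma ::
    "('r, 'x) ring_scheme \<Rightarrow> ('a, 'z) monoid_scheme \<Rightarrow> 'g monoid \<Rightarrow> ('g \<Rightarrow> 'r) \<Rightarrow>
      (('g \<times> 'g, 'a) subchar \<Rightarrow> 'r)" where
  "sigma R A G = linear_ext R (carrier G) (RS_hom R A G G) (\<lambda>g. s_sym R A G G (Delta A G g))"

definition e_idem :: "('r, 'x) ring_scheme \<Rightarrow> 'g monoid \<Rightarrow> ('g \<Rightarrow> 'r)" where
  "e_idem R G = (let RG = free_module R (carrier G) in
     inv\<^bsub>R\<^esub> (of_nat_in R (order G)) \<odot>\<^bsub>RG\<^esub> finsum RG (grp_sym R G) (carrier G))"

text \<open>Since \<open>sigma R A G\<close> is an algebra map, the inverse of the image of \<open>g\<close> is the image of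
  \<open>g\<inverse>\<close>.\<close>

definition RS_act ::
    "('r, 'x) ring_scheme \<Rightarrow> (nat \<Rightarrow> 'r) \<Rightarrow> ('a, 'z) monoid_scheme \<Rightarrow> 'g monoid \<Rightarrow> 'g monoid \<Rightarrow>
      'g \<times> 'g \<Rightarrow> (('g \<times> 'g, 'a) subchar \<Rightarrow> 'r) \<Rightarrow> (('g \<times> 'g, 'a) subchar \<Rightarrow> 'r)" where
  "RS_act R l A F G = (\<lambda>(f, g) \<phi>.
     RS_comp R l A F G G
       (RS_comp R l A F F G (sigma R A F (grp_sym R F f)) \<phi>)
       (sigma R A G (grp_sym R G (inv\<^bsub>G\<^esub> g))))"

definition RSbar_hom ::
    "('r, 'x) ring_scheme \<Rightarrow> (nat \<Rightarrow> 'r) \<Rightarrow> ('a, 'z) monoid_scheme \<Rightarrow> 'g monoid \<Rightarrow> 'g monoid \<Rightarrow>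
      ('r, ('g \<times> 'g, 'a) subchar \<Rightarrow> 'r) module" where
  "RSbar_hom R l A F G = (RS_hom R A F G)\<lparr>carrier :=
     {\<phi> \<in> carrier (RS_hom R A F G). \<forall>x \<in> carrier (F \<times>\<times> G). RS_act R l A F G x \<phi> = \<phi>}\<rparr>"

definition RSbar ::
    "('r, 'x) ring_scheme \<Rightarrow> (nat \<Rightarrow> 'r) \<Rightarrow> ('a, 'z) monoid_scheme \<Rightarrow> 'g monoid set \<Rightarrow>
      ('g monoid, 'r, ('g \<times> 'g, 'a) subchar \<Rightarrow> 'r) lincat" where
  "RSbar R l A \<G> = (RS R l A \<G>)\<lparr>Hom := RSbar_hom R l A,
     Ident := (\<lambda>G. sigma R A G (e_idem R G))\<rparr>"

definition sbar ::
    "('r, 'x) ring_scheme \<Rightarrow> (nat \<Rightarrow> 'r) \<Rightarrow> ('a, 'z) monoid_scheme \<Rightarrow> 'g monoid \<Rightarrow> 'g monoid \<Rightarrow>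
      ('g \<times> 'g, 'a) subchar \<Rightarrow> (('g \<times> 'g, 'a) subchar \<Rightarrow> 'r)" where
  "sbar R l A F G u =
     RS_comp R l A F G G
       (RS_comp R l A F F G (sigma R A F (e_idem R F)) (s_sym R A F G u))
       (sigma R A G (e_idem R G))"


section \<open>The structure on orbits of subcharacters\<close>

definition RB_hom ::
    "('r, 'x) ring_scheme \<Rightarrow> ('a, 'z) monoid_scheme \<Rightarrow> 'g monoid \<Rightarrow> 'g monoid \<Rightarrow>
      ('r, ('g \<times> 'g, 'a) subchar set \<Rightarrow> 'r) module" where
  "RB_hom R A F G = free_module R (SA_orbits A F G)"

definition d_sym ::
    "('r, 'x) ring_scheme \<Rightarrow> ('a, 'z) monoid_scheme \<Rightarrow> 'g monoid \<Rightarrow> 'g monoid \<Rightarrow>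
      ('g \<times> 'g, 'a) subchar \<Rightarrow> (('g \<times> 'g, 'a) subchar set \<Rightarrow> 'r)" where
  "d_sym R A F G u = symbol R (SA_orbits A F G) (orbit_of F G u)"

definition double_coset_reps :: "'g monoid \<Rightarrow> 'g set \<Rightarrow> 'g set \<Rightarrow> 'g set \<Rightarrow> bool" where
  "double_coset_reps G P Q D \<longleftrightarrow>
     D \<subseteq> carrier G \<and> (\<forall>x \<in> carrier G. \<exists>!g. g \<in> D \<and> g \<in> (P #>\<^bsub>G\<^esub> x) <#>\<^bsub>G\<^esub> Q)"

definition d_prod ::
    "('r, 'x) ring_scheme \<Rightarrow> (nat \<Rightarrow> 'r) \<Rightarrow> ('a, 'z) monoid_scheme \<Rightarrow>
      'g monoid \<Rightarrow> 'g monoid \<Rightarrow> 'g monoid \<Rightarrow> 'g set \<Rightarrow>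
      ('g \<times> 'g, 'a) subchar \<Rightarrow> ('g \<times> 'g, 'a) subchar \<Rightarrow>
      (('g \<times> 'g, 'a) subchar set \<Rightarrow> 'r)" where
  "d_prod R l A F G H D u v =
    (let cv = (\<lambda>g. conj_subchar (G \<times>\<times> H) (g, \<one>\<^bsub>H\<^esub>) v);
         n = (\<lambda>g. card (Gamma_cap F G H (fst u) (fst (cv g))))
     in finsum (RB_hom R A F H)
          (\<lambda>g. (l (n g) \<otimes>\<^bsub>R\<^esub> inv\<^bsub>R\<^esub> (of_nat_in R (n g)))
                 \<odot>\<^bsub>RB_hom R A F H\<^esub> d_sym R A F H (star A u (cv g)))
          {g \<in> D. compatible A F G H u (cv g)})"

text \<open>The product of two orbit symbols is the common value of \<^const>\<open>d_prod\<close> for all choices of orbit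
  representatives and of double coset representatives.\<close>

definition RB_comp ::
    "('r, 'x) ring_scheme \<Rightarrow> (nat \<Rightarrow> 'r) \<Rightarrow> ('a, 'z) monoid_scheme \<Rightarrow>
      'g monoid \<Rightarrow> 'g monoid \<Rightarrow> 'g monoid \<Rightarrow>
      (('g \<times> 'g, 'a) subchar set \<Rightarrow> 'r) \<Rightarrow> (('g \<times> 'g, 'a) subchar set \<Rightarrow> 'r) \<Rightarrow>
      (('g \<times> 'g, 'a) subchar set \<Rightarrow> 'r)" where
  "RB_comp R l A F G H = bilinear_ext R (SA_orbits A F G) (SA_orbits A G H) (RB_hom R A F H)
     (\<lambda>X Y. THE z. \<forall>u\<in>X. \<forall>v\<in>Y. \<forall>D.
        double_coset_reps G (snd ` fst u) (fst ` fst v) D \<longrightarrow> z = d_prod R l A F G H D u v)"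

text \<open>No identities are given in advance: \<open>Ident\<close> is whatever two-sided identity there is, so that
  its existence is part of the assertion that \<open>RB\<close> is a category.\<close>

definition RB ::
    "('r, 'x) ring_scheme \<Rightarrow> (nat \<Rightarrow> 'r) \<Rightarrow> ('a, 'z) monoid_scheme \<Rightarrow> 'g monoid set \<Rightarrow>
      ('g monoid, 'r, ('g \<times> 'g, 'a) subchar set \<Rightarrow> 'r) lincat" where
  "RB R l A \<G> = \<lparr>Ob = \<G>, Hom = RB_hom R A, Comp = RB_comp R l A,
     Ident = (\<lambda>G. THE e. e \<in> carrier (RB_hom R A G G) \<and>
       (\<forall>F\<in>\<G>. (\<forall>\<phi>\<in>carrier (RB_hom R A G F). RB_comp R l A G G F e \<phi> = \<phi>) \<and>
               (\<forall>\<phi>\<in>carrier (RB_hom R A F G). RB_comp R l A F G G \<phi> e = \<phi>)))\<rparr>"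

text \<open>Both \<open>|U|\<close> and \<^const>\<open>sbar\<close> depend only on the orbit, so \<open>THE\<close> denotes their common
  value on the orbit \<open>X\<close>.\<close>

definition nu_map ::
    "('r, 'x) ring_scheme \<Rightarrow> (nat \<Rightarrow> 'r) \<Rightarrow> ('a, 'z) monoid_scheme \<Rightarrow> 'g monoid \<Rightarrow> 'g monoid \<Rightarrow>
      (('g \<times> 'g, 'a) subchar set \<Rightarrow> 'r) \<Rightarrow> (('g \<times> 'g, 'a) subchar \<Rightarrow> 'r)" where
  "nu_map R l A F G = linear_ext R (SA_orbits A F G) (RSbar_hom R l A F G)
     (\<lambda>X. THE z. \<forall>u\<in>X. z =
        (of_nat_in R (order G) \<otimes>\<^bsub>R\<^esub> inv\<^bsub>R\<^esub> (of_nat_in R (card (fst u))))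
          \<odot>\<^bsub>RSbar_hom R l A F G\<^esub> sbar R l A F G u)"

end

theory Submission
  imports Defs
begin

text \<open>The morphisms of the invariant category are the elements fixed by multiplication with the
  images \<open>\<sigma>(g)\<close> of group elements on either side, and averaging \<open>\<phi> \<mapsto> \<sigma>(e\<^sub>F) \<phi> \<sigma>(e\<^sub>G)\<close> projects onto
  them.  Averaging \<open>s\<^sub>u\<close> and passing from \<open>u\<close> to its orbit symbol lose the same information, namely
  the position of \<open>u\<close> in its orbit.  So \<open>\<nu>\<close> has an explicit inverse: send \<open>s\<^sub>u\<close> to
  \<open>|U| / |G|\<close> times the symbol of the orbit of \<open>u = (U, \<mu>)\<close>, and restrict this map to the invariant
  elements.  Both composites can be evaluated on symbols (\<open>orbit_map_nu\<close>, \<open>nu_orbit_map\<close>), and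
  no orbit has to be counted.

  For the composition, write \<open>\<^bold>s\<^sub>u\<close> for the average of \<open>s\<^sub>u\<close>.  As \<open>\<sigma>(e\<^sub>G)\<close> is idempotent,
  \<open>\<^bold>s\<^sub>u \<^bold>s\<^sub>v\<close> is \<open>1 / |G|\<close> times the sum over \<open>x \<in> G\<close> of the averages of \<open>s\<^sub>u s\<^sub>x\<^sub>v\<close>, where \<open>xv\<close> is the
  conjugate of \<open>v\<close> by \<open>x\<close> (\<open>cmp_sbar_sbar\<close>).  If \<open>(f, p) \<in> U\<close>, then \<open>(f, p)\<close> fixes \<open>u\<close>, whence
  \<open>s\<^sub>u \<sigma>(p) = \<sigma>(f) s\<^sub>u\<close>, and \<open>\<sigma>(f)\<close> disappears in the average.  With the same remark for \<open>V\<close>, the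
  summand depends only on the double coset of \<open>x\<close> with respect to \<open>P\<close>, the second projection of \<open>U\<close>,
  and \<open>Q\<close>, the first projection of \<open>V\<close> (\<open>twisted_product_double_coset\<close>).  Collecting equal terms, a
  representative \<open>g\<close> is counted \<open>|PgQ|\<close> times.  The identity
  \<open>|U| |V| = |\<Gamma>| |U * W| |PgQ|\<close>, where \<open>W\<close> is the conjugate of \<open>V\<close> by \<open>g\<close> and \<open>\<Gamma>\<close> the intersection
  group of \<open>U\<close> and \<open>W\<close> (\<open>card_double_coset\<close>), turns the resulting coefficients into those in the
  definition of the product of two orbit symbols (\<open>nu_d_prod\<close>).  It also follows that this product
  is independent of all choices: its image under the injective map \<open>\<nu>\<close> depends only on the orbits.

  Composition of subcharacters is associative because either bracketing of a triple is governed by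
  the same group \<open>L\<close> of pairs \<open>(g, h)\<close> with \<open>(1, g) \<in> U\<close>, \<open>(g, h) \<in> V\<close>, \<open>(h, 1) \<in> W\<close>.  The
  compatibility conditions amount to a single condition on \<open>L\<close>, and the two numbers to which \<open>\<ell>\<close> is
  applied multiply to \<open>|L|\<close> (\<open>cmp_assoc_symbols\<close>).  So the invariant category is a linear category,
  and its structure is carried over to the orbit symbols along the bijection \<open>\<nu>\<close>
  (\<open>transport_linear_category\<close>).\<close>

section \<open>Linear maps and free modules\<close>

lemma linear_mapsI:
  assumes "\<And>x. x \<in> carrier M \<Longrightarrow> f x \<in> carrier N"
    and "\<And>x y. \<lbrakk>x \<in> carrier M; y \<in> carrier M\<rbrakk> \<Longrightarrow> f (x \<oplus>\<^bsub>M\<^esub> y) = f x \<oplus>\<^bsub>N\<^esub> f y"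
    and "\<And>r x. \<lbrakk>r \<in> carrier R; x \<in> carrier M\<rbrakk> \<Longrightarrow> f (r \<odot>\<^bsub>M\<^esub> x) = r \<odot>\<^bsub>N\<^esub> f x"
  shows "f \<in> linear_maps R M N"
  using assms unfolding linear_maps_def by auto

lemma linear_mapsD:
  assumes "f \<in> linear_maps R M N"
  shows "x \<in> carrier M \<Longrightarrow> f x \<in> carrier N"
    and "\<lbrakk>x \<in> carrier M; y \<in> carrier M\<rbrakk> \<Longrightarrow> f (x \<oplus>\<^bsub>M\<^esub> y) = f x \<oplus>\<^bsub>N\<^esub> f y"
    and "\<lbrakk>r \<in> carrier R; x \<in> carrier M\<rbrakk> \<Longrightarrow> f (r \<odot>\<^bsub>M\<^esub> x) = r \<odot>\<^bsub>N\<^esub> f x"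
  using assms unfolding linear_maps_def by auto

lemma linear_maps_comp:
  assumes "f \<in> linear_maps R M N" "g \<in> linear_maps R N P"
  shows "(\<lambda>x. g (f x)) \<in> linear_maps R M P"
  by (rule linear_mapsI) (simp_all add: linear_mapsD[OF assms(1)] linear_mapsD[OF assms(2)])

lemma linear_maps_zero:
  assumes "module R M" "module R N" "f \<in> linear_maps R M N"
  shows "f \<zero>\<^bsub>M\<^esub> = \<zero>\<^bsub>N\<^esub>"
proof -
  interpret M: module R M by fact
  interpret N: module R N by fact
  have "f (\<zero>\<^bsub>R\<^esub> \<odot>\<^bsub>M\<^esub> \<zero>\<^bsub>M\<^esub>) = \<zero>\<^bsub>R\<^esub> \<odot>\<^bsub>N\<^esub> f \<zero>\<^bsub>M\<^esub>"
    by (rule linear_mapsD(3)[OF assms(3)]) auto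
  thus ?thesis using linear_mapsD(1)[OF assms(3), of "\<zero>\<^bsub>M\<^esub>"] by simp
qed

lemma linear_maps_finsum:
  assumes "module R M" "module R N" "f \<in> linear_maps R M N" "g \<in> I \<rightarrow> carrier M"
  shows "f (finsum M g I) = finsum N (\<lambda>i. f (g i)) I"
proof -
  interpret M: module R M by fact
  interpret N: module R N by fact
  note f = linear_mapsD[OF assms(3)]
  show ?thesis
  proof (cases "finite I")
    case True
    thus ?thesis using assms(4)
    proof (induction I)
      case empty
      show ?case by (simp add: linear_maps_zero[OF assms(1-3)])
    next
      case (insert i I)
      hence "g \<in> I \<rightarrow> carrier M" "g i \<in> carrier M" by auto
      moreover from this have "(\<lambda>i. f (g i)) \<in> I \<rightarrow> carrier N" using f(1) by auto
      ultimately show ?case using insert by (simp add: f)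
    qed
  next
    case False
    thus ?thesis by (simp add: linear_maps_zero[OF assms(1-3)])
  qed
qed

lemma linear_maps_finsum_pointwise:
  assumes "module R M" "module R N" "finite I" "\<And>i. i \<in> I \<Longrightarrow> h i \<in> linear_maps R M N"
  shows "(\<lambda>x. finsum N (\<lambda>i. h i x) I) \<in> linear_maps R M N"
proof -
  interpret M: module R M by fact
  interpret N: module R N by fact
  have c: "(\<lambda>i. h i x) \<in> I \<rightarrow> carrier N" if "x \<in> carrier M" for x
    using linear_mapsD(1)[OF assms(4)] that by auto
  show ?thesis
  proof (rule linear_mapsI)
    fix x assume "x \<in> carrier M"
    thus "finsum N (\<lambda>i. h i x) I \<in> carrier N" using c by simp
  next
    fix x y assume xy: "x \<in> carrier M" "y \<in> carrier M"
    have "finsum N (\<lambda>i. h i (x \<oplus>\<^bsub>M\<^esub> y)) I = finsum N (\<lambda>i. h i x \<oplus>\<^bsub>N\<^esub> h i y) I"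
      using xy c by (intro N.finsum_cong') (auto simp: linear_mapsD[OF assms(4)])
    also have "\<dots> = finsum N (\<lambda>i. h i x) I \<oplus>\<^bsub>N\<^esub> finsum N (\<lambda>i. h i y) I"
      using c xy by (intro N.finsum_addf) auto
    finally show "finsum N (\<lambda>i. h i (x \<oplus>\<^bsub>M\<^esub> y)) I
      = finsum N (\<lambda>i. h i x) I \<oplus>\<^bsub>N\<^esub> finsum N (\<lambda>i. h i y) I" .
  next
    fix r x assume rx: "r \<in> carrier R" "x \<in> carrier M"
    have "finsum N (\<lambda>i. h i (r \<odot>\<^bsub>M\<^esub> x)) I = finsum N (\<lambda>i. r \<odot>\<^bsub>N\<^esub> h i x) I"
      using rx by (intro N.finsum_cong') (auto simp: linear_mapsD[OF assms(4)])
    also have "\<dots> = r \<odot>\<^bsub>N\<^esub> finsum N (\<lambda>i. h i x) I"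
      using c rx assms(3) by (intro N.finsum_smult_ldistr[symmetric]) auto
    finally show "finsum N (\<lambda>i. h i (r \<odot>\<^bsub>M\<^esub> x)) I = r \<odot>\<^bsub>N\<^esub> finsum N (\<lambda>i. h i x) I" .
  qed
qed

lemma linear_maps_smult:
  assumes "module R M" "module R N" "r \<in> carrier R" "h \<in> linear_maps R M N"
  shows "(\<lambda>x. r \<odot>\<^bsub>N\<^esub> h x) \<in> linear_maps R M N"
proof -
  interpret M: module R M by fact
  interpret N: module R N by fact
  show ?thesis
    using assms(3) by (intro linear_mapsI)
      (auto simp: linear_mapsD[OF assms(4)] N.smult_r_distr N.smult_assoc1[symmetric] M.m_comm)
qed

lemma linear_maps_linear_comb:
  assumes "module R M" "module R N" "finite I" "c \<in> I \<rightarrow> carrier R"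
    "\<And>i. i \<in> I \<Longrightarrow> h i \<in> linear_maps R M N"
  shows "(\<lambda>x. finsum N (\<lambda>i. c i \<odot>\<^bsub>N\<^esub> h i x) I) \<in> linear_maps R M N"
  using assms by (intro linear_maps_finsum_pointwise linear_maps_smult) auto

lemma of_nat_in_smult:
  assumes "module R M" "x \<in> carrier M"
  shows "of_nat_in R n \<odot>\<^bsub>M\<^esub> x = [n] \<cdot>\<^bsub>M\<^esub> x"
proof -
  interpret M: module R M by fact
  show ?thesis using assms(2)
    by (induction n) (simp_all add: of_nat_in_def M.smult_l_distr)
qed

lemma finsum_constant:
  assumes "module R M" "x \<in> carrier M"
  shows "finsum M (\<lambda>_. x) I = of_nat_in R (card I) \<odot>\<^bsub>M\<^esub> x"
proof -
  interpret M: module R M by fact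
  show ?thesis using assms M.add.finprod_const[of x I] by (simp add: of_nat_in_smult)
qed

context cring
begin

lemma of_nat_in_closed [simp]: "of_nat_in R n \<in> carrier R"
  by (simp add: of_nat_in_def)

lemma of_nat_in_mult: "of_nat_in R (m * n) = of_nat_in R m \<otimes> of_nat_in R n"
  unfolding of_nat_in_def by (simp add: add_pow_ldistr add.nat_pow_pow mult.commute)

lemma inv_mult_eq_inv:
  assumes "a \<in> Units R" "b \<in> Units R" "p \<in> carrier R" "a = b \<otimes> p"
  shows "inv a \<otimes> p = inv b"
proof -
  have "p \<otimes> b = a" using assms m_comm[of p b] Units_closed[of b] by simp
  hence "inv a \<otimes> p \<otimes> b = inv a \<otimes> a" using assms(1-3) by (simp only: m_assoc Units_closed Units_inv_closed)
  also have "\<dots> = \<one>" using assms(1) by (rule Units_l_inv)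
  finally have 1: "inv a \<otimes> p \<otimes> b = \<one>" .
  have cl: "inv a \<otimes> p \<in> carrier R" "b \<in> carrier R" using assms by auto
  have "inv b = inv a \<otimes> p"
    using 1 cl by (intro comm_inv_char) (simp_all add: m_comm)
  thus ?thesis by simp
qed

lemma free_module_simps [simp]:
  shows "\<zero>\<^bsub>free_module R S\<^esub> = (\<lambda>s\<in>S. \<zero>)"
    and "\<phi> \<oplus>\<^bsub>free_module R S\<^esub> \<psi> = (\<lambda>s\<in>S. \<phi> s \<oplus> \<psi> s)"
    and "r \<odot>\<^bsub>free_module R S\<^esub> \<phi> = (\<lambda>s\<in>S. r \<otimes> \<phi> s)"
  by (simp_all add: free_module_def)

lemma free_module_carrier:
  "\<phi> \<in> carrier (free_module R S) \<longleftrightarrow> \<phi> \<in> S \<rightarrow>\<^sub>E carrier R \<and> finite (support R S \<phi>)"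
  by (simp add: free_module_def)

lemma free_module_coeff: "\<lbrakk>\<phi> \<in> carrier (free_module R S); s \<in> S\<rbrakk> \<Longrightarrow> \<phi> s \<in> carrier R"
  by (auto simp: free_module_carrier)

lemma free_module_eqI:
  assumes "\<phi> \<in> carrier (free_module R S)" "\<psi> \<in> carrier (free_module R S)"
    "\<And>s. s \<in> S \<Longrightarrow> \<phi> s = \<psi> s"
  shows "\<phi> = \<psi>"
  using assms by (auto simp: free_module_carrier intro: PiE_ext)

lemma free_module_add_closed:
  assumes "\<phi> \<in> carrier (free_module R S)" "\<psi> \<in> carrier (free_module R S)"
  shows "(\<lambda>s\<in>S. \<phi> s \<oplus> \<psi> s) \<in> carrier (free_module R S)"
proof -
  have "support R S (\<lambda>s\<in>S. \<phi> s \<oplus> \<psi> s) \<subseteq> support R S \<phi> \<union> support R S \<psi>"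
    unfolding support_def by auto
  thus ?thesis using assms unfolding free_module_carrier
    by (auto intro: finite_subset)
qed

lemma free_module_smult_closed:
  assumes "r \<in> carrier R" "\<phi> \<in> carrier (free_module R S)"
  shows "(\<lambda>s\<in>S. r \<otimes> \<phi> s) \<in> carrier (free_module R S)"
proof -
  have "support R S (\<lambda>s\<in>S. r \<otimes> \<phi> s) \<subseteq> support R S \<phi>"
    unfolding support_def using assms(1) by auto
  thus ?thesis using assms unfolding free_module_carrier
    by (auto intro: finite_subset)
qed

lemma module_free_module: "module R (free_module R S)"
proof (rule moduleI)
  note closed = free_module_add_closed free_module_smult_closed
  have zero: "(\<lambda>s\<in>S. \<zero>) \<in> carrier (free_module R S)"
    by (auto simp: free_module_carrier support_def)
  show "cring R" by (rule is_cring)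
  show "abelian_group (free_module R S)"
  proof (rule abelian_groupI)
    show "\<zero>\<^bsub>free_module R S\<^esub> \<in> carrier (free_module R S)" using zero by simp
    fix x assume x: "x \<in> carrier (free_module R S)"
    have "(\<lambda>s\<in>S. (\<ominus> \<one>) \<otimes> x s) \<in> carrier (free_module R S)"
      using x by (intro closed) auto
    moreover have "(\<lambda>s\<in>S. (\<ominus> \<one>) \<otimes> x s) \<oplus>\<^bsub>free_module R S\<^esub> x = \<zero>\<^bsub>free_module R S\<^esub>"
      using x by (auto simp: fun_eq_iff l_minus l_neg free_module_coeff)
    ultimately show "\<exists>y\<in>carrier (free_module R S). y \<oplus>\<^bsub>free_module R S\<^esub> x = \<zero>\<^bsub>free_module R S\<^esub>"
      by blast
    show "\<zero>\<^bsub>free_module R S\<^esub> \<oplus>\<^bsub>free_module R S\<^esub> x = x"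
      using x zero closed(1)[OF zero x]
      by (intro free_module_eqI[of _ S]) (simp_all add: free_module_coeff)
  qed (auto simp: closed fun_eq_iff free_module_coeff a_assoc a_comm a_lcomm)
  show "\<one> \<odot>\<^bsub>free_module R S\<^esub> x = x" if "x \<in> carrier (free_module R S)" for x
    using that closed(2)[OF one_closed that]
    by (intro free_module_eqI[of _ S]) (simp_all add: free_module_coeff)
qed (auto simp: free_module_add_closed free_module_smult_closed fun_eq_iff free_module_coeff
       l_distr r_distr m_assoc)

lemma symbol_closed [simp]: "symbol R S s \<in> carrier (free_module R S)"
proof -
  have "support R S (symbol R S s) \<subseteq> {s}"
    by (auto simp: support_def symbol_def)
  thus ?thesis by (auto simp: free_module_carrier symbol_def intro: finite_subset)
qed

text \<open>A linear map on a free module is determined on the symbols: peel off the entries of a finite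
  set containing the support one at a time.\<close>

lemma linear_maps_free_eqI:
  assumes "module R M" "f \<in> linear_maps R (free_module R S) M"
    "g \<in> linear_maps R (free_module R S) M"
    "\<And>s. s \<in> S \<Longrightarrow> f (symbol R S s) = g (symbol R S s)"
    "\<phi> \<in> carrier (free_module R S)"
  shows "f \<phi> = g \<phi>"
proof -
  interpret M: module R "free_module R S" by (rule module_free_module)
  note f = linear_mapsD[OF assms(2)] and g = linear_mapsD[OF assms(3)]
  have "\<forall>\<phi>\<in>carrier (free_module R S). support R S \<phi> \<subseteq> B \<longrightarrow> f \<phi> = g \<phi>" if "finite B" for B
    using that
  proof induction
    case empty
    show ?case
    proof (intro ballI impI)
      fix \<phi> assume "\<phi> \<in> carrier (free_module R S)" "support R S \<phi> \<subseteq> {}"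
      hence "\<phi> = \<zero>\<^bsub>free_module R S\<^esub>"
        using M.zero_closed by (intro free_module_eqI[of _ S]) (auto simp: support_def)
      thus "f \<phi> = g \<phi>"
        using linear_maps_zero[OF module_free_module assms(1,2)]
          linear_maps_zero[OF module_free_module assms(1,3)] by simp
    qed
  next
    case (insert b B)
    show ?case
    proof (intro ballI impI)
      fix \<phi> assume \<phi>: "\<phi> \<in> carrier (free_module R S)" "support R S \<phi> \<subseteq> insert b B"
      show "f \<phi> = g \<phi>"
      proof (cases "b \<in> S")
        case False
        hence "support R S \<phi> \<subseteq> B" using \<phi>(2) by (auto simp: support_def)
        thus ?thesis using insert.IH \<phi> by blast
      next
        case b: True
        define \<psi> where "\<psi> = (\<lambda>s\<in>S. if s = b then \<zero> else \<phi> s)"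
        have "support R S \<psi> \<subseteq> support R S \<phi>" by (auto simp: support_def \<psi>_def)
        hence \<psi>: "\<psi> \<in> carrier (free_module R S)"
          using \<phi>(1) by (auto simp: free_module_carrier \<psi>_def intro: finite_subset)
        have "support R S \<psi> \<subseteq> B" using \<phi>(2) by (auto simp: support_def \<psi>_def)
        hence eq: "f \<psi> = g \<psi>" using insert.IH \<psi> by blast
        have \<phi>b: "\<phi> b \<in> carrier R" using b \<phi> by (simp add: free_module_coeff)
        hence cl: "\<phi> b \<odot>\<^bsub>free_module R S\<^esub> symbol R S b \<in> carrier (free_module R S)"
          by (intro M.smult_closed) auto
        have "\<phi> = \<psi> \<oplus>\<^bsub>free_module R S\<^esub> \<phi> b \<odot>\<^bsub>free_module R S\<^esub> symbol R S b"
          using \<phi> b M.add.m_closed[OF \<psi> cl]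
          by (intro free_module_eqI[of _ S]) (auto simp: \<psi>_def symbol_def free_module_coeff)
        moreover have "f (\<psi> \<oplus>\<^bsub>free_module R S\<^esub> \<phi> b \<odot>\<^bsub>free_module R S\<^esub> symbol R S b)
          = g (\<psi> \<oplus>\<^bsub>free_module R S\<^esub> \<phi> b \<odot>\<^bsub>free_module R S\<^esub> symbol R S b)"
          using \<psi> cl \<phi>b b by (simp only: f(2,3) g(2,3) eq assms(4) symbol_closed)
        ultimately show ?thesis by simp
      qed
    qed
  qed
  thus ?thesis using assms(5) by (auto simp: free_module_carrier)
qed

text \<open>The sum in \<^const>\<open>linear_ext\<close> runs over the support, which varies with the argument.  To compare
  two arguments one sums over a common finite set containing both supports.\<close>

lemma linear_ext_superset:
  assumes "module R M" "f \<in> S \<rightarrow> carrier M" "finite B" "support R S \<phi> \<subseteq> B" "B \<subseteq> S"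
    "\<phi> \<in> carrier (free_module R S)"
  shows "linear_ext R S M f \<phi> = finsum M (\<lambda>s. \<phi> s \<odot>\<^bsub>M\<^esub> f s) B"
proof -
  interpret M: module R M by fact
  show ?thesis unfolding linear_ext_def
  proof (rule M.add.finprod_mono_neutral_cong_left)
    show "(\<lambda>s. \<phi> s \<odot>\<^bsub>M\<^esub> f s) \<in> B \<rightarrow> carrier M"
      using assms(2,5) by (intro Pi_I M.smult_closed free_module_coeff[OF assms(6)]) auto
    show "\<phi> i \<odot>\<^bsub>M\<^esub> f i = \<zero>\<^bsub>M\<^esub>" if "i \<in> B - support R S \<phi>" for i
    proof -
      have "i \<in> S" "\<phi> i = \<zero>" using that assms(5) by (auto simp: support_def)
      thus ?thesis using Pi_mem[OF assms(2)] by simp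
    qed
  qed (use assms in auto)
qed

lemma linear_ext_linear:
  assumes "module R M" "f \<in> S \<rightarrow> carrier M"
  shows "linear_ext R S M f \<in> linear_maps R (free_module R S) M"
proof -
  interpret M: module R M by fact
  interpret S: module R "free_module R S" by (rule module_free_module)
  let ?t = "\<lambda>\<phi> s. \<phi> s \<odot>\<^bsub>M\<^esub> f s"
  have fM: "f s \<in> carrier M" if "s \<in> S" for s using assms(2) that by auto
  have supp: "finite (support R S \<phi>)" "support R S \<phi> \<subseteq> S" if "\<phi> \<in> carrier (free_module R S)" for \<phi>
    using that by (auto simp: free_module_carrier support_def)
  have t: "?t \<phi> \<in> B \<rightarrow> carrier M" if "\<phi> \<in> carrier (free_module R S)" "B \<subseteq> S" for \<phi> B
    using that(2) assms(2) by (intro Pi_I M.smult_closed free_module_coeff[OF that(1)]) auto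
  show ?thesis
  proof (rule linear_mapsI)
    fix \<phi> assume "\<phi> \<in> carrier (free_module R S)"
    thus "linear_ext R S M f \<phi> \<in> carrier M"
      unfolding linear_ext_def using t supp by simp
  next
    fix \<phi> \<psi> assume \<phi>: "\<phi> \<in> carrier (free_module R S)" and \<psi>: "\<psi> \<in> carrier (free_module R S)"
    define B where "B = support R S \<phi> \<union> support R S \<psi>"
    have B: "finite B" "B \<subseteq> S" using supp[OF \<phi>] supp[OF \<psi>] by (auto simp: B_def)
    have s: "support R S (\<phi> \<oplus>\<^bsub>free_module R S\<^esub> \<psi>) \<subseteq> B"
      by (auto simp: support_def B_def)
    have "linear_ext R S M f (\<phi> \<oplus>\<^bsub>free_module R S\<^esub> \<psi>) = finsum M (?t (\<phi> \<oplus>\<^bsub>free_module R S\<^esub> \<psi>)) B"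
      using \<phi> \<psi> B s assms by (intro linear_ext_superset) (auto simp del: free_module_simps)
    also have "\<dots> = finsum M (\<lambda>s. ?t \<phi> s \<oplus>\<^bsub>M\<^esub> ?t \<psi> s) B"
      using B(2) fM t[OF \<phi> B(2)] t[OF \<psi> B(2)] free_module_coeff[OF \<phi>] free_module_coeff[OF \<psi>]
      by (intro M.finsum_cong') (auto simp: M.smult_l_distr)
    also have "\<dots> = finsum M (?t \<phi>) B \<oplus>\<^bsub>M\<^esub> finsum M (?t \<psi>) B"
      using B t[OF \<phi>] t[OF \<psi>] by (intro M.finsum_addf) auto
    also have "finsum M (?t \<phi>) B = linear_ext R S M f \<phi>"
      using \<phi> B assms by (intro linear_ext_superset[symmetric]) (auto simp: B_def)
    also have "finsum M (?t \<psi>) B = linear_ext R S M f \<psi>"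
      using \<psi> B assms by (intro linear_ext_superset[symmetric]) (auto simp: B_def)
    finally show "linear_ext R S M f (\<phi> \<oplus>\<^bsub>free_module R S\<^esub> \<psi>)
      = linear_ext R S M f \<phi> \<oplus>\<^bsub>M\<^esub> linear_ext R S M f \<psi>" .
  next
    fix r \<phi> assume r: "r \<in> carrier R" and \<phi>: "\<phi> \<in> carrier (free_module R S)"
    define B where "B = support R S \<phi>"
    have B: "finite B" "B \<subseteq> S" using supp[OF \<phi>] by (auto simp: B_def)
    have s: "support R S (r \<odot>\<^bsub>free_module R S\<^esub> \<phi>) \<subseteq> B"
      using r by (auto simp: support_def B_def)
    have "linear_ext R S M f (r \<odot>\<^bsub>free_module R S\<^esub> \<phi>) = finsum M (?t (r \<odot>\<^bsub>free_module R S\<^esub> \<phi>)) B"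
      using \<phi> r B s assms by (intro linear_ext_superset) (auto simp del: free_module_simps)
    also have "\<dots> = finsum M (\<lambda>s. r \<odot>\<^bsub>M\<^esub> ?t \<phi> s) B"
      using B(2) fM t[OF \<phi> B(2)] free_module_coeff[OF \<phi>] r
      by (intro M.finsum_cong') (auto simp: M.smult_assoc1)
    also have "\<dots> = r \<odot>\<^bsub>M\<^esub> finsum M (?t \<phi>) B"
      using B t[OF \<phi>] r by (intro M.finsum_smult_ldistr[symmetric]) auto
    finally show "linear_ext R S M f (r \<odot>\<^bsub>free_module R S\<^esub> \<phi>) = r \<odot>\<^bsub>M\<^esub> linear_ext R S M f \<phi>"
      by (simp add: linear_ext_def B_def)
  qed
qed

lemma linear_ext_symbol:
  assumes "module R M" "f \<in> S \<rightarrow> carrier M" "s \<in> S"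
  shows "linear_ext R S M f (symbol R S s) = f s"
proof -
  interpret M: module R M by fact
  have fs: "f s \<in> carrier M" using assms by auto
  have "linear_ext R S M f (symbol R S s) = finsum M (\<lambda>t. symbol R S s t \<odot>\<^bsub>M\<^esub> f t) {s}"
    using assms symbol_closed[of S s] by (intro linear_ext_superset) (auto simp: support_def symbol_def)
  thus ?thesis using assms(3) fs by (simp add: symbol_def)
qed

lemma bilinear_ext_linear:
  assumes "module R M" "\<And>s t. \<lbrakk>s \<in> S; t \<in> T\<rbrakk> \<Longrightarrow> f s t \<in> carrier M"
  shows "\<psi> \<in> carrier (free_module R T) \<Longrightarrow>
      (\<lambda>\<phi>. bilinear_ext R S T M f \<phi> \<psi>) \<in> linear_maps R (free_module R S) M"
    and "\<phi> \<in> carrier (free_module R S) \<Longrightarrow>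
      (\<lambda>\<psi>. bilinear_ext R S T M f \<phi> \<psi>) \<in> linear_maps R (free_module R T) M"
proof -
  have lin: "linear_ext R T M (f s) \<in> linear_maps R (free_module R T) M" if "s \<in> S" for s
    using assms that by (intro linear_ext_linear) auto
  show "(\<lambda>\<phi>. bilinear_ext R S T M f \<phi> \<psi>) \<in> linear_maps R (free_module R S) M"
    if "\<psi> \<in> carrier (free_module R T)"
    unfolding bilinear_ext_def
    using linear_mapsD(1)[OF lin that] assms(1) by (intro linear_ext_linear) auto
  show "(\<lambda>\<psi>. bilinear_ext R S T M f \<phi> \<psi>) \<in> linear_maps R (free_module R T) M"
    if "\<phi> \<in> carrier (free_module R S)"
    unfolding bilinear_ext_def linear_ext_def[of R S]
    using that lin assms(1) module_free_module
    by (intro linear_maps_linear_comb) (auto simp: free_module_carrier support_def)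
qed

lemma bilinear_ext_symbol:
  assumes "module R M" "\<And>s t. \<lbrakk>s \<in> S; t \<in> T\<rbrakk> \<Longrightarrow> f s t \<in> carrier M" "s \<in> S" "t \<in> T"
  shows "bilinear_ext R S T M f (symbol R S s) (symbol R T t) = f s t"
proof -
  have "linear_ext R T M (f s) \<in> linear_maps R (free_module R T) M" if "s \<in> S" for s
    using assms that by (intro linear_ext_linear) auto
  hence "(\<lambda>s. linear_ext R T M (f s) (symbol R T t)) \<in> S \<rightarrow> carrier M"
    by (intro Pi_I linear_mapsD(1)[OF _ symbol_closed])
  hence "bilinear_ext R S T M f (symbol R S s) (symbol R T t) = linear_ext R T M (f s) (symbol R T t)"
    unfolding bilinear_ext_def by (rule linear_ext_symbol[OF assms(1) _ assms(3)])
  also have "\<dots> = f s t" using assms by (intro linear_ext_symbol) auto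
  finally show ?thesis .
qed

end

section \<open>Transport of linear categories\<close>

lemma linear_maps_inverse:
  assumes f: "f \<in> linear_maps R M N" and M: "module R M"
    and g: "\<And>y. y \<in> carrier N \<Longrightarrow> g y \<in> carrier M \<and> f (g y) = y"
    and gf: "\<And>x. x \<in> carrier M \<Longrightarrow> g (f x) = x"
  shows "g \<in> linear_maps R N M"
proof (rule linear_mapsI)
  interpret M: module R M by (rule M)
  fix x assume x: "x \<in> carrier N"
  thus "g x \<in> carrier M" using g by blast
  { fix y assume y: "y \<in> carrier N"
    have "f (g x \<oplus>\<^bsub>M\<^esub> g y) = x \<oplus>\<^bsub>N\<^esub> y" using g x y by (simp add: linear_mapsD(2)[OF f])
    thus "g (x \<oplus>\<^bsub>N\<^esub> y) = g x \<oplus>\<^bsub>M\<^esub> g y" using gf[of "g x \<oplus>\<^bsub>M\<^esub> g y"] g x y by simp }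
  { fix r assume r: "r \<in> carrier R"
    have "f (r \<odot>\<^bsub>M\<^esub> g x) = r \<odot>\<^bsub>N\<^esub> x" using g x r by (simp add: linear_mapsD(3)[OF f])
    thus "g (r \<odot>\<^bsub>N\<^esub> x) = r \<odot>\<^bsub>M\<^esub> g x" using gf[of "r \<odot>\<^bsub>M\<^esub> g x"] g x r by simp }
qed

text \<open>Composition in \<open>C\<close> is composition in \<open>D\<close> conjugated by the bijection, so that bilinearity,
  associativity and the unit laws need only be known in \<open>D\<close>.\<close>

lemma transport_linear_category:
  fixes C :: "('o, 'r, 'm) lincat" and D :: "('o, 'r, 'n) lincat"
  assumes D: "linear_category R D" and Ob: "Ob D = Ob C"
    and mod: "\<And>F G. \<lbrakk>F \<in> Ob C; G \<in> Ob C\<rbrakk> \<Longrightarrow> module R (Hom C F G)"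
    and lin: "\<And>F G. \<lbrakk>F \<in> Ob C; G \<in> Ob C\<rbrakk> \<Longrightarrow> \<Phi> F G \<in> linear_maps R (Hom C F G) (Hom D F G)"
    and inv: "\<And>F G \<psi>. \<lbrakk>F \<in> Ob C; G \<in> Ob C; \<psi> \<in> carrier (Hom D F G)\<rbrakk>
      \<Longrightarrow> \<Psi> F G \<psi> \<in> carrier (Hom C F G) \<and> \<Phi> F G (\<Psi> F G \<psi>) = \<psi>"
    and inv': "\<And>F G \<phi>. \<lbrakk>F \<in> Ob C; G \<in> Ob C; \<phi> \<in> carrier (Hom C F G)\<rbrakk>
      \<Longrightarrow> \<Psi> F G (\<Phi> F G \<phi>) = \<phi>"
    and closed: "\<And>F G H \<phi> \<psi>. \<lbrakk>F \<in> Ob C; G \<in> Ob C; H \<in> Ob C;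
        \<phi> \<in> carrier (Hom C F G); \<psi> \<in> carrier (Hom C G H)\<rbrakk>
      \<Longrightarrow> Comp C F G H \<phi> \<psi> \<in> carrier (Hom C F H)"
    and comp: "\<And>F G H \<phi> \<psi>. \<lbrakk>F \<in> Ob C; G \<in> Ob C; H \<in> Ob C;
        \<phi> \<in> carrier (Hom C F G); \<psi> \<in> carrier (Hom C G H)\<rbrakk>
      \<Longrightarrow> \<Phi> F H (Comp C F G H \<phi> \<psi>) = Comp D F G H (\<Phi> F G \<phi>) (\<Phi> G H \<psi>)"
    and ident: "\<And>G. G \<in> Ob C \<Longrightarrow> Ident C G = \<Psi> G G (Ident D G)"
  shows "linear_category R C" and "object_identical_isomorphism R C D \<Phi>"
proof -
  interpret D: linear_category R D by (rule D)
  note \<Phi> = linear_mapsD[OF lin]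
  have lin': "\<Psi> F G \<in> linear_maps R (Hom D F G) (Hom C F G)" if "F \<in> Ob C" "G \<in> Ob C" for F G
    using linear_maps_inverse[OF lin[OF that] mod[OF that]] inv[OF that] inv'[OF that] by blast
  have comp': "Comp C F G H \<phi> \<psi> = \<Psi> F H (Comp D F G H (\<Phi> F G \<phi>) (\<Phi> G H \<psi>))"
    if "F \<in> Ob C" "G \<in> Ob C" "H \<in> Ob C" "\<phi> \<in> carrier (Hom C F G)" "\<psi> \<in> carrier (Hom C G H)"
    for F G H \<phi> \<psi>
    using comp[OF that] inv'[OF that(1,3) closed[OF that]] by simp
  have cong: "f \<in> linear_maps R M N" if "g \<in> linear_maps R M N" "module R M"
    "\<And>x. x \<in> carrier M \<Longrightarrow> f x = g x" for M :: "('r, 'm) module" and N :: "('r, 'm) module" and f g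
  proof -
    interpret M: module R M by (rule that(2))
    show ?thesis using linear_mapsD[OF that(1)] that(3) by (intro linear_mapsI) simp_all
  qed
  show C: "linear_category R C"
  proof (intro linear_category.intro linear_category_axioms.intro)
    show "cring R" by (rule D.is_cring)
  next
    fix F G assume "F \<in> Ob C" "G \<in> Ob C"
    thus "module R (Hom C F G)" by (rule mod)
  next
    fix F G H \<psi> assume ob: "F \<in> Ob C" "G \<in> Ob C" "H \<in> Ob C" and \<psi>: "\<psi> \<in> carrier (Hom C G H)"
    show "(\<lambda>\<phi>. Comp C F G H \<phi> \<psi>) \<in> linear_maps R (Hom C F G) (Hom C F H)"
    proof (rule cong)
      show "(\<lambda>\<phi>. \<Psi> F H (Comp D F G H (\<Phi> F G \<phi>) (\<Phi> G H \<psi>))) \<in> linear_maps R (Hom C F G) (Hom C F H)"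
        using D.comp_linear_left[unfolded Ob, OF ob \<Phi>(1)[OF ob(2,3) \<psi>]]
        by (intro linear_maps_comp[OF _ lin'[OF ob(1,3)]]
            linear_maps_comp[OF lin[OF ob(1,2)], of "\<lambda>x. Comp D F G H x (\<Phi> G H \<psi>)"])
    qed (use mod ob \<psi> comp' in auto)
  next
    fix F G H \<phi> assume ob: "F \<in> Ob C" "G \<in> Ob C" "H \<in> Ob C" and \<phi>: "\<phi> \<in> carrier (Hom C F G)"
    show "(\<lambda>\<psi>. Comp C F G H \<phi> \<psi>) \<in> linear_maps R (Hom C G H) (Hom C F H)"
    proof (rule cong)
      show "(\<lambda>\<psi>. \<Psi> F H (Comp D F G H (\<Phi> F G \<phi>) (\<Phi> G H \<psi>))) \<in> linear_maps R (Hom C G H) (Hom C F H)"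
        using D.comp_linear_right[unfolded Ob, OF ob \<Phi>(1)[OF ob(1,2) \<phi>]]
        by (intro linear_maps_comp[OF _ lin'[OF ob(1,3)]]
            linear_maps_comp[OF lin[OF ob(2,3)], of "\<lambda>x. Comp D F G H (\<Phi> F G \<phi>) x"])
    qed (use mod ob \<phi> comp' in auto)
  next
    show "associative_comp C"
      unfolding associative_comp_def
    proof (intro ballI)
      fix F G H K \<phi> \<psi> \<chi> assume ob: "F \<in> Ob C" "G \<in> Ob C" "H \<in> Ob C" "K \<in> Ob C"
        and m: "\<phi> \<in> carrier (Hom C F G)" "\<psi> \<in> carrier (Hom C G H)" "\<chi> \<in> carrier (Hom C H K)"
      have "Comp D F H K (Comp D F G H (\<Phi> F G \<phi>) (\<Phi> G H \<psi>)) (\<Phi> H K \<chi>)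
        = Comp D F G K (\<Phi> F G \<phi>) (Comp D G H K (\<Phi> G H \<psi>) (\<Phi> H K \<chi>))"
        using D.comp_assoc \<Phi>(1) ob m unfolding associative_comp_def Ob by blast
      thus "Comp C F H K (Comp C F G H \<phi> \<psi>) \<chi> = Comp C F G K \<phi> (Comp C G H K \<psi> \<chi>)"
        using ob m by (simp add: comp'[OF ob(1,3,4) closed[OF ob(1-3) m(1,2)] m(3)]
            comp'[OF ob(1,2,4) m(1) closed[OF ob(2-4) m(2,3)]] comp)
    qed
  next
    fix G assume "G \<in> Ob C"
    thus "Ident C G \<in> carrier (Hom C G G)" using inv D.ident_closed by (simp add: ident Ob)
  next
    fix F G \<phi> assume ob: "F \<in> Ob C" "G \<in> Ob C" and \<phi>: "\<phi> \<in> carrier (Hom C F G)"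
    show "Comp C F F G (Ident C F) \<phi> = \<phi>"
      using comp'[OF ob(1,1,2) _ \<phi>, of "Ident C F"] inv[OF ob(1,1) D.ident_closed[unfolded Ob, OF ob(1)]]
        D.ident_left[unfolded Ob, OF ob \<Phi>(1)[OF ob \<phi>]] inv'[OF ob \<phi>] by (simp add: ident ob)
    show "Comp C F G G \<phi> (Ident C G) = \<phi>"
      using comp'[OF ob(1,2,2) \<phi>, of "Ident C G"] inv[OF ob(2,2) D.ident_closed[unfolded Ob, OF ob(2)]]
        D.ident_right[unfolded Ob, OF ob \<Phi>(1)[OF ob \<phi>]] inv'[OF ob \<phi>] by (simp add: ident ob)
  qed
  interpret C: linear_category R C by (rule C)
  have "object_identical_functor R C D \<Phi>"
    by unfold_locales (use Ob lin comp ident inv D.ident_closed in auto)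
  moreover have "object_identical_functor R D C \<Psi>"
  proof (unfold_locales)
    fix F G H \<phi> \<psi> assume ob: "F \<in> Ob D" "G \<in> Ob D" "H \<in> Ob D"
      and m: "\<phi> \<in> carrier (Hom D F G)" "\<psi> \<in> carrier (Hom D G H)"
    show "\<Psi> F H (Comp D F G H \<phi> \<psi>) = Comp C F G H (\<Psi> F G \<phi>) (\<Psi> G H \<psi>)"
      using ob m inv comp' unfolding Ob by simp
  qed (use Ob lin' ident in auto)
  ultimately show "object_identical_isomorphism R C D \<Phi>"
    unfolding object_identical_isomorphism_def using inv inv' Ob by blast
qed

section \<open>Conjugation of subcharacters\<close>

lemma (in group) l_cancel_inv: "\<lbrakk>x \<in> carrier G; y \<in> carrier G\<rbrakk> \<Longrightarrow> inv x \<otimes> (x \<otimes> y) = y"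
  by (simp add: m_assoc[symmetric])

lemma (in group) r_cancel_inv: "\<lbrakk>x \<in> carrier G; y \<in> carrier G\<rbrakk> \<Longrightarrow> x \<otimes> (inv x \<otimes> y) = y"
  by (simp add: m_assoc[symmetric])

lemmas (in group) cancel_simps = m_assoc inv_mult_group l_cancel_inv r_cancel_inv

context
  fixes E :: "'e monoid"
  assumes E: "group E"
begin

interpretation E: group E by (rule E)

lemma conj_elt_closed: "\<lbrakk>g \<in> carrier E; y \<in> carrier E\<rbrakk> \<Longrightarrow> conj_elt E g y \<in> carrier E"
  by (simp add: conj_elt_def)

lemma conj_elt_by_one: "y \<in> carrier E \<Longrightarrow> conj_elt E \<one>\<^bsub>E\<^esub> y = y"
  by (simp add: conj_elt_def)

lemma conj_elt_of_one: "g \<in> carrier E \<Longrightarrow> conj_elt E g \<one>\<^bsub>E\<^esub> = \<one>\<^bsub>E\<^esub>"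
  by (simp add: conj_elt_def)

lemma conj_elt_by_mult:
  "\<lbrakk>g \<in> carrier E; h \<in> carrier E; y \<in> carrier E\<rbrakk>
    \<Longrightarrow> conj_elt E (g \<otimes>\<^bsub>E\<^esub> h) y = conj_elt E g (conj_elt E h y)"
  by (simp add: conj_elt_def E.cancel_simps)

lemma conj_elt_of_mult:
  "\<lbrakk>g \<in> carrier E; x \<in> carrier E; y \<in> carrier E\<rbrakk>
    \<Longrightarrow> conj_elt E g (x \<otimes>\<^bsub>E\<^esub> y) = conj_elt E g x \<otimes>\<^bsub>E\<^esub> conj_elt E g y"
  by (simp add: conj_elt_def E.cancel_simps)

lemma conj_elt_of_inv:
  "\<lbrakk>g \<in> carrier E; x \<in> carrier E\<rbrakk> \<Longrightarrow> inv\<^bsub>E\<^esub> conj_elt E g x = conj_elt E g (inv\<^bsub>E\<^esub> x)"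
  by (simp add: conj_elt_def E.cancel_simps)

lemma conj_elt_inv_cancel:
  "\<lbrakk>g \<in> carrier E; y \<in> carrier E\<rbrakk> \<Longrightarrow> conj_elt E (inv\<^bsub>E\<^esub> g) (conj_elt E g y) = y"
  by (simp add: conj_elt_by_mult[symmetric] conj_elt_by_one)

lemma subchar_eqI:
  assumes "u \<in> subchars A E" "v \<in> subchars A E" "fst u = fst v"
    "\<And>t. t \<in> fst u \<Longrightarrow> snd u t = snd v t"
  shows "u = v"
  using assms by (cases u; cases v) (auto simp: subchars_def intro: extensionalityI)

lemma subcharD:
  assumes "u \<in> subchars A E"
  shows "subgroup (fst u) E"
    and "x \<in> fst u \<Longrightarrow> snd u x \<in> carrier A"
    and "\<lbrakk>x \<in> fst u; y \<in> fst u\<rbrakk> \<Longrightarrow> snd u (x \<otimes>\<^bsub>E\<^esub> y) = snd u x \<otimes>\<^bsub>A\<^esub> snd u y"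
    and "x \<in> fst u \<Longrightarrow> x \<in> carrier E"
  using assms by (auto simp: subchars_def hom_def subgroup.mem_carrier)

lemma subcharI:
  assumes "subgroup (fst u) E" "\<And>x. x \<in> fst u \<Longrightarrow> snd u x \<in> carrier A"
    "\<And>x y. \<lbrakk>x \<in> fst u; y \<in> fst u\<rbrakk> \<Longrightarrow> snd u (x \<otimes>\<^bsub>E\<^esub> y) = snd u x \<otimes>\<^bsub>A\<^esub> snd u y"
    "snd u \<in> extensional (fst u)"
  shows "u \<in> subchars A E"
  using assms by (cases u) (auto simp: subchars_def hom_def)

lemma fst_conj_subchar: "fst (conj_subchar E g u) = conj_elt E g ` fst u"
  by (cases u) (simp add: conj_subchar_def)

lemma snd_conj_subchar:
  assumes "u \<in> subchars A E" "g \<in> carrier E" "y \<in> fst u"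
  shows "snd (conj_subchar E g u) (conj_elt E g y) = snd u y"
  using assms subcharD(4)[OF assms(1,3)]
  by (cases u) (auto simp: conj_subchar_def conj_elt_inv_cancel)

lemma conj_subchar_closed:
  assumes u: "u \<in> subchars A E" and g: "g \<in> carrier E"
  shows "conj_subchar E g u \<in> subchars A E"
proof (rule subcharI)
  interpret U: subgroup "fst u" E by (rule subcharD(1)[OF u])
  show "subgroup (fst (conj_subchar E g u)) E"
  proof (rule E.subgroupI)
    show "fst (conj_subchar E g u) \<subseteq> carrier E"
      using g by (auto simp: fst_conj_subchar conj_elt_closed)
    show "fst (conj_subchar E g u) \<noteq> {}"
      using U.one_closed unfolding fst_conj_subchar by blast
    show "inv\<^bsub>E\<^esub> a \<in> fst (conj_subchar E g u)" if "a \<in> fst (conj_subchar E g u)" for a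
      using that g by (auto simp: fst_conj_subchar conj_elt_of_inv)
    show "a \<otimes>\<^bsub>E\<^esub> b \<in> fst (conj_subchar E g u)"
      if "a \<in> fst (conj_subchar E g u)" "b \<in> fst (conj_subchar E g u)" for a b
      using that g by (auto simp: fst_conj_subchar conj_elt_of_mult[symmetric])
  qed
  show "snd (conj_subchar E g u) x \<in> carrier A" if "x \<in> fst (conj_subchar E g u)" for x
    using that u g by (auto simp: fst_conj_subchar snd_conj_subchar subcharD(2))
  show "snd (conj_subchar E g u) (x \<otimes>\<^bsub>E\<^esub> y)
      = snd (conj_subchar E g u) x \<otimes>\<^bsub>A\<^esub> snd (conj_subchar E g u) y"
    if "x \<in> fst (conj_subchar E g u)" "y \<in> fst (conj_subchar E g u)" for x y
    using that g
    by (auto simp: fst_conj_subchar conj_elt_of_mult[symmetric] snd_conj_subchar[OF u g]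
        subcharD(3)[OF u])
  show "snd (conj_subchar E g u) \<in> extensional (fst (conj_subchar E g u))"
    by (cases u) (simp add: conj_subchar_def)
qed

lemma conj_subchar_one:
  assumes u: "u \<in> subchars A E"
  shows "conj_subchar E \<one>\<^bsub>E\<^esub> u = u"
proof (rule subchar_eqI[of _ A])
  have c: "conj_elt E \<one>\<^bsub>E\<^esub> y = y" if "y \<in> fst u" for y
    using subcharD(4)[OF u that] by (rule conj_elt_by_one)
  thus f: "fst (conj_subchar E \<one>\<^bsub>E\<^esub> u) = fst u" by (simp add: fst_conj_subchar)
  show "snd (conj_subchar E \<one>\<^bsub>E\<^esub> u) t = snd u t" if "t \<in> fst (conj_subchar E \<one>\<^bsub>E\<^esub> u)" for t
    using snd_conj_subchar[OF u E.one_closed, of t] that by (simp add: f c)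
qed (use u in \<open>auto intro: conj_subchar_closed\<close>)

lemma conj_subchar_mult:
  assumes u: "u \<in> subchars A E" and g: "g \<in> carrier E" and h: "h \<in> carrier E"
  shows "conj_subchar E (g \<otimes>\<^bsub>E\<^esub> h) u = conj_subchar E g (conj_subchar E h u)"
proof (rule subchar_eqI[of _ A])
  have c: "conj_elt E (g \<otimes>\<^bsub>E\<^esub> h) y = conj_elt E g (conj_elt E h y)" if "y \<in> fst u" for y
    using g h subcharD(4)[OF u that] by (rule conj_elt_by_mult)
  show "fst (conj_subchar E (g \<otimes>\<^bsub>E\<^esub> h) u) = fst (conj_subchar E g (conj_subchar E h u))"
    by (simp add: fst_conj_subchar image_image c cong: image_cong_simp)
  fix t assume "t \<in> fst (conj_subchar E (g \<otimes>\<^bsub>E\<^esub> h) u)"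
  then obtain y where y: "y \<in> fst u" "t = conj_elt E (g \<otimes>\<^bsub>E\<^esub> h) y"
    by (auto simp: fst_conj_subchar)
  have "snd (conj_subchar E g (conj_subchar E h u)) t = snd u y"
    using y u g h conj_subchar_closed[OF u h]
    by (simp add: c snd_conj_subchar fst_conj_subchar)
  thus "snd (conj_subchar E (g \<otimes>\<^bsub>E\<^esub> h) u) t = snd (conj_subchar E g (conj_subchar E h u)) t"
    using y u g h by (simp add: snd_conj_subchar)
qed (use u g h in \<open>auto intro: conj_subchar_closed\<close>)

text \<open>Since \<open>A\<close> is commutative, a character is invariant under inner automorphisms of its domain.\<close>

lemma conj_subchar_self:
  assumes A: "comm_group A" and u: "u \<in> subchars A E" and x: "x \<in> fst u"
  shows "conj_subchar E x u = u"
proof (rule subchar_eqI[of _ A])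
  interpret A: comm_group A by (rule A)
  interpret U: subgroup "fst u" E by (rule subcharD(1)[OF u])
  have xE: "x \<in> carrier E" using x by simp
  have c: "conj_elt E x y \<in> fst u" if "y \<in> fst u" for y
    using that x by (simp add: conj_elt_def)
  show f: "fst (conj_subchar E x u) = fst u"
  proof
    show "fst (conj_subchar E x u) \<subseteq> fst u" using c by (auto simp: fst_conj_subchar)
    show "fst u \<subseteq> fst (conj_subchar E x u)"
    proof
      fix y assume y: "y \<in> fst u"
      have "y = conj_elt E x (conj_elt E (inv\<^bsub>E\<^esub> x) y)"
        using x y by (simp add: conj_elt_by_mult[symmetric] conj_elt_by_one)
      moreover have "conj_elt E (inv\<^bsub>E\<^esub> x) y \<in> fst u" using x y by (simp add: conj_elt_def)
      ultimately show "y \<in> fst (conj_subchar E x u)" by (auto simp: fst_conj_subchar)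
    qed
  qed
  have s: "snd u (conj_elt E x y) = snd u y" if y: "y \<in> fst u" for y
  proof -
    have "snd u (conj_elt E x y) \<otimes>\<^bsub>A\<^esub> snd u x = snd u (conj_elt E x y \<otimes>\<^bsub>E\<^esub> x)"
      using subcharD(3)[OF u c[OF y] x] by simp
    also have "conj_elt E x y \<otimes>\<^bsub>E\<^esub> x = x \<otimes>\<^bsub>E\<^esub> y" using x y by (simp add: conj_elt_def E.m_assoc)
    also have "snd u \<dots> = snd u y \<otimes>\<^bsub>A\<^esub> snd u x"
      using x y by (simp add: subcharD[OF u] A.m_comm)
    finally show ?thesis using x y c[OF y] by (simp add: subcharD[OF u])
  qed
  fix t assume "t \<in> fst (conj_subchar E x u)"
  then obtain y where y: "y \<in> fst u" "t = conj_elt E x y" by (auto simp: fst_conj_subchar)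
  thus "snd (conj_subchar E x u) t = snd u t" using snd_conj_subchar[OF u xE y(1)] s by simp
qed (use u subcharD(4)[OF u x] in \<open>auto intro: conj_subchar_closed\<close>)

end

lemma conj_elt_DirProd:
  assumes "group F" "group G" "f \<in> carrier F" "g \<in> carrier G"
  shows "conj_elt (F \<times>\<times> G) (f, g) (x, y) = (conj_elt F f x, conj_elt G g y)"
  using assms by (simp add: conj_elt_def)

section \<open>Composition of subcharacters\<close>

locale subcharacters = A?: comm_group A for A :: "('a, 'z) monoid_scheme" (structure) +
  fixes \<G> :: "'g monoid set"
  assumes group_object: "G \<in> \<G> \<Longrightarrow> group G"
    and finite_object: "G \<in> \<G> \<Longrightarrow> finite (carrier G)"
begin

lemma group_pair: "\<lbrakk>F \<in> \<G>; G \<in> \<G>\<rbrakk> \<Longrightarrow> group (F \<times>\<times> G)"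
  by (simp add: DirProd_group group_object)

lemma SA_D:
  assumes "u \<in> SA A F G" "F \<in> \<G>" "G \<in> \<G>"
  shows "(f, g) \<in> fst u \<Longrightarrow> f \<in> carrier F"
    and "(f, g) \<in> fst u \<Longrightarrow> g \<in> carrier G"
    and "(f, g) \<in> fst u \<Longrightarrow> snd u (f, g) \<in> carrier A"
    and "\<lbrakk>(f, g) \<in> fst u; (f', g') \<in> fst u\<rbrakk> \<Longrightarrow> (f \<otimes>\<^bsub>F\<^esub> f', g \<otimes>\<^bsub>G\<^esub> g') \<in> fst u"
    and "\<lbrakk>(f, g) \<in> fst u; (f', g') \<in> fst u\<rbrakk>
      \<Longrightarrow> snd u (f \<otimes>\<^bsub>F\<^esub> f', g \<otimes>\<^bsub>G\<^esub> g') = snd u (f, g) \<otimes> snd u (f', g')"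
    and "(f, g) \<in> fst u \<Longrightarrow> (inv\<^bsub>F\<^esub> f, inv\<^bsub>G\<^esub> g) \<in> fst u"
    and "(\<one>\<^bsub>F\<^esub>, \<one>\<^bsub>G\<^esub>) \<in> fst u"
    and "snd u (\<one>\<^bsub>F\<^esub>, \<one>\<^bsub>G\<^esub>) = \<one>"
proof -
  interpret F: group F by (rule group_object) fact
  interpret G: group G by (rule group_object) fact
  interpret FG: group "F \<times>\<times> G" by (rule group_pair) fact+
  note D = subcharD[OF FG.is_group assms(1)[unfolded SA_def]]
  interpret U: subgroup "fst u" "F \<times>\<times> G" by (rule D(1))
  show car: "f \<in> carrier F" "g \<in> carrier G" if "(f, g) \<in> fst u" for f g
    using U.mem_carrier[OF that] by auto
  show "snd u (f, g) \<in> carrier A" if "(f, g) \<in> fst u" using D(2)[OF that] .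
  show "(f \<otimes>\<^bsub>F\<^esub> f', g \<otimes>\<^bsub>G\<^esub> g') \<in> fst u" if "(f, g) \<in> fst u" "(f', g') \<in> fst u"
    using U.m_closed[OF that] by simp
  show mult: "snd u (f \<otimes>\<^bsub>F\<^esub> f', g \<otimes>\<^bsub>G\<^esub> g') = snd u (f, g) \<otimes> snd u (f', g')"
    if "(f, g) \<in> fst u" "(f', g') \<in> fst u" for f g f' g'
    using D(3)[OF that] by simp
  show "(inv\<^bsub>F\<^esub> f, inv\<^bsub>G\<^esub> g) \<in> fst u" if "(f, g) \<in> fst u"
    using U.m_inv_closed[OF that] car[OF that] by (simp add: F.is_group G.is_group)
  show one: "(\<one>\<^bsub>F\<^esub>, \<one>\<^bsub>G\<^esub>) \<in> fst u" using U.one_closed by simp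
  have "snd u (\<one>\<^bsub>F\<^esub>, \<one>\<^bsub>G\<^esub>) \<otimes> snd u (\<one>\<^bsub>F\<^esub>, \<one>\<^bsub>G\<^esub>) = snd u (\<one>\<^bsub>F\<^esub>, \<one>\<^bsub>G\<^esub>)"
    using mult[OF one one] by simp
  thus "snd u (\<one>\<^bsub>F\<^esub>, \<one>\<^bsub>G\<^esub>) = \<one>" using D(2)[OF one] A.l_cancel_one by auto
qed

lemma SA_eqI:
  assumes "u \<in> SA A F G" "v \<in> SA A F G" "F \<in> \<G>" "G \<in> \<G>" "fst u = fst v"
    "\<And>f g. (f, g) \<in> fst u \<Longrightarrow> snd u (f, g) = snd v (f, g)"
  shows "u = v"
  using assms by (intro subchar_eqI[OF group_pair, of F G _ A]) (auto simp: SA_def)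

lemma finite_SA_fst:
  assumes "u \<in> SA A F G" "F \<in> \<G>" "G \<in> \<G>"
  shows "finite (fst u)"
  by (rule finite_subset[of _ "carrier F \<times> carrier G"])
    (auto simp: SA_D[OF assms] finite_object assms(2,3))

lemma card_SA_fst_pos:
  assumes "u \<in> SA A F G" "F \<in> \<G>" "G \<in> \<G>"
  shows "card (fst u) > 0"
  using finite_SA_fst[OF assms] SA_D(7)[OF assms] by (auto simp: card_gt_0_iff)

lemma SA_I:
  assumes "F \<in> \<G>" "G \<in> \<G>"
    and "(\<one>\<^bsub>F\<^esub>, \<one>\<^bsub>G\<^esub>) \<in> U" "\<And>f g. (f, g) \<in> U \<Longrightarrow> f \<in> carrier F \<and> g \<in> carrier G"
    and "\<And>f g. (f, g) \<in> U \<Longrightarrow> (inv\<^bsub>F\<^esub> f, inv\<^bsub>G\<^esub> g) \<in> U"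
    and "\<And>f g f' g'. \<lbrakk>(f, g) \<in> U; (f', g') \<in> U\<rbrakk> \<Longrightarrow> (f \<otimes>\<^bsub>F\<^esub> f', g \<otimes>\<^bsub>G\<^esub> g') \<in> U"
    and "\<And>f g. (f, g) \<in> U \<Longrightarrow> \<mu> (f, g) \<in> carrier A"
    and "\<And>f g f' g'. \<lbrakk>(f, g) \<in> U; (f', g') \<in> U\<rbrakk>
      \<Longrightarrow> \<mu> (f \<otimes>\<^bsub>F\<^esub> f', g \<otimes>\<^bsub>G\<^esub> g') = \<mu> (f, g) \<otimes> \<mu> (f', g')"
    and "\<mu> \<in> extensional U"
  shows "(U, \<mu>) \<in> SA A F G"
  unfolding SA_def
proof (rule subcharI[OF group_pair])
  interpret F: group F by (rule group_object) fact
  interpret G: group G by (rule group_object) fact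
  interpret FG: group "F \<times>\<times> G" by (rule group_pair) fact+
  have "subgroup U (F \<times>\<times> G)"
  proof (rule FG.subgroupI)
    show "U \<subseteq> carrier (F \<times>\<times> G)" using assms(4) by auto
    show "U \<noteq> {}" using assms(3) by auto
    show "inv\<^bsub>F \<times>\<times> G\<^esub> x \<in> U" if "x \<in> U" for x
      using that assms(4,5)[of "fst x" "snd x"]
        inv_DirProd[OF F.is_group G.is_group, of "fst x" "snd x"] by simp
    show "x \<otimes>\<^bsub>F \<times>\<times> G\<^esub> y \<in> U" if "x \<in> U" "y \<in> U" for x y
      using that assms(6)[of "fst x" "snd x" "fst y" "snd y"] by (simp add: mult_DirProd')
  qed
  thus "subgroup (fst (U, \<mu>)) (F \<times>\<times> G)" by simp
qed (use assms in auto)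

lemma Gamma_cap_iff:
  assumes "u \<in> SA A F G" "F \<in> \<G>" "G \<in> \<G>"
  shows "g \<in> Gamma_cap F G H (fst u) V \<longleftrightarrow> (\<one>\<^bsub>F\<^esub>, g) \<in> fst u \<and> (g, \<one>\<^bsub>H\<^esub>) \<in> V"
  using SA_D(2)[OF assms] by (auto simp: Gamma_cap_def)

lemma compatible_iff:
  "compatible A F G H u v \<longleftrightarrow>
    (\<forall>g \<in> Gamma_cap F G H (fst u) (fst v). snd u (\<one>\<^bsub>F\<^esub>, g) \<otimes> snd v (g, \<one>\<^bsub>H\<^esub>) = \<one>)"
  by (cases u; cases v) (simp add: compatible_def)

lemma fst_star: "fst (star A u v) = fst u O fst v"
  by (cases u; cases v) (simp add: star_def)

lemma SA_left_quotient:
  assumes "u \<in> SA A F G" "F \<in> \<G>" "G \<in> \<G>" "(f, g) \<in> fst u" "(f, g') \<in> fst u"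
  shows "(\<one>\<^bsub>F\<^esub>, inv\<^bsub>G\<^esub> g \<otimes>\<^bsub>G\<^esub> g') \<in> fst u"
proof -
  interpret F: group F by (rule group_object) fact
  show ?thesis using SA_D(4)[OF assms(1-3) SA_D(6)[OF assms(1-4)] assms(5)]
      SA_D(1)[OF assms(1-4)] by simp
qed

lemma SA_right_quotient:
  assumes "u \<in> SA A F G" "F \<in> \<G>" "G \<in> \<G>" "(f, g) \<in> fst u" "(f', g) \<in> fst u"
  shows "(inv\<^bsub>F\<^esub> f \<otimes>\<^bsub>F\<^esub> f', \<one>\<^bsub>G\<^esub>) \<in> fst u"
proof -
  interpret G: group G by (rule group_object) fact
  show ?thesis using SA_D(4)[OF assms(1-3) SA_D(6)[OF assms(1-4)] assms(5)]
      SA_D(2)[OF assms(1-4)] by simp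
qed

text \<open>Two intermediate elements differ by an element of \<^const>\<open>Gamma_cap\<close>, on which compatible
  characters cancel.\<close>

lemma star_value_unique:
  assumes u: "u \<in> SA A F G" and v: "v \<in> SA A G H" and ob: "F \<in> \<G>" "G \<in> \<G>" "H \<in> \<G>"
    and c: "compatible A F G H u v"
    and g: "(f, g) \<in> fst u" "(g, h) \<in> fst v" and g': "(f, g') \<in> fst u" "(g', h) \<in> fst v"
  shows "snd u (f, g') \<otimes> snd v (g', h) = snd u (f, g) \<otimes> snd v (g, h)"
proof -
  interpret F: group F by (rule group_object) fact
  interpret G: group G by (rule group_object) fact
  interpret H: group H by (rule group_object) fact
  note U = SA_D[OF u ob(1,2)] and V = SA_D[OF v ob(2,3)]
  let ?x = "inv\<^bsub>G\<^esub> g \<otimes>\<^bsub>G\<^esub> g'"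
  have cl: "f \<in> carrier F" "g \<in> carrier G" "g' \<in> carrier G" "h \<in> carrier H"
    using g g' by (auto dest: U(1,2) V(1,2))
  have x: "(\<one>\<^bsub>F\<^esub>, ?x) \<in> fst u" "(?x, \<one>\<^bsub>H\<^esub>) \<in> fst v"
    using SA_left_quotient[OF u ob(1,2) g(1) g'(1)] SA_right_quotient[OF v ob(2,3) g(2) g'(2)] .
  have "snd u (f, g') = snd u (f, g) \<otimes> snd u (\<one>\<^bsub>F\<^esub>, ?x)"
    using U(5)[OF g(1) x(1)] cl by (simp add: G.r_cancel_inv)
  moreover have "snd v (g', h) = snd v (g, h) \<otimes> snd v (?x, \<one>\<^bsub>H\<^esub>)"
    using V(5)[OF g(2) x(2)] cl by (simp add: G.r_cancel_inv)
  moreover have "snd u (\<one>\<^bsub>F\<^esub>, ?x) \<otimes> snd v (?x, \<one>\<^bsub>H\<^esub>) = \<one>"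
    using c x by (simp add: compatible_iff Gamma_cap_iff[OF u ob(1,2)])
  ultimately show ?thesis
    using U(3)[OF g(1)] U(3)[OF x(1)] V(3)[OF g(2)] V(3)[OF x(2)]
    by (metis A.m_assoc A.m_comm A.m_closed A.r_one)
qed

lemma snd_star:
  assumes "u \<in> SA A F G" "v \<in> SA A G H" "F \<in> \<G>" "G \<in> \<G>" "H \<in> \<G>"
    and "compatible A F G H u v" and "(f, g) \<in> fst u" "(g, h) \<in> fst v"
  shows "snd (star A u v) (f, h) = snd u (f, g) \<otimes> snd v (g, h)"
proof -
  have "(THE a. \<forall>g. (f, g) \<in> fst u \<and> (g, h) \<in> fst v \<longrightarrow> a = snd u (f, g) \<otimes> snd v (g, h))
     = snd u (f, g) \<otimes> snd v (g, h)"
    using star_value_unique[OF assms(1-6)] assms(7,8)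
    by (intro the_equality) blast+
  thus ?thesis using assms(7,8) by (cases u; cases v) (auto simp: star_def)
qed

lemma star_closed:
  assumes u: "u \<in> SA A F G" and v: "v \<in> SA A G H" and ob: "F \<in> \<G>" "G \<in> \<G>" "H \<in> \<G>"
    and c: "compatible A F G H u v"
  shows "star A u v \<in> SA A F H"
proof -
  note U = SA_D[OF u ob(1,2)] and V = SA_D[OF v ob(2,3)] and s = snd_star[OF u v ob c]
  have "(fst u O fst v, snd (star A u v)) \<in> SA A F H"
  proof (rule SA_I[OF ob(1,3)])
    show "(\<one>\<^bsub>F\<^esub>, \<one>\<^bsub>H\<^esub>) \<in> fst u O fst v" using U(7) V(7) by blast
    show "f \<in> carrier F \<and> h \<in> carrier H" if "(f, h) \<in> fst u O fst v" for f h
      using that by (auto dest: U(1,2) V(1,2))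
    show "(inv\<^bsub>F\<^esub> f, inv\<^bsub>H\<^esub> h) \<in> fst u O fst v" if "(f, h) \<in> fst u O fst v" for f h
      using that U(6) V(6) by blast
    show "snd (star A u v) (f, h) \<in> carrier A" if "(f, h) \<in> fst u O fst v" for f h
      using that by (auto simp: s U(3) V(3))
    fix f h f' h' assume "(f, h) \<in> fst u O fst v" "(f', h') \<in> fst u O fst v"
    then obtain g g' where g: "(f, g) \<in> fst u" "(g, h) \<in> fst v"
      and g': "(f', g') \<in> fst u" "(g', h') \<in> fst v" by blast
    note m = U(4)[OF g(1) g'(1)] V(4)[OF g(2) g'(2)]
    show "(f \<otimes>\<^bsub>F\<^esub> f', h \<otimes>\<^bsub>H\<^esub> h') \<in> fst u O fst v" using m by blast
    show "snd (star A u v) (f \<otimes>\<^bsub>F\<^esub> f', h \<otimes>\<^bsub>H\<^esub> h')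
        = snd (star A u v) (f, h) \<otimes> snd (star A u v) (f', h')"
      using s[OF g] s[OF g'] s[OF m] U(3)[OF g(1)] U(3)[OF g'(1)] V(3)[OF g(2)] V(3)[OF g'(2)]
      by (simp add: U(5)[OF g(1) g'(1)] V(5)[OF g(2) g'(2)] A.m_ac)
  next
    show "snd (star A u v) \<in> extensional (fst u O fst v)"
      by (cases u; cases v) (simp add: star_def)
  qed
  thus ?thesis using fst_star by (metis prod.collapse)
qed

text \<open>The pairs of intermediate elements that link the two trivial elements through three subgroups.
  The compatibility conditions for either bracketing of a triple of subcharacters are equivalent to
  one condition on this set.\<close>

definition linking ::
    "'g monoid \<Rightarrow> 'g monoid \<Rightarrow> ('g \<times> 'g) set \<Rightarrow> ('g \<times> 'g) set \<Rightarrow> ('g \<times> 'g) set \<Rightarrow> ('g \<times> 'g) set"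
  where "linking F K U V W = {(g, h). (\<one>\<^bsub>F\<^esub>, g) \<in> U \<and> (g, h) \<in> V \<and> (h, \<one>\<^bsub>K\<^esub>) \<in> W}"

lemma compatible_star_left:
  assumes u: "u \<in> SA A F G" and v: "v \<in> SA A G H" and w: "w \<in> SA A H K"
    and ob: "F \<in> \<G>" "G \<in> \<G>" "H \<in> \<G>" "K \<in> \<G>"
  shows "compatible A F G H u v \<and> compatible A F H K (star A u v) w \<longleftrightarrow>
    (\<forall>(g, h) \<in> linking F K (fst u) (fst v) (fst w).
       snd u (\<one>\<^bsub>F\<^esub>, g) \<otimes> snd v (g, h) \<otimes> snd w (h, \<one>\<^bsub>K\<^esub>) = \<one>)" (is "?L \<longleftrightarrow> ?R")
proof
  note s = snd_star[OF u v ob(1-3)]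
  assume L: ?L
  note sc = star_closed[OF u v ob(1-3) conjunct1[OF L]]
  show ?R
  proof clarify
    fix g h assume "(g, h) \<in> linking F K (fst u) (fst v) (fst w)"
    hence gh: "(\<one>\<^bsub>F\<^esub>, g) \<in> fst u" "(g, h) \<in> fst v" "(h, \<one>\<^bsub>K\<^esub>) \<in> fst w"
      by (auto simp: linking_def)
    hence "(\<one>\<^bsub>F\<^esub>, h) \<in> fst (star A u v)" by (auto simp: fst_star)
    hence "h \<in> Gamma_cap F H K (fst (star A u v)) (fst w)"
      using gh(3) by (simp add: Gamma_cap_iff[OF sc ob(1,3)])
    with L have "snd (star A u v) (\<one>\<^bsub>F\<^esub>, h) \<otimes> snd w (h, \<one>\<^bsub>K\<^esub>) = \<one>"
      by (simp add: compatible_iff)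
    thus "snd u (\<one>\<^bsub>F\<^esub>, g) \<otimes> snd v (g, h) \<otimes> snd w (h, \<one>\<^bsub>K\<^esub>) = \<one>"
      using s[OF conjunct1[OF L] gh(1,2)] by simp
  qed
next
  note s = snd_star[OF u v ob(1-3)]
  assume R: ?R
  have c: "compatible A F G H u v"
    unfolding compatible_iff
  proof
    fix g assume "g \<in> Gamma_cap F G H (fst u) (fst v)"
    hence g: "(\<one>\<^bsub>F\<^esub>, g) \<in> fst u" "(g, \<one>\<^bsub>H\<^esub>) \<in> fst v" by (auto simp: Gamma_cap_def)
    moreover have "(\<one>\<^bsub>H\<^esub>, \<one>\<^bsub>K\<^esub>) \<in> fst w" by (rule SA_D(7)[OF w ob(3,4)])
    \<comment> \<open>The pairs with \<open>h = 1\<close> express compatibility of \<open>u\<close> and \<open>v\<close> alone.\<close>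
    ultimately have "(g, \<one>\<^bsub>H\<^esub>) \<in> linking F K (fst u) (fst v) (fst w)" by (simp add: linking_def)
    with R have "snd u (\<one>\<^bsub>F\<^esub>, g) \<otimes> snd v (g, \<one>\<^bsub>H\<^esub>) \<otimes> snd w (\<one>\<^bsub>H\<^esub>, \<one>\<^bsub>K\<^esub>) = \<one>" by blast
    thus "snd u (\<one>\<^bsub>F\<^esub>, g) \<otimes> snd v (g, \<one>\<^bsub>H\<^esub>) = \<one>"
      using SA_D(3)[OF u ob(1,2) g(1)] SA_D(3)[OF v ob(2,3) g(2)] SA_D(8)[OF w ob(3,4)] by simp
  qed
  note sc = star_closed[OF u v ob(1-3) c]
  have "compatible A F H K (star A u v) w"
    unfolding compatible_iff
  proof
    fix h assume "h \<in> Gamma_cap F H K (fst (star A u v)) (fst w)"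
    hence "(\<one>\<^bsub>F\<^esub>, h) \<in> fst u O fst v" "(h, \<one>\<^bsub>K\<^esub>) \<in> fst w"
      by (simp_all add: Gamma_cap_def fst_star)
    then obtain g where g: "(\<one>\<^bsub>F\<^esub>, g) \<in> fst u" "(g, h) \<in> fst v" "(h, \<one>\<^bsub>K\<^esub>) \<in> fst w"
      by blast
    hence "(g, h) \<in> linking F K (fst u) (fst v) (fst w)" by (simp add: linking_def)
    with R have "snd u (\<one>\<^bsub>F\<^esub>, g) \<otimes> snd v (g, h) \<otimes> snd w (h, \<one>\<^bsub>K\<^esub>) = \<one>" by blast
    thus "snd (star A u v) (\<one>\<^bsub>F\<^esub>, h) \<otimes> snd w (h, \<one>\<^bsub>K\<^esub>) = \<one>" using s[OF c g(1,2)] by simp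
  qed
  with c show ?L by blast
qed

lemma compatible_star_right:
  assumes u: "u \<in> SA A F G" and v: "v \<in> SA A G H" and w: "w \<in> SA A H K"
    and ob: "F \<in> \<G>" "G \<in> \<G>" "H \<in> \<G>" "K \<in> \<G>"
  shows "compatible A G H K v w \<and> compatible A F G K u (star A v w) \<longleftrightarrow>
    (\<forall>(g, h) \<in> linking F K (fst u) (fst v) (fst w).
       snd u (\<one>\<^bsub>F\<^esub>, g) \<otimes> snd v (g, h) \<otimes> snd w (h, \<one>\<^bsub>K\<^esub>) = \<one>)" (is "?L \<longleftrightarrow> ?R")
proof
  note s = snd_star[OF v w ob(2-4)]
  assume L: ?L
  show ?R
  proof clarify
    fix g h assume "(g, h) \<in> linking F K (fst u) (fst v) (fst w)"
    hence gh: "(\<one>\<^bsub>F\<^esub>, g) \<in> fst u" "(g, h) \<in> fst v" "(h, \<one>\<^bsub>K\<^esub>) \<in> fst w"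
      by (auto simp: linking_def)
    hence "g \<in> Gamma_cap F G K (fst u) (fst (star A v w))"
      by (auto simp: Gamma_cap_iff[OF u ob(1,2)] fst_star)
    with L have "snd u (\<one>\<^bsub>F\<^esub>, g) \<otimes> snd (star A v w) (g, \<one>\<^bsub>K\<^esub>) = \<one>"
      by (simp add: compatible_iff)
    thus "snd u (\<one>\<^bsub>F\<^esub>, g) \<otimes> snd v (g, h) \<otimes> snd w (h, \<one>\<^bsub>K\<^esub>) = \<one>"
      using s[OF conjunct1[OF L] gh(2,3)] SA_D(3)[OF u ob(1,2) gh(1)] SA_D(3)[OF v ob(2,3) gh(2)]
        SA_D(3)[OF w ob(3,4) gh(3)] by (simp add: A.m_assoc)
  qed
next
  note s = snd_star[OF v w ob(2-4)]
  assume R: ?R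
  have c: "compatible A G H K v w"
    unfolding compatible_iff
  proof
    fix h assume "h \<in> Gamma_cap G H K (fst v) (fst w)"
    hence h: "(\<one>\<^bsub>G\<^esub>, h) \<in> fst v" "(h, \<one>\<^bsub>K\<^esub>) \<in> fst w" by (auto simp: Gamma_cap_def)
    moreover have "(\<one>\<^bsub>F\<^esub>, \<one>\<^bsub>G\<^esub>) \<in> fst u" by (rule SA_D(7)[OF u ob(1,2)])
    \<comment> \<open>Here the pairs with \<open>g = 1\<close> express compatibility of \<open>v\<close> and \<open>w\<close>.\<close>
    ultimately have "(\<one>\<^bsub>G\<^esub>, h) \<in> linking F K (fst u) (fst v) (fst w)" by (simp add: linking_def)
    with R have "snd u (\<one>\<^bsub>F\<^esub>, \<one>\<^bsub>G\<^esub>) \<otimes> snd v (\<one>\<^bsub>G\<^esub>, h) \<otimes> snd w (h, \<one>\<^bsub>K\<^esub>) = \<one>" by blast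
    thus "snd v (\<one>\<^bsub>G\<^esub>, h) \<otimes> snd w (h, \<one>\<^bsub>K\<^esub>) = \<one>"
      using SA_D(3)[OF v ob(2,3) h(1)] SA_D(3)[OF w ob(3,4) h(2)] SA_D(8)[OF u ob(1,2)] by simp
  qed
  have "compatible A F G K u (star A v w)"
    unfolding compatible_iff
  proof
    fix g assume "g \<in> Gamma_cap F G K (fst u) (fst (star A v w))"
    then obtain h where h: "(\<one>\<^bsub>F\<^esub>, g) \<in> fst u" "(g, h) \<in> fst v" "(h, \<one>\<^bsub>K\<^esub>) \<in> fst w"
      by (auto simp: Gamma_cap_iff[OF u ob(1,2)] fst_star)
    hence "(g, h) \<in> linking F K (fst u) (fst v) (fst w)" by (simp add: linking_def)
    with R have "snd u (\<one>\<^bsub>F\<^esub>, g) \<otimes> snd v (g, h) \<otimes> snd w (h, \<one>\<^bsub>K\<^esub>) = \<one>" by blast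
    thus "snd u (\<one>\<^bsub>F\<^esub>, g) \<otimes> snd (star A v w) (g, \<one>\<^bsub>K\<^esub>) = \<one>"
      using s[OF c h(2,3)] SA_D(3)[OF u ob(1,2) h(1)] SA_D(3)[OF v ob(2,3) h(2)]
        SA_D(3)[OF w ob(3,4) h(3)] by (simp add: A.m_assoc)
  qed
  with c show ?L by blast
qed

lemma star_assoc:
  assumes u: "u \<in> SA A F G" and v: "v \<in> SA A G H" and w: "w \<in> SA A H K"
    and ob: "F \<in> \<G>" "G \<in> \<G>" "H \<in> \<G>" "K \<in> \<G>"
    and c1: "compatible A F G H u v" "compatible A F H K (star A u v) w"
    and c2: "compatible A G H K v w" "compatible A F G K u (star A v w)"
  shows "star A (star A u v) w = star A u (star A v w)"
proof (rule SA_eqI[of _ F K])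
  note uv = star_closed[OF u v ob(1-3) c1(1)] and vw = star_closed[OF v w ob(2-4) c2(1)]
  show "star A (star A u v) w \<in> SA A F K" by (rule star_closed[OF uv w ob(1,3,4) c1(2)])
  show "star A u (star A v w) \<in> SA A F K" by (rule star_closed[OF u vw ob(1,2,4) c2(2)])
  show "fst (star A (star A u v) w) = fst (star A u (star A v w))"
    by (simp add: fst_star O_assoc)
  fix f k assume "(f, k) \<in> fst (star A (star A u v) w)"
  then obtain g h where gh: "(f, g) \<in> fst u" "(g, h) \<in> fst v" "(h, k) \<in> fst w"
    by (auto simp: fst_star)
  hence "(f, h) \<in> fst (star A u v)" "(g, k) \<in> fst (star A v w)" by (auto simp: fst_star)
  thus "snd (star A (star A u v) w) (f, k) = snd (star A u (star A v w)) (f, k)"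
    using snd_star[OF uv w ob(1,3,4) c1(2) _ gh(3)] snd_star[OF u v ob(1-3) c1(1) gh(1,2)]
      snd_star[OF u vw ob(1,2,4) c2(2) gh(1)] snd_star[OF v w ob(2-4) c2(1) gh(2,3)]
      SA_D(3)[OF u ob(1,2) gh(1)] SA_D(3)[OF v ob(2,3) gh(2)] SA_D(3)[OF w ob(3,4) gh(3)]
    by (simp add: A.m_assoc)
qed (use ob in auto)

section \<open>Twisted diagonal subgroups\<close>

lemma fst_Delta: "fst (Delta A G g) = {(conj_elt G g y, y) | y. y \<in> carrier G}"
  by (simp add: Delta_def Let_def)

lemma snd_Delta: "t \<in> fst (Delta A G g) \<Longrightarrow> snd (Delta A G g) t = \<one>"
  by (simp add: Delta_def Let_def)

lemma Delta_closed:
  assumes "G \<in> \<G>" "g \<in> carrier G"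
  shows "Delta A G g \<in> SA A G G"
proof -
  interpret G: group G by (rule group_object) fact
  note c = conj_elt_closed[OF G.is_group] conj_elt_of_one[OF G.is_group]
    conj_elt_of_mult[OF G.is_group, symmetric] conj_elt_of_inv[OF G.is_group]
  have D: "(conj_elt G g y, y) \<in> fst (Delta A G g)" if "y \<in> carrier G" for y
    using that by (auto simp: fst_Delta)
  have "(fst (Delta A G g), snd (Delta A G g)) \<in> SA A G G"
  proof (rule SA_I[OF assms(1,1)])
    show "(\<one>\<^bsub>G\<^esub>, \<one>\<^bsub>G\<^esub>) \<in> fst (Delta A G g)" using D[OF G.one_closed] assms(2) by (simp add: c)
    show "(inv\<^bsub>G\<^esub> x, inv\<^bsub>G\<^esub> y) \<in> fst (Delta A G g)" if "(x, y) \<in> fst (Delta A G g)" for x y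
      using that assms(2) by (auto simp: fst_Delta c)
    show "x \<in> carrier G \<and> y \<in> carrier G" if "(x, y) \<in> fst (Delta A G g)" for x y
      using that assms(2) by (auto simp: fst_Delta c)
    show m: "(x \<otimes>\<^bsub>G\<^esub> x', y \<otimes>\<^bsub>G\<^esub> y') \<in> fst (Delta A G g)"
      if "(x, y) \<in> fst (Delta A G g)" "(x', y') \<in> fst (Delta A G g)" for x y x' y'
      using that assms(2) by (auto simp: fst_Delta c)
    show "snd (Delta A G g) (x \<otimes>\<^bsub>G\<^esub> x', y \<otimes>\<^bsub>G\<^esub> y')
        = snd (Delta A G g) (x, y) \<otimes> snd (Delta A G g) (x', y')"
      if "(x, y) \<in> fst (Delta A G g)" "(x', y') \<in> fst (Delta A G g)" for x y x' y'
      using snd_Delta[OF m[OF that]] snd_Delta[OF that(1)] snd_Delta[OF that(2)] by simp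
    show "snd (Delta A G g) \<in> extensional (fst (Delta A G g))"
      by (simp add: Delta_def Let_def)
  qed (simp add: snd_Delta)
  thus ?thesis by simp
qed

lemma conj_SA_closed:
  assumes "u \<in> SA A F G" "F \<in> \<G>" "G \<in> \<G>" "f \<in> carrier F" "g \<in> carrier G"
  shows "conj_subchar (F \<times>\<times> G) (f, g) u \<in> SA A F G"
  using conj_subchar_closed[OF group_pair[OF assms(2,3)], of u A "(f, g)"] assms
  by (simp add: SA_def)

lemma conj_SA_mult:
  assumes "u \<in> SA A F G" "F \<in> \<G>" "G \<in> \<G>" "f \<in> carrier F" "g \<in> carrier G"
    "f' \<in> carrier F" "g' \<in> carrier G"
  shows "conj_subchar (F \<times>\<times> G) (f, g) (conj_subchar (F \<times>\<times> G) (f', g') u)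
    = conj_subchar (F \<times>\<times> G) (f \<otimes>\<^bsub>F\<^esub> f', g \<otimes>\<^bsub>G\<^esub> g') u"
  using conj_subchar_mult[OF group_pair[OF assms(2,3)], of u A "(f, g)" "(f', g')"] assms
  by (simp add: SA_def)

lemma conj_SA_one:
  assumes "u \<in> SA A F G" "F \<in> \<G>" "G \<in> \<G>"
  shows "conj_subchar (F \<times>\<times> G) (\<one>\<^bsub>F\<^esub>, \<one>\<^bsub>G\<^esub>) u = u"
  using conj_subchar_one[OF group_pair[OF assms(2,3)], of u A] assms by (simp add: SA_def)

lemma Gamma_cap_Delta_left:
  assumes u: "u \<in> SA A F G" and ob: "F \<in> \<G>" "G \<in> \<G>" and f: "f \<in> carrier F"
  shows "Gamma_cap F F G (fst (Delta A F f)) (fst u) = {\<one>\<^bsub>F\<^esub>}"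
proof -
  interpret F: group F by (rule group_object) fact
  have "y = \<one>\<^bsub>F\<^esub>" if "y \<in> carrier F" "\<one>\<^bsub>F\<^esub> = conj_elt F f y" for y
    using that f conj_elt_inv_cancel[OF F.is_group f that(1)] conj_elt_of_one[OF F.is_group, of "inv\<^bsub>F\<^esub> f"]
    by simp
  moreover have "(\<one>\<^bsub>F\<^esub>, \<one>\<^bsub>F\<^esub>) \<in> fst (Delta A F f)" by (rule SA_D(7)[OF Delta_closed]) fact+
  ultimately show ?thesis
    using SA_D(7)[OF u ob] by (auto simp: Gamma_cap_def fst_Delta)
qed

lemma Gamma_cap_Delta_right:
  assumes u: "u \<in> SA A F G" and ob: "F \<in> \<G>" "G \<in> \<G>" and g: "g \<in> carrier G"
  shows "Gamma_cap F G G (fst u) (fst (Delta A G g)) = {\<one>\<^bsub>G\<^esub>}"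
proof -
  interpret G: group G by (rule group_object) fact
  have "(\<one>\<^bsub>G\<^esub>, \<one>\<^bsub>G\<^esub>) \<in> fst (Delta A G g)" by (rule SA_D(7)[OF Delta_closed]) fact+
  thus ?thesis
    using SA_D(7)[OF u ob] g
    by (auto simp: Gamma_cap_def fst_Delta conj_elt_of_one[OF G.is_group])
qed

lemma compatible_Delta_left:
  assumes u: "u \<in> SA A F G" and ob: "F \<in> \<G>" "G \<in> \<G>" and f: "f \<in> carrier F"
  shows "compatible A F F G (Delta A F f) u"
  using SA_D(8)[OF u ob] SA_D(8)[OF Delta_closed[OF ob(1) f] ob(1,1)]
  by (simp add: compatible_iff Gamma_cap_Delta_left[OF assms])

lemma compatible_Delta_right:
  assumes u: "u \<in> SA A F G" and ob: "F \<in> \<G>" "G \<in> \<G>" and g: "g \<in> carrier G"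
  shows "compatible A F G G u (Delta A G g)"
  using SA_D(8)[OF u ob] SA_D(8)[OF Delta_closed[OF ob(2) g] ob(2,2)]
  by (simp add: compatible_iff Gamma_cap_Delta_right[OF assms])

lemma star_Delta_left:
  assumes u: "u \<in> SA A F G" and ob: "F \<in> \<G>" "G \<in> \<G>" and f: "f \<in> carrier F"
  shows "star A (Delta A F f) u = conj_subchar (F \<times>\<times> G) (f, \<one>\<^bsub>G\<^esub>) u"
proof (rule SA_eqI[OF _ _ ob])
  interpret F: group F by (rule group_object) fact
  interpret G: group G by (rule group_object) fact
  note D = Delta_closed[OF ob(1) f] and c = compatible_Delta_left[OF assms]
  have conj: "conj_elt (F \<times>\<times> G) (f, \<one>\<^bsub>G\<^esub>) (x, y) = (conj_elt F f x, y)" if "y \<in> carrier G" for x y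
    using that f by (simp add: conj_elt_DirProd F.is_group G.is_group conj_elt_by_one)
  show "star A (Delta A F f) u \<in> SA A F G" by (rule star_closed[OF D u ob(1,1,2) c])
  show "conj_subchar (F \<times>\<times> G) (f, \<one>\<^bsub>G\<^esub>) u \<in> SA A F G"
    by (rule conj_SA_closed[OF u ob f]) simp
  show "fst (star A (Delta A F f) u) = fst (conj_subchar (F \<times>\<times> G) (f, \<one>\<^bsub>G\<^esub>) u)"
  proof
    show "fst (star A (Delta A F f) u) \<subseteq> fst (conj_subchar (F \<times>\<times> G) (f, \<one>\<^bsub>G\<^esub>) u)"
      by (auto simp: fst_star fst_conj_subchar[OF group_pair[OF ob]] fst_Delta SA_D(2)[OF u ob]
          intro!: image_eqI conj[symmetric])
    show "fst (conj_subchar (F \<times>\<times> G) (f, \<one>\<^bsub>G\<^esub>) u) \<subseteq> fst (star A (Delta A F f) u)"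
    proof clarify
      fix x z assume "(x, z) \<in> fst (conj_subchar (F \<times>\<times> G) (f, \<one>\<^bsub>G\<^esub>) u)"
      then obtain y where y: "(y, z) \<in> fst u" "x = conj_elt F f y"
        by (auto simp: fst_conj_subchar[OF group_pair[OF ob]] conj SA_D(2)[OF u ob])
      hence "(x, y) \<in> fst (Delta A F f)" using SA_D(1)[OF u ob y(1)] by (auto simp: fst_Delta)
      thus "(x, z) \<in> fst (star A (Delta A F f) u)" using y(1) by (auto simp: fst_star)
    qed
  qed
  fix x z assume "(x, z) \<in> fst (star A (Delta A F f) u)"
  then obtain y where y: "(x, y) \<in> fst (Delta A F f)" "(y, z) \<in> fst u" by (auto simp: fst_star)
  hence x: "x = conj_elt F f y" by (auto simp: fst_Delta)
  have "snd (conj_subchar (F \<times>\<times> G) (f, \<one>\<^bsub>G\<^esub>) u) (x, z) = snd u (y, z)"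
    using snd_conj_subchar[OF group_pair[OF ob] u[unfolded SA_def] _ y(2), of "(f, \<one>\<^bsub>G\<^esub>)"] f
      SA_D(2)[OF u ob y(2)] by (simp add: conj x)
  thus "snd (star A (Delta A F f) u) (x, z) = snd (conj_subchar (F \<times>\<times> G) (f, \<one>\<^bsub>G\<^esub>) u) (x, z)"
    using snd_star[OF D u ob(1,1,2) c y] snd_Delta[OF y(1)] SA_D(3)[OF u ob y(2)] by simp
qed

lemma star_Delta_right:
  assumes u: "u \<in> SA A F G" and ob: "F \<in> \<G>" "G \<in> \<G>" and g: "g \<in> carrier G"
  shows "star A u (Delta A G g) = conj_subchar (F \<times>\<times> G) (\<one>\<^bsub>F\<^esub>, inv\<^bsub>G\<^esub> g) u"
proof (rule SA_eqI[OF _ _ ob])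
  interpret F: group F by (rule group_object) fact
  interpret G: group G by (rule group_object) fact
  note D = Delta_closed[OF ob(2) g] and c = compatible_Delta_right[OF assms]
  have conj: "conj_elt (F \<times>\<times> G) (\<one>\<^bsub>F\<^esub>, inv\<^bsub>G\<^esub> g) (x, y) = (x, conj_elt G (inv\<^bsub>G\<^esub> g) y)"
    if "x \<in> carrier F" for x y
    using that g by (simp add: conj_elt_DirProd F.is_group G.is_group conj_elt_by_one)
  have flip: "conj_elt G (inv\<^bsub>G\<^esub> g) (conj_elt G g y) = y"
    "conj_elt G g (conj_elt G (inv\<^bsub>G\<^esub> g) y) = y" if "y \<in> carrier G" for y
    using that g conj_elt_inv_cancel[OF G.is_group, of "inv\<^bsub>G\<^esub> g" y]
    by (simp_all add: conj_elt_inv_cancel[OF G.is_group])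
  show "star A u (Delta A G g) \<in> SA A F G" by (rule star_closed[OF u D ob(1,2,2) c])
  show "conj_subchar (F \<times>\<times> G) (\<one>\<^bsub>F\<^esub>, inv\<^bsub>G\<^esub> g) u \<in> SA A F G"
    using g by (intro conj_SA_closed[OF u ob]) simp_all
  show "fst (star A u (Delta A G g)) = fst (conj_subchar (F \<times>\<times> G) (\<one>\<^bsub>F\<^esub>, inv\<^bsub>G\<^esub> g) u)"
  proof
    show "fst (star A u (Delta A G g)) \<subseteq> fst (conj_subchar (F \<times>\<times> G) (\<one>\<^bsub>F\<^esub>, inv\<^bsub>G\<^esub> g) u)"
    proof clarify
      fix x z assume "(x, z) \<in> fst (star A u (Delta A G g))"
      then obtain y where y: "(x, y) \<in> fst u" "(y, z) \<in> fst (Delta A G g)" by (auto simp: fst_star)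
      hence "(x, z) = conj_elt (F \<times>\<times> G) (\<one>\<^bsub>F\<^esub>, inv\<^bsub>G\<^esub> g) (x, y)"
        using SA_D(1)[OF u ob y(1)] by (auto simp: conj fst_Delta flip)
      thus "(x, z) \<in> fst (conj_subchar (F \<times>\<times> G) (\<one>\<^bsub>F\<^esub>, inv\<^bsub>G\<^esub> g) u)"
        using y(1) by (simp add: fst_conj_subchar[OF group_pair[OF ob]])
    qed
    show "fst (conj_subchar (F \<times>\<times> G) (\<one>\<^bsub>F\<^esub>, inv\<^bsub>G\<^esub> g) u) \<subseteq> fst (star A u (Delta A G g))"
    proof clarify
      fix x z assume "(x, z) \<in> fst (conj_subchar (F \<times>\<times> G) (\<one>\<^bsub>F\<^esub>, inv\<^bsub>G\<^esub> g) u)"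
      then obtain y where y: "(x, y) \<in> fst u" "z = conj_elt G (inv\<^bsub>G\<^esub> g) y"
        by (auto simp: fst_conj_subchar[OF group_pair[OF ob]] conj SA_D(1)[OF u ob])
      hence "(y, z) \<in> fst (Delta A G g)"
        using SA_D(2)[OF u ob y(1)] g
        by (auto simp: fst_Delta flip conj_elt_closed[OF G.is_group])
      thus "(x, z) \<in> fst (star A u (Delta A G g))" using y(1) by (auto simp: fst_star)
    qed
  qed
  fix x z assume "(x, z) \<in> fst (star A u (Delta A G g))"
  then obtain y where y: "(x, y) \<in> fst u" "(y, z) \<in> fst (Delta A G g)" by (auto simp: fst_star)
  hence z: "z = conj_elt G (inv\<^bsub>G\<^esub> g) y" by (auto simp: fst_Delta flip)
  have "snd (conj_subchar (F \<times>\<times> G) (\<one>\<^bsub>F\<^esub>, inv\<^bsub>G\<^esub> g) u) (x, z) = snd u (x, y)"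
    using snd_conj_subchar[OF group_pair[OF ob] u[unfolded SA_def] _ y(1), of "(\<one>\<^bsub>F\<^esub>, inv\<^bsub>G\<^esub> g)"] g
      SA_D(1)[OF u ob y(1)] by (simp add: conj z)
  thus "snd (star A u (Delta A G g)) (x, z) = snd (conj_subchar (F \<times>\<times> G) (\<one>\<^bsub>F\<^esub>, inv\<^bsub>G\<^esub> g) u) (x, z)"
    using snd_star[OF u D ob(1,2,2) c y] snd_Delta[OF y(2)] SA_D(3)[OF u ob y(1)] by simp
qed

lemma conj_Delta:
  assumes G: "G \<in> \<G>" and f: "f \<in> carrier G" and g: "g \<in> carrier G"
  shows "conj_subchar (G \<times>\<times> G) (f, \<one>\<^bsub>G\<^esub>) (Delta A G g) = Delta A G (f \<otimes>\<^bsub>G\<^esub> g)"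
proof -
  interpret G: group G by (rule group_object) fact
  note D = Delta_closed[OF G] and c = compatible_Delta_left[OF Delta_closed[OF G g] G G f]
  have "star A (Delta A G f) (Delta A G g) = Delta A G (f \<otimes>\<^bsub>G\<^esub> g)"
  proof (rule SA_eqI[OF _ _ G G])
    show "star A (Delta A G f) (Delta A G g) \<in> SA A G G"
      by (rule star_closed[OF D[OF f] D[OF g] G G G c])
    show "Delta A G (f \<otimes>\<^bsub>G\<^esub> g) \<in> SA A G G" using f g by (intro D) simp
    show eq: "fst (star A (Delta A G f) (Delta A G g)) = fst (Delta A G (f \<otimes>\<^bsub>G\<^esub> g))"
      using f g
      by (auto simp: fst_star fst_Delta conj_elt_by_mult[OF G.is_group]
          conj_elt_closed[OF G.is_group] relcomp_unfold)
    fix x z assume xz: "(x, z) \<in> fst (star A (Delta A G f) (Delta A G g))"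
    then obtain y where y: "(x, y) \<in> fst (Delta A G f)" "(y, z) \<in> fst (Delta A G g)"
      by (auto simp: fst_star)
    thus "snd (star A (Delta A G f) (Delta A G g)) (x, z) = snd (Delta A G (f \<otimes>\<^bsub>G\<^esub> g)) (x, z)"
      using snd_star[OF D[OF f] D[OF g] G G G c y] xz by (simp add: snd_Delta eq)
  qed
  thus ?thesis using star_Delta_left[OF D[OF g] G G f] by simp
qed

end

section \<open>Counting intermediate elements\<close>

lemma card_eq_fibre_mult_image:
  assumes "finite X" "\<And>x. x \<in> X \<Longrightarrow> card {y \<in> X. f y = f x} = k"
  shows "card X = k * card (f ` X)"
proof -
  have "card X = (\<Sum>z \<in> f ` X. card {y \<in> X. f y = z})"
    unfolding card_eq_sum by (rule sum.image_gen[OF assms(1)])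
  also have "\<dots> = (\<Sum>z \<in> f ` X. k)" using assms(2) by (intro sum.cong) auto
  finally show ?thesis by simp
qed

context subcharacters
begin

lemma Gamma_cap_D:
  assumes "c \<in> Gamma_cap F G H U V"
  shows "c \<in> carrier G" "(\<one>\<^bsub>F\<^esub>, c) \<in> U" "(c, \<one>\<^bsub>H\<^esub>) \<in> V"
  using assms by (auto simp: Gamma_cap_def)

text \<open>The intermediate elements of a pair form a coset of \<^const>\<open>Gamma_cap\<close>.\<close>

lemma card_intermediate:
  assumes u: "u \<in> SA A F G" and v: "v \<in> SA A G H" and ob: "F \<in> \<G>" "G \<in> \<G>" "H \<in> \<G>"
    and g0: "(f, g\<^sub>0) \<in> fst u" "(g\<^sub>0, h) \<in> fst v"
  shows "card {g. (f, g) \<in> fst u \<and> (g, h) \<in> fst v} = card (Gamma_cap F G H (fst u) (fst v))"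
proof -
  interpret F: group F by (rule group_object) fact
  interpret G: group G by (rule group_object) fact
  interpret H: group H by (rule group_object) fact
  note U = SA_D[OF u ob(1,2)] and V = SA_D[OF v ob(2,3)]
  have cl: "f \<in> carrier F" "g\<^sub>0 \<in> carrier G" "h \<in> carrier H" using g0 by (auto dest: U(1,2) V(2))
  have "bij_betw (\<lambda>c. g\<^sub>0 \<otimes>\<^bsub>G\<^esub> c) (Gamma_cap F G H (fst u) (fst v))
      {g. (f, g) \<in> fst u \<and> (g, h) \<in> fst v}"
  proof (rule bij_betw_byWitness[where f' = "\<lambda>g. inv\<^bsub>G\<^esub> g\<^sub>0 \<otimes>\<^bsub>G\<^esub> g"])
    show "\<forall>c\<in>Gamma_cap F G H (fst u) (fst v). inv\<^bsub>G\<^esub> g\<^sub>0 \<otimes>\<^bsub>G\<^esub> (g\<^sub>0 \<otimes>\<^bsub>G\<^esub> c) = c"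
      using cl by (auto simp: G.l_cancel_inv dest: Gamma_cap_D)
    show "\<forall>g\<in>{g. (f, g) \<in> fst u \<and> (g, h) \<in> fst v}. g\<^sub>0 \<otimes>\<^bsub>G\<^esub> (inv\<^bsub>G\<^esub> g\<^sub>0 \<otimes>\<^bsub>G\<^esub> g) = g"
      using cl by (auto simp: G.r_cancel_inv dest: U(2))
    show "(\<lambda>c. g\<^sub>0 \<otimes>\<^bsub>G\<^esub> c) ` Gamma_cap F G H (fst u) (fst v) \<subseteq> {g. (f, g) \<in> fst u \<and> (g, h) \<in> fst v}"
    proof
      fix x assume "x \<in> (\<lambda>c. g\<^sub>0 \<otimes>\<^bsub>G\<^esub> c) ` Gamma_cap F G H (fst u) (fst v)"
      then obtain c where c: "c \<in> Gamma_cap F G H (fst u) (fst v)" "x = g\<^sub>0 \<otimes>\<^bsub>G\<^esub> c" by blast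
      thus "x \<in> {g. (f, g) \<in> fst u \<and> (g, h) \<in> fst v}"
        using U(4)[OF g0(1) Gamma_cap_D(2)[OF c(1)]] V(4)[OF g0(2) Gamma_cap_D(3)[OF c(1)]] cl
        by simp
    qed
    show "(\<lambda>g. inv\<^bsub>G\<^esub> g\<^sub>0 \<otimes>\<^bsub>G\<^esub> g) ` {g. (f, g) \<in> fst u \<and> (g, h) \<in> fst v}
        \<subseteq> Gamma_cap F G H (fst u) (fst v)"
      using SA_left_quotient[OF u ob(1,2) g0(1)] SA_right_quotient[OF v ob(2,3) g0(2)]
      by (auto simp: Gamma_cap_iff[OF u ob(1,2)])
  qed
  thus ?thesis by (simp add: bij_betw_same_card)
qed

text \<open>Project \<open>(g, h)\<close> to \<open>h\<close> here, and to \<open>g\<close> in the next lemma; the fibres are sets of intermediate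
  elements.\<close>

lemma card_linking_left:
  assumes u: "u \<in> SA A F G" and v: "v \<in> SA A G H" and w: "w \<in> SA A H K"
    and ob: "F \<in> \<G>" "G \<in> \<G>" "H \<in> \<G>" "K \<in> \<G>"
  shows "card (linking F K (fst u) (fst v) (fst w))
    = card (Gamma_cap F G H (fst u) (fst v)) * card (Gamma_cap F H K (fst u O fst v) (fst w))"
proof -
  let ?L = "linking F K (fst u) (fst v) (fst w)"
  have "?L \<subseteq> fst v" by (auto simp: linking_def)
  hence fin: "finite ?L" using finite_SA_fst[OF v ob(2,3)] by (rule finite_subset)
  have im: "snd ` ?L = Gamma_cap F H K (fst u O fst v) (fst w)"
    using SA_D(2)[OF v ob(2,3)] by (force simp: linking_def Gamma_cap_def)
  have "card {y \<in> ?L. snd y = snd x} = card (Gamma_cap F G H (fst u) (fst v))" if "x \<in> ?L" for x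
  proof -
    obtain g h where x: "x = (g, h)" "(\<one>\<^bsub>F\<^esub>, g) \<in> fst u" "(g, h) \<in> fst v" "(h, \<one>\<^bsub>K\<^esub>) \<in> fst w"
      using \<open>x \<in> ?L\<close> by (auto simp: linking_def)
    have "{y \<in> ?L. snd y = snd x} = (\<lambda>g. (g, h)) ` {g. (\<one>\<^bsub>F\<^esub>, g) \<in> fst u \<and> (g, h) \<in> fst v}"
      using x by (auto simp: linking_def)
    thus ?thesis using card_intermediate[OF u v ob(1-3) x(2,3)]
      by (simp add: card_image inj_on_def)
  qed
  from card_eq_fibre_mult_image[OF fin this] show ?thesis by (simp add: im)
qed

lemma card_linking_right:
  assumes u: "u \<in> SA A F G" and v: "v \<in> SA A G H" and w: "w \<in> SA A H K"
    and ob: "F \<in> \<G>" "G \<in> \<G>" "H \<in> \<G>" "K \<in> \<G>"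
  shows "card (linking F K (fst u) (fst v) (fst w))
    = card (Gamma_cap G H K (fst v) (fst w)) * card (Gamma_cap F G K (fst u) (fst v O fst w))"
proof -
  let ?L = "linking F K (fst u) (fst v) (fst w)"
  have "?L \<subseteq> fst v" by (auto simp: linking_def)
  hence fin: "finite ?L" using finite_SA_fst[OF v ob(2,3)] by (rule finite_subset)
  have im: "fst ` ?L = Gamma_cap F G K (fst u) (fst v O fst w)"
    using SA_D(1)[OF v ob(2,3)] by (force simp: linking_def Gamma_cap_def)
  have "card {y \<in> ?L. fst y = fst x} = card (Gamma_cap G H K (fst v) (fst w))" if "x \<in> ?L" for x
  proof -
    obtain g h where x: "x = (g, h)" "(\<one>\<^bsub>F\<^esub>, g) \<in> fst u" "(g, h) \<in> fst v" "(h, \<one>\<^bsub>K\<^esub>) \<in> fst w"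
      using \<open>x \<in> ?L\<close> by (auto simp: linking_def)
    have "{y \<in> ?L. fst y = fst x} = (\<lambda>h. (g, h)) ` {h. (g, h) \<in> fst v \<and> (h, \<one>\<^bsub>K\<^esub>) \<in> fst w}"
      using x by (auto simp: linking_def)
    thus ?thesis using card_intermediate[OF v w ob(2-4) x(3,4)]
      by (simp add: card_image inj_on_def)
  qed
  from card_eq_fibre_mult_image[OF fin this] show ?thesis by (simp add: im)
qed

lemma card_Gamma_cap_pos:
  assumes u: "u \<in> SA A F G" and v: "v \<in> SA A G H" and ob: "F \<in> \<G>" "G \<in> \<G>" "H \<in> \<G>"
  shows "card (Gamma_cap F G H (fst u) (fst v)) > 0"
proof -
  interpret G: group G by (rule group_object) fact
  have "finite (Gamma_cap F G H (fst u) (fst v))"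
    by (rule finite_subset[OF _ finite_object[OF ob(2)]]) (auto simp: Gamma_cap_def)
  moreover have "\<one>\<^bsub>G\<^esub> \<in> Gamma_cap F G H (fst u) (fst v)"
    using SA_D(7)[OF u ob(1,2)] SA_D(7)[OF v ob(2,3)] by (simp add: Gamma_cap_def)
  ultimately show ?thesis by (auto simp: card_gt_0_iff)
qed

lemma card_fibre_product:
  assumes u: "u \<in> SA A F G" and v: "v \<in> SA A G H" and ob: "F \<in> \<G>" "G \<in> \<G>" "H \<in> \<G>"
  shows "card {(f, g, h). (f, g) \<in> fst u \<and> (g, h) \<in> fst v}
    = card (Gamma_cap F G H (fst u) (fst v)) * card (fst u O fst v)"
proof -
  let ?T = "{(f, g, h). (f, g) \<in> fst u \<and> (g, h) \<in> fst v}"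
  let ?p = "\<lambda>(f, g, h). (f, h)"
  have "?T \<subseteq> carrier F \<times> carrier G \<times> carrier H"
    using SA_D(1,2)[OF u ob(1,2)] SA_D(2)[OF v ob(2,3)] by auto
  hence fin: "finite ?T" by (rule finite_subset) (simp add: finite_object ob)
  have im: "?p ` ?T = fst u O fst v" by force
  have "card {y \<in> ?T. ?p y = ?p x} = card (Gamma_cap F G H (fst u) (fst v))" if "x \<in> ?T" for x
  proof -
    obtain f g h where x: "x = (f, g, h)" "(f, g) \<in> fst u" "(g, h) \<in> fst v"
      using \<open>x \<in> ?T\<close> by auto
    have "{y \<in> ?T. ?p y = ?p x} = (\<lambda>g. (f, g, h)) ` {g. (f, g) \<in> fst u \<and> (g, h) \<in> fst v}"
      using x by auto
    thus ?thesis using card_intermediate[OF u v ob x(2,3)]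
      by (simp add: card_image inj_on_def)
  qed
  from card_eq_fibre_mult_image[OF fin this] show ?thesis by (simp add: im)
qed

end

section \<open>Double cosets\<close>

definition double_coset :: "('g, 'b) monoid_scheme \<Rightarrow> 'g set \<Rightarrow> 'g set \<Rightarrow> 'g \<Rightarrow> 'g set" where
  "double_coset G P Q x = (P #>\<^bsub>G\<^esub> x) <#>\<^bsub>G\<^esub> Q"

lemma (in group) double_coset_iff:
  "y \<in> double_coset G P Q x \<longleftrightarrow> (\<exists>p\<in>P. \<exists>q\<in>Q. y = p \<otimes> x \<otimes> q)"
  by (auto simp: double_coset_def r_coset_def set_mult_def)

lemma (in group) double_coset_self:
  assumes "subgroup P G" "subgroup Q G" "x \<in> carrier G"
  shows "x \<in> double_coset G P Q x"
  using assms subgroup.one_closed[OF assms(1)] subgroup.one_closed[OF assms(2)]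
  unfolding double_coset_iff by (metis l_one r_one)

lemma (in group) double_coset_closed:
  assumes "subgroup P G" "subgroup Q G" "x \<in> carrier G"
  shows "double_coset G P Q x \<subseteq> carrier G"
  using assms by (auto simp: double_coset_iff subgroup.mem_carrier)

lemma (in group) double_coset_sym:
  assumes P: "subgroup P G" and Q: "subgroup Q G" and x: "x \<in> carrier G"
    and y: "y \<in> double_coset G P Q x"
  shows "x \<in> double_coset G P Q y"
proof -
  obtain p q where pq: "p \<in> P" "q \<in> Q" "y = p \<otimes> x \<otimes> q" using y by (auto simp: double_coset_iff)
  moreover have "x = inv p \<otimes> y \<otimes> inv q"
    using pq x P Q by (simp add: cancel_simps subgroup.mem_carrier)
  ultimately show ?thesis
    using P Q unfolding double_coset_iff by (metis subgroup.m_inv_closed)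
qed

lemma (in group) double_coset_subset:
  assumes P: "subgroup P G" and Q: "subgroup Q G" and x: "x \<in> carrier G"
    and y: "y \<in> double_coset G P Q x"
  shows "double_coset G P Q y \<subseteq> double_coset G P Q x"
proof
  fix z assume "z \<in> double_coset G P Q y"
  then obtain p q p' q' where pq: "p \<in> P" "q \<in> Q" "p' \<in> P" "q' \<in> Q"
    "z = p' \<otimes> (p \<otimes> x \<otimes> q) \<otimes> q'" using y by (auto simp: double_coset_iff)
  moreover have "z = (p' \<otimes> p) \<otimes> x \<otimes> (q \<otimes> q')"
    using pq x P Q by (simp add: m_assoc subgroup.mem_carrier)
  moreover have "p' \<otimes> p \<in> P" "q \<otimes> q' \<in> Q" using pq P Q by (auto intro: subgroup.m_closed)
  ultimately show "z \<in> double_coset G P Q x" unfolding double_coset_iff by blast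
qed

lemma (in group) double_coset_eq:
  assumes "subgroup P G" "subgroup Q G" "x \<in> carrier G" "y \<in> double_coset G P Q x"
  shows "double_coset G P Q y = double_coset G P Q x"
  using double_coset_subset[OF assms] double_coset_closed[OF assms(1-3)] assms(4)
    double_coset_subset[OF assms(1,2) _ double_coset_sym[OF assms]] by blast

text \<open>Choosing an element from each double coset as a set gives equal choices for equal double cosets.\<close>

lemma double_coset_reps_exist:
  fixes G :: "'g monoid"
  assumes G: "group G" and P: "subgroup P G" and Q: "subgroup Q G"
  shows "\<exists>D. double_coset_reps G P Q D"
proof -
  interpret group G by (rule G)
  let ?r = "\<lambda>x. SOME y. y \<in> double_coset G P Q x"
  have r: "?r x \<in> double_coset G P Q x" if "x \<in> carrier G" for x
    using double_coset_self[OF P Q that] by (rule someI)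
  have "double_coset_reps G P Q (?r ` carrier G)"
    unfolding double_coset_reps_def double_coset_def[symmetric]
  proof (intro conjI ballI)
    show "?r ` carrier G \<subseteq> carrier G" using r double_coset_closed[OF P Q] by blast
    fix x assume x: "x \<in> carrier G"
    show "\<exists>!g. g \<in> ?r ` carrier G \<and> g \<in> double_coset G P Q x"
    proof (rule ex1I[of _ "?r x"])
      show "?r x \<in> ?r ` carrier G \<and> ?r x \<in> double_coset G P Q x" using x r by blast
      fix g assume "g \<in> ?r ` carrier G \<and> g \<in> double_coset G P Q x"
      then obtain y where y: "y \<in> carrier G" "g = ?r y" "g \<in> double_coset G P Q x" by blast
      have "double_coset G P Q y = double_coset G P Q x"
        using double_coset_eq[OF P Q x y(3)] double_coset_eq[OF P Q y(1) r[OF y(1)]] y(2) by simp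
      thus "g = ?r x" using y(2) by simp
    qed
  qed
  thus ?thesis by blast
qed

lemma finsum_double_cosets:
  fixes G :: "'g monoid"
  assumes G: "group G" and M: "module R M" and fin: "finite (carrier G)"
    and P: "subgroup P G" and Q: "subgroup Q G" and D: "double_coset_reps G P Q D"
    and k: "k \<in> carrier G \<rightarrow> carrier M"
    and const: "\<And>p x q. \<lbrakk>p \<in> P; x \<in> carrier G; q \<in> Q\<rbrakk> \<Longrightarrow> k (p \<otimes>\<^bsub>G\<^esub> x \<otimes>\<^bsub>G\<^esub> q) = k x"
  shows "finsum M k (carrier G)
    = finsum M (\<lambda>g. of_nat_in R (card (double_coset G P Q g)) \<odot>\<^bsub>M\<^esub> k g) D"
proof -
  interpret group G by (rule G)
  interpret M: module R M by (rule M)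
  have DG: "D \<subseteq> carrier G"
    and ex1: "\<And>x. x \<in> carrier G \<Longrightarrow> \<exists>!g. g \<in> D \<and> g \<in> double_coset G P Q x"
    using D by (auto simp: double_coset_reps_def double_coset_def)
  have UN: "carrier G = (\<Union>g\<in>D. double_coset G P Q g)"
  proof
    show "carrier G \<subseteq> (\<Union>g\<in>D. double_coset G P Q g)"
    proof
      fix x assume x: "x \<in> carrier G"
      then obtain g where "g \<in> D" "g \<in> double_coset G P Q x" using ex1 by blast
      thus "x \<in> (\<Union>g\<in>D. double_coset G P Q g)" using double_coset_sym[OF P Q x] by blast
    qed
    show "(\<Union>g\<in>D. double_coset G P Q g) \<subseteq> carrier G"
      using double_coset_closed[OF P Q] DG by (intro UN_least) auto
  qed
  have disj: "g = g'" if "g \<in> D" "g' \<in> D" "x \<in> double_coset G P Q g" "x \<in> double_coset G P Q g'"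
    for g g' x
  proof -
    have "g \<in> carrier G" "g' \<in> carrier G" using that(1,2) DG by auto
    hence "x \<in> carrier G" "g \<in> double_coset G P Q x" "g' \<in> double_coset G P Q x"
      using that(3,4) double_coset_closed[OF P Q] double_coset_sym[OF P Q] by auto
    thus ?thesis using ex1[of x] that(1,2) by blast
  qed
  have "finsum M k (\<Union>g\<in>D. double_coset G P Q g)
    = finsum M (\<lambda>g. finsum M k (double_coset G P Q g)) D"
  proof (rule M.add.finprod_UN_disjoint)
    show "finite D" using DG fin by (rule finite_subset)
    show "finite (double_coset G P Q g)" if "g \<in> D" for g
      using double_coset_closed[OF P Q, of g] that DG fin by (auto intro: finite_subset)
    show "k x \<in> carrier M" if "g \<in> D" "x \<in> double_coset G P Q g" for g x
      using that UN k by blast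
    show "pairwise (\<lambda>i j. disjnt (double_coset G P Q i) (double_coset G P Q j)) D"
      using disj by (auto simp: pairwise_def disjnt_def)
  qed
  also have "\<dots> = finsum M (\<lambda>g. of_nat_in R (card (double_coset G P Q g)) \<odot>\<^bsub>M\<^esub> k g) D"
  proof (rule M.finsum_cong')
    fix g assume g: "g \<in> D"
    hence kg: "k g \<in> carrier M" using DG k by auto
    have "finsum M k (double_coset G P Q g) = finsum M (\<lambda>_. k g) (double_coset G P Q g)"
      using kg g DG const by (intro M.finsum_cong') (auto simp: double_coset_iff)
    thus "finsum M k (double_coset G P Q g) = of_nat_in R (card (double_coset G P Q g)) \<odot>\<^bsub>M\<^esub> k g"
      using finsum_constant[OF M kg] by simp
  qed (use DG k in \<open>auto intro!: M.smult_closed simp: subset_iff\<close>)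
  finally show ?thesis using UN by simp
qed

context subcharacters
begin

lemma subgroup_snd_SA:
  assumes u: "u \<in> SA A F G" and ob: "F \<in> \<G>" "G \<in> \<G>"
  shows "subgroup (snd ` fst u) G"
proof -
  interpret G: group G by (rule group_object) fact
  note U = SA_D[OF u ob]
  show ?thesis
  proof (rule G.subgroupI)
    show "snd ` fst u \<noteq> {}" using U(7) by blast
    show "snd ` fst u \<subseteq> carrier G" using U(2) by auto
    show "inv\<^bsub>G\<^esub> a \<in> snd ` fst u" if "a \<in> snd ` fst u" for a using that U(6) by force
    show "a \<otimes>\<^bsub>G\<^esub> b \<in> snd ` fst u" if "a \<in> snd ` fst u" "b \<in> snd ` fst u" for a b
      using that U(4) by force
  qed
qed

lemma subgroup_fst_SA:
  assumes u: "u \<in> SA A F G" and ob: "F \<in> \<G>" "G \<in> \<G>"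
  shows "subgroup (fst ` fst u) F"
proof -
  interpret F: group F by (rule group_object) fact
  note U = SA_D[OF u ob]
  show ?thesis
  proof (rule F.subgroupI)
    show "fst ` fst u \<noteq> {}" using U(7) by blast
    show "fst ` fst u \<subseteq> carrier F" using U(1) by auto
    show "inv\<^bsub>F\<^esub> a \<in> fst ` fst u" if "a \<in> fst ` fst u" for a using that U(6) by force
    show "a \<otimes>\<^bsub>F\<^esub> b \<in> fst ` fst u" if "a \<in> fst ` fst u" "b \<in> fst ` fst u" for a b
      using that U(4) by force
  qed
qed

text \<open>Both sides count pairs in \<open>U \<times> V\<close>: map \<open>((f, p), (q, h))\<close> to \<open>p\<inverse>gq\<close>.  The image is the
  double coset of \<open>g\<close>, and every fibre is a translate of the fibre product of \<open>U\<close> and the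
  conjugate of \<open>V\<close> by \<open>g\<close>.\<close>

lemma card_double_coset:
  assumes u: "u \<in> SA A F G" and v: "v \<in> SA A G H" and ob: "F \<in> \<G>" "G \<in> \<G>" "H \<in> \<G>"
    and g: "g \<in> carrier G"
  defines "w \<equiv> conj_subchar (G \<times>\<times> H) (g, \<one>\<^bsub>H\<^esub>) v"
  shows "card (fst u) * card (fst v) = card (Gamma_cap F G H (fst u) (fst w))
    * card (fst u O fst w) * card (double_coset G (snd ` fst u) (fst ` fst v) g)"
proof -
  interpret F: group F by (rule group_object) fact
  interpret G: group G by (rule group_object) fact
  interpret H: group H by (rule group_object) fact
  note U = SA_D[OF u ob(1,2)] and V = SA_D[OF v ob(2,3)]
  have w: "w \<in> SA A G H" unfolding w_def by (rule conj_SA_closed[OF v ob(2,3) g H.one_closed])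
  have w_iff: "(k, h) \<in> fst w \<longleftrightarrow> k \<in> carrier G \<and> (inv\<^bsub>G\<^esub> g \<otimes>\<^bsub>G\<^esub> k \<otimes>\<^bsub>G\<^esub> g, h) \<in> fst v" for k h
  proof
    assume "(k, h) \<in> fst w"
    then obtain q h' where q: "(q, h') \<in> fst v" "(k, h) = conj_elt (G \<times>\<times> H) (g, \<one>\<^bsub>H\<^esub>) (q, h')"
      by (auto simp: w_def fst_conj_subchar[OF group_pair[OF ob(2,3)]])
    hence "k = g \<otimes>\<^bsub>G\<^esub> q \<otimes>\<^bsub>G\<^esub> inv\<^bsub>G\<^esub> g" "h = h'" "q \<in> carrier G"
      using V(1,2)[OF q(1)] g by (auto simp: conj_elt_DirProd G.is_group H.is_group conj_elt_def)
    thus "k \<in> carrier G \<and> (inv\<^bsub>G\<^esub> g \<otimes>\<^bsub>G\<^esub> k \<otimes>\<^bsub>G\<^esub> g, h) \<in> fst v"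
      using q(1) g by (simp add: G.cancel_simps)
  next
    assume k: "k \<in> carrier G \<and> (inv\<^bsub>G\<^esub> g \<otimes>\<^bsub>G\<^esub> k \<otimes>\<^bsub>G\<^esub> g, h) \<in> fst v"
    hence "h \<in> carrier H" using V(2) by blast
    hence "(k, h) = conj_elt (G \<times>\<times> H) (g, \<one>\<^bsub>H\<^esub>) (inv\<^bsub>G\<^esub> g \<otimes>\<^bsub>G\<^esub> k \<otimes>\<^bsub>G\<^esub> g, h)"
      using k g by (simp add: conj_elt_DirProd G.is_group H.is_group conj_elt_def G.cancel_simps)
    thus "(k, h) \<in> fst w" using k by (auto simp: w_def fst_conj_subchar[OF group_pair[OF ob(2,3)]])
  qed
  define X where "X = fst u \<times> fst v"
  define m :: "('g \<times> 'g) \<times> ('g \<times> 'g) \<Rightarrow> 'g" where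
    "m = (\<lambda>((f, p), (q, h)). inv\<^bsub>G\<^esub> p \<otimes>\<^bsub>G\<^esub> g \<otimes>\<^bsub>G\<^esub> q)"
  define T where "T = {(f, k, h). (f, k) \<in> fst u \<and> (k, h) \<in> fst w}"
  have fin: "finite X"
    by (simp add: X_def finite_SA_fst[OF u ob(1,2)] finite_SA_fst[OF v ob(2,3)])
  have im: "m ` X = double_coset G (snd ` fst u) (fst ` fst v) g"
  proof
    show "m ` X \<subseteq> double_coset G (snd ` fst u) (fst ` fst v) g"
    proof
      fix y assume "y \<in> m ` X"
      then obtain f p q h where x: "(f, p) \<in> fst u" "(q, h) \<in> fst v" "y = inv\<^bsub>G\<^esub> p \<otimes>\<^bsub>G\<^esub> g \<otimes>\<^bsub>G\<^esub> q"
        by (auto simp: X_def m_def)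
      hence "inv\<^bsub>G\<^esub> p \<in> snd ` fst u" "q \<in> fst ` fst v" using U(6)[OF x(1)] by force+
      thus "y \<in> double_coset G (snd ` fst u) (fst ` fst v) g"
        using x(3) unfolding G.double_coset_iff by blast
    qed
    show "double_coset G (snd ` fst u) (fst ` fst v) g \<subseteq> m ` X"
    proof
      fix y assume "y \<in> double_coset G (snd ` fst u) (fst ` fst v) g"
      then obtain f p q h where x: "(f, p) \<in> fst u" "(q, h) \<in> fst v" "y = p \<otimes>\<^bsub>G\<^esub> g \<otimes>\<^bsub>G\<^esub> q"
        by (auto simp: G.double_coset_iff)
      hence "y = m ((inv\<^bsub>F\<^esub> f, inv\<^bsub>G\<^esub> p), (q, h))" using U(2)[OF x(1)] by (simp add: m_def)
      moreover have "((inv\<^bsub>F\<^esub> f, inv\<^bsub>G\<^esub> p), (q, h)) \<in> X" using U(6)[OF x(1)] x(2) by (simp add: X_def)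
      ultimately show "y \<in> m ` X" by blast
    qed
  qed
  have "card {y \<in> X. m y = m x} = card T" if "x \<in> X" for x
  proof -
    obtain f\<^sub>0 p\<^sub>0 q\<^sub>0 h\<^sub>0 where x: "x = ((f\<^sub>0, p\<^sub>0), (q\<^sub>0, h\<^sub>0))" "(f\<^sub>0, p\<^sub>0) \<in> fst u" "(q\<^sub>0, h\<^sub>0) \<in> fst v"
      using \<open>x \<in> X\<close> by (auto simp: X_def)
    note x0 = U(1,2)[OF x(2)] V(1,2)[OF x(3)]
    \<comment> \<open>Multiply the given point of the fibre by a point of the fibre product; \<open>b\<close> divides it out again.\<close>
    define a :: "'g \<times> 'g \<times> 'g \<Rightarrow> ('g \<times> 'g) \<times> ('g \<times> 'g)" where
      "a = (\<lambda>(f, k, h). ((f \<otimes>\<^bsub>F\<^esub> f\<^sub>0, k \<otimes>\<^bsub>G\<^esub> p\<^sub>0),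
        (inv\<^bsub>G\<^esub> g \<otimes>\<^bsub>G\<^esub> k \<otimes>\<^bsub>G\<^esub> g \<otimes>\<^bsub>G\<^esub> q\<^sub>0, h \<otimes>\<^bsub>H\<^esub> h\<^sub>0)))"
    define b :: "('g \<times> 'g) \<times> ('g \<times> 'g) \<Rightarrow> 'g \<times> 'g \<times> 'g" where
      "b = (\<lambda>((f, p), (q, h)). (f \<otimes>\<^bsub>F\<^esub> inv\<^bsub>F\<^esub> f\<^sub>0, p \<otimes>\<^bsub>G\<^esub> inv\<^bsub>G\<^esub> p\<^sub>0, h \<otimes>\<^bsub>H\<^esub> inv\<^bsub>H\<^esub> h\<^sub>0))"
    have "bij_betw a T {y \<in> X. m y = m x}"
    proof (rule bij_betw_byWitness[where f' = b], goal_cases)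
      case 1
      show ?case
      proof
        fix y assume "y \<in> T"
        then obtain f k h where y: "y = (f, k, h)" "(f, k, h) \<in> T" by (cases y) auto
        hence "f \<in> carrier F" "k \<in> carrier G" "h \<in> carrier H"
          using U(1) V(2) by (auto simp: T_def w_iff)
        thus "b (a y) = y"
          using x0 by (simp add: a_def b_def y(1) F.m_assoc G.m_assoc H.m_assoc)
      qed
    next
      case 2
      show ?case
      proof
        fix y assume "y \<in> {y \<in> X. m y = m x}"
        then obtain f p q h where yy: "y = ((f, p), (q, h))"
          and y: "((f, p), (q, h)) \<in> X" "m ((f, p), (q, h)) = m x"
          by (cases y; cases "fst y"; cases "snd y") auto
        hence y': "(f, p) \<in> fst u" "(q, h) \<in> fst v" by (auto simp: X_def)
        note c = U(1,2)[OF y'(1)] V(1,2)[OF y'(2)]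
        have "inv\<^bsub>G\<^esub> p \<otimes>\<^bsub>G\<^esub> g \<otimes>\<^bsub>G\<^esub> q = inv\<^bsub>G\<^esub> p\<^sub>0 \<otimes>\<^bsub>G\<^esub> g \<otimes>\<^bsub>G\<^esub> q\<^sub>0" using y(2) x(1) by (simp add: m_def)
        hence "inv\<^bsub>G\<^esub> g \<otimes>\<^bsub>G\<^esub> p \<otimes>\<^bsub>G\<^esub> (inv\<^bsub>G\<^esub> p \<otimes>\<^bsub>G\<^esub> g \<otimes>\<^bsub>G\<^esub> q)
          = inv\<^bsub>G\<^esub> g \<otimes>\<^bsub>G\<^esub> p \<otimes>\<^bsub>G\<^esub> (inv\<^bsub>G\<^esub> p\<^sub>0 \<otimes>\<^bsub>G\<^esub> g \<otimes>\<^bsub>G\<^esub> q\<^sub>0)" by simp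
        hence "inv\<^bsub>G\<^esub> g \<otimes>\<^bsub>G\<^esub> (p \<otimes>\<^bsub>G\<^esub> inv\<^bsub>G\<^esub> p\<^sub>0) \<otimes>\<^bsub>G\<^esub> g \<otimes>\<^bsub>G\<^esub> q\<^sub>0 = q"
          using c x0 g by (simp add: G.cancel_simps)
        thus "a (b y) = y"
          using c x0 by (simp add: a_def b_def yy F.m_assoc G.m_assoc H.m_assoc)
      qed
    next
      case 3
      show ?case
      proof (rule image_subsetI)
        fix y assume "y \<in> T"
        then obtain f k h where y: "y = (f, k, h)" "(f, k, h) \<in> T" by (cases y) auto
        hence t: "(f, k) \<in> fst u" "(inv\<^bsub>G\<^esub> g \<otimes>\<^bsub>G\<^esub> k \<otimes>\<^bsub>G\<^esub> g, h) \<in> fst v" by (auto simp: T_def w_iff)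
        note c = U(2)[OF t(1)]
        have "m ((f \<otimes>\<^bsub>F\<^esub> f\<^sub>0, k \<otimes>\<^bsub>G\<^esub> p\<^sub>0), (inv\<^bsub>G\<^esub> g \<otimes>\<^bsub>G\<^esub> k \<otimes>\<^bsub>G\<^esub> g \<otimes>\<^bsub>G\<^esub> q\<^sub>0, h \<otimes>\<^bsub>H\<^esub> h\<^sub>0)) = m x"
          using c x0 g by (simp add: m_def x(1) G.cancel_simps)
        thus "a y \<in> {y \<in> X. m y = m x}"
          using U(4)[OF t(1) x(2)] V(4)[OF t(2) x(3)] by (simp add: a_def b_def y(1) X_def)
      qed
    next
      case 4
      show ?case
      proof (rule image_subsetI)
        fix y assume "y \<in> {y \<in> X. m y = m x}"
        then obtain f p q h where yy: "y = ((f, p), (q, h))"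
          and y: "((f, p), (q, h)) \<in> X" "m ((f, p), (q, h)) = m x"
          by (cases y; cases "fst y"; cases "snd y") auto
        hence y': "(f, p) \<in> fst u" "(q, h) \<in> fst v" by (auto simp: X_def)
        note c = U(1,2)[OF y'(1)] V(1,2)[OF y'(2)]
        have "inv\<^bsub>G\<^esub> p \<otimes>\<^bsub>G\<^esub> g \<otimes>\<^bsub>G\<^esub> q = inv\<^bsub>G\<^esub> p\<^sub>0 \<otimes>\<^bsub>G\<^esub> g \<otimes>\<^bsub>G\<^esub> q\<^sub>0" using y(2) x(1) by (simp add: m_def)
        hence "inv\<^bsub>G\<^esub> g \<otimes>\<^bsub>G\<^esub> p \<otimes>\<^bsub>G\<^esub> (inv\<^bsub>G\<^esub> p \<otimes>\<^bsub>G\<^esub> g \<otimes>\<^bsub>G\<^esub> q) \<otimes>\<^bsub>G\<^esub> inv\<^bsub>G\<^esub> q\<^sub>0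
          = inv\<^bsub>G\<^esub> g \<otimes>\<^bsub>G\<^esub> p \<otimes>\<^bsub>G\<^esub> (inv\<^bsub>G\<^esub> p\<^sub>0 \<otimes>\<^bsub>G\<^esub> g \<otimes>\<^bsub>G\<^esub> q\<^sub>0) \<otimes>\<^bsub>G\<^esub> inv\<^bsub>G\<^esub> q\<^sub>0" by simp
        hence e: "inv\<^bsub>G\<^esub> g \<otimes>\<^bsub>G\<^esub> (p \<otimes>\<^bsub>G\<^esub> inv\<^bsub>G\<^esub> p\<^sub>0) \<otimes>\<^bsub>G\<^esub> g = q \<otimes>\<^bsub>G\<^esub> inv\<^bsub>G\<^esub> q\<^sub>0"
          using c x0 g by (simp add: G.cancel_simps)
        show "b y \<in> T"
          using U(4)[OF y'(1) U(6)[OF x(2)]] V(4)[OF y'(2) V(6)[OF x(3)]] c x0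
          by (simp add: a_def b_def yy T_def w_iff e)
      qed
    qed
    thus ?thesis by (simp add: bij_betw_same_card)
  qed
  from card_eq_fibre_mult_image[OF fin this]
  show ?thesis
    using card_fibre_product[OF u w ob] unfolding im T_def by (simp add: X_def card_cartesian_product)
qed

end

section \<open>The category of subcharacters\<close>

locale subcharacter_algebra = subcharacters A \<G> + R: cring R
  for A :: "('a, 'z) monoid_scheme" (structure) and \<G> :: "'g monoid set"
    and R :: "('r, 'x) ring_scheme" +
  fixes l :: "nat \<Rightarrow> 'r"
  assumes of_nat_unit: "n > 0 \<Longrightarrow> of_nat_in R n \<in> Units R"
    and l_closed: "n > 0 \<Longrightarrow> l n \<in> carrier R"
    and l_one: "l (Suc 0) = \<one>\<^bsub>R\<^esub>"
    and l_mult: "\<lbrakk>m > 0; n > 0\<rbrakk> \<Longrightarrow> l (m * n) = l m \<otimes>\<^bsub>R\<^esub> l n"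
begin

abbreviation "Hm \<equiv> RS_hom R A"
abbreviation "cmp \<equiv> RS_comp R l A"
abbreviation "s \<equiv> s_sym R A"

text \<open>The value of \<^const>\<open>sigma\<close> at a group element, by \<open>sigma_grp_sym\<close> below.\<close>

abbreviation sg :: "'g monoid \<Rightarrow> 'g \<Rightarrow> (('g \<times> 'g, 'a) subchar \<Rightarrow> 'r)" where
  "sg G g \<equiv> s G G (Delta A G g)"

abbreviation av :: "'g monoid \<Rightarrow> (('g \<times> 'g, 'a) subchar \<Rightarrow> 'r)" where
  "av G \<equiv> sigma R A G (e_idem R G)"

lemma Hm_module: "module R (Hm F G)"
  unfolding RS_hom_def by (rule R.module_free_module)

lemma s_closed [simp]: "s F G u \<in> carrier (Hm F G)"
  by (simp add: s_sym_def RS_hom_def)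

lemma Hm_linear_eqI:
  assumes "module R M" "f \<in> linear_maps R (Hm F G) M" "g \<in> linear_maps R (Hm F G) M"
    "\<And>u. u \<in> SA A F G \<Longrightarrow> f (s F G u) = g (s F G u)" "\<phi> \<in> carrier (Hm F G)"
  shows "f \<phi> = g \<phi>"
  using R.linear_maps_free_eqI[OF assms(1), of f "SA A F G" g \<phi>] assms(2-)
  by (simp add: RS_hom_def s_sym_def)

lemma RS_product_closed:
  assumes "u \<in> SA A F G" "v \<in> SA A G H" "F \<in> \<G>" "G \<in> \<G>" "H \<in> \<G>"
  shows "(if compatible A F G H u v
      then l (card (Gamma_cap F G H (fst u) (fst v))) \<odot>\<^bsub>Hm F H\<^esub> s F H (star A u v)
      else \<zero>\<^bsub>Hm F H\<^esub>) \<in> carrier (Hm F H)"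
proof -
  interpret M: module R "Hm F H" by (rule Hm_module)
  show ?thesis using l_closed[OF card_Gamma_cap_pos[OF assms]] by simp
qed

lemma cmp_symbols:
  assumes "u \<in> SA A F G" "v \<in> SA A G H" "F \<in> \<G>" "G \<in> \<G>" "H \<in> \<G>"
  shows "cmp F G H (s F G u) (s G H v) = (if compatible A F G H u v
      then l (card (Gamma_cap F G H (fst u) (fst v))) \<odot>\<^bsub>Hm F H\<^esub> s F H (star A u v)
      else \<zero>\<^bsub>Hm F H\<^esub>)"
  using assms RS_product_closed unfolding RS_comp_def s_sym_def[of R A F G] s_sym_def[of R A G H]
  by (intro R.bilinear_ext_symbol[OF Hm_module]) auto

lemma cmp_linear:
  assumes "F \<in> \<G>" "G \<in> \<G>" "H \<in> \<G>"
  shows "\<psi> \<in> carrier (Hm G H) \<Longrightarrow> (\<lambda>\<phi>. cmp F G H \<phi> \<psi>) \<in> linear_maps R (Hm F G) (Hm F H)"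
    and "\<phi> \<in> carrier (Hm F G) \<Longrightarrow> cmp F G H \<phi> \<in> linear_maps R (Hm G H) (Hm F H)"
  using R.bilinear_ext_linear[OF Hm_module[of F H] RS_product_closed[OF _ _ assms], of "SA A F G" "SA A G H"]
  by (simp_all add: RS_comp_def RS_hom_def[of R A F G] RS_hom_def[of R A G H])

lemma cmp_closed [simp]:
  assumes "F \<in> \<G>" "G \<in> \<G>" "H \<in> \<G>" "\<phi> \<in> carrier (Hm F G)" "\<psi> \<in> carrier (Hm G H)"
  shows "cmp F G H \<phi> \<psi> \<in> carrier (Hm F H)"
  using linear_mapsD(1)[OF cmp_linear(2)] assms by blast

lemma cmp_smult:
  assumes "F \<in> \<G>" "G \<in> \<G>" "H \<in> \<G>" "\<phi> \<in> carrier (Hm F G)" "\<psi> \<in> carrier (Hm G H)"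
    "r \<in> carrier R"
  shows "cmp F G H (r \<odot>\<^bsub>Hm F G\<^esub> \<phi>) \<psi> = r \<odot>\<^bsub>Hm F H\<^esub> cmp F G H \<phi> \<psi>"
    and "cmp F G H \<phi> (r \<odot>\<^bsub>Hm G H\<^esub> \<psi>) = r \<odot>\<^bsub>Hm F H\<^esub> cmp F G H \<phi> \<psi>"
  using linear_mapsD(3)[OF cmp_linear(1)[OF assms(1-3,5)] assms(6,4)]
    linear_mapsD(3)[OF cmp_linear(2)[OF assms(1-3,4)] assms(6,5)] by simp_all

lemma cmp_zero:
  assumes "F \<in> \<G>" "G \<in> \<G>" "H \<in> \<G>"
  shows "\<psi> \<in> carrier (Hm G H) \<Longrightarrow> cmp F G H \<zero>\<^bsub>Hm F G\<^esub> \<psi> = \<zero>\<^bsub>Hm F H\<^esub>"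
    and "\<phi> \<in> carrier (Hm F G) \<Longrightarrow> cmp F G H \<phi> \<zero>\<^bsub>Hm G H\<^esub> = \<zero>\<^bsub>Hm F H\<^esub>"
  using linear_maps_zero[OF Hm_module Hm_module cmp_linear(1)[OF assms]]
    linear_maps_zero[OF Hm_module Hm_module cmp_linear(2)[OF assms]] by simp_all

text \<open>Both sides are \<open>\<ell>(|L|)\<close> times the symbol of the triple composition if the common compatibility
  condition holds, and zero otherwise, where \<open>L\<close> is the linking set: its order is the product of the
  two orders of intersection groups for either bracketing, and \<open>\<ell>\<close> is multiplicative.\<close>

lemma cmp_assoc_symbols:
  assumes u: "u \<in> SA A F G" and v: "v \<in> SA A G H" and w: "w \<in> SA A H K"
    and ob: "F \<in> \<G>" "G \<in> \<G>" "H \<in> \<G>" "K \<in> \<G>"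
  shows "cmp F H K (cmp F G H (s F G u) (s G H v)) (s H K w)
    = cmp F G K (s F G u) (cmp G H K (s G H v) (s H K w))"
proof -
  interpret M: module R "Hm F K" by (rule Hm_module)
  let ?L = "linking F K (fst u) (fst v) (fst w)"
  define c where "c \<longleftrightarrow>
    (\<forall>(g, h) \<in> ?L. snd u (\<one>\<^bsub>F\<^esub>, g) \<otimes> snd v (g, h) \<otimes> snd w (h, \<one>\<^bsub>K\<^esub>) = \<one>)"
  note csl = compatible_star_left[OF u v w ob, folded c_def]
    and csr = compatible_star_right[OF u v w ob, folded c_def]
  have left: "cmp F H K (cmp F G H (s F G u) (s G H v)) (s H K w)
    = (if c then l (card ?L) \<odot>\<^bsub>Hm F K\<^esub> s F K (star A (star A u v) w) else \<zero>\<^bsub>Hm F K\<^esub>)"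
  proof (cases "compatible A F G H u v")
    case True
    note uv = star_closed[OF u v ob(1-3) True]
    note p = card_Gamma_cap_pos[OF u v ob(1-3)] card_Gamma_cap_pos[OF uv w ob(1,3,4)]
    have "c = compatible A F H K (star A u v) w"
      using csl True by blast
    moreover have "l (card ?L) = l (card (Gamma_cap F G H (fst u) (fst v)))
        \<otimes>\<^bsub>R\<^esub> l (card (Gamma_cap F H K (fst (star A u v)) (fst w)))"
      using p l_mult by (simp add: card_linking_left[OF u v w ob] fst_star)
    ultimately show ?thesis
      using True l_closed[OF p(1)] l_closed[OF p(2)]
      by (simp add: cmp_symbols[OF u v ob(1-3)] cmp_smult ob cmp_symbols[OF uv w ob(1,3,4)]
          M.smult_assoc1 del: One_nat_def)
  next
    case False
    hence "\<not> c" using csl by blast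
    thus ?thesis using False by (simp add: cmp_symbols[OF u v ob(1-3)] cmp_zero ob)
  qed
  have right: "cmp F G K (s F G u) (cmp G H K (s G H v) (s H K w))
    = (if c then l (card ?L) \<odot>\<^bsub>Hm F K\<^esub> s F K (star A u (star A v w)) else \<zero>\<^bsub>Hm F K\<^esub>)"
  proof (cases "compatible A G H K v w")
    case True
    note vw = star_closed[OF v w ob(2-4) True]
    note p = card_Gamma_cap_pos[OF v w ob(2-4)] card_Gamma_cap_pos[OF u vw ob(1,2,4)]
    have "c = compatible A F G K u (star A v w)"
      using csr True by blast
    moreover have "l (card ?L) = l (card (Gamma_cap G H K (fst v) (fst w)))
        \<otimes>\<^bsub>R\<^esub> l (card (Gamma_cap F G K (fst u) (fst (star A v w))))"
      using p l_mult by (simp add: card_linking_right[OF u v w ob] fst_star)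
    ultimately show ?thesis
      using True l_closed[OF p(1)] l_closed[OF p(2)]
      by (simp add: cmp_symbols[OF v w ob(2-4)] cmp_smult ob cmp_symbols[OF u vw ob(1,2,4)]
          M.smult_assoc1 del: One_nat_def)
  next
    case False
    hence "\<not> c" using csr by blast
    thus ?thesis using False by (simp add: cmp_symbols[OF v w ob(2-4)] cmp_zero ob)
  qed
  have "star A (star A u v) w = star A u (star A v w)" if c
    using csl csr that
    by (intro star_assoc[OF u v w ob]) blast+
  thus ?thesis unfolding left right by simp
qed

lemma cmp_assoc:
  assumes ob: "F \<in> \<G>" "G \<in> \<G>" "H \<in> \<G>" "K \<in> \<G>"
    and "\<phi> \<in> carrier (Hm F G)" "\<psi> \<in> carrier (Hm G H)" "\<chi> \<in> carrier (Hm H K)"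
  shows "cmp F H K (cmp F G H \<phi> \<psi>) \<chi> = cmp F G K \<phi> (cmp G H K \<psi> \<chi>)"
proof -
  have 1: "cmp F H K (cmp F G H \<phi> (s G H v)) (s H K w) = cmp F G K \<phi> (cmp G H K (s G H v) (s H K w))"
    if "v \<in> SA A G H" "w \<in> SA A H K" "\<phi> \<in> carrier (Hm F G)" for \<phi> v w
    by (rule Hm_linear_eqI[where f = "\<lambda>\<phi>. cmp F H K (cmp F G H \<phi> (s G H v)) (s H K w)"
          and g = "\<lambda>\<phi>. cmp F G K \<phi> (cmp G H K (s G H v) (s H K w))",
          OF Hm_module
            linear_maps_comp[OF cmp_linear(1)[OF ob(1,2,3) s_closed] cmp_linear(1)[OF ob(1,3,4) s_closed]]
            cmp_linear(1)[OF ob(1,2,4) cmp_closed[OF ob(2-4) s_closed s_closed]]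
            cmp_assoc_symbols[OF _ that(1,2) ob] that(3)])
  have 2: "cmp F H K (cmp F G H \<phi> \<psi>) (s H K w) = cmp F G K \<phi> (cmp G H K \<psi> (s H K w))"
    if "w \<in> SA A H K" "\<phi> \<in> carrier (Hm F G)" "\<psi> \<in> carrier (Hm G H)" for \<phi> \<psi> w
    by (rule Hm_linear_eqI[where f = "\<lambda>\<psi>. cmp F H K (cmp F G H \<phi> \<psi>) (s H K w)"
          and g = "\<lambda>\<psi>. cmp F G K \<phi> (cmp G H K \<psi> (s H K w))",
          OF Hm_module _ _ 1[OF _ that(1,2)] that(3)])
      (use ob that in \<open>auto intro!: linear_maps_comp[OF cmp_linear(2) cmp_linear(1)]
        linear_maps_comp[OF cmp_linear(1) cmp_linear(2)]\<close>)
  show ?thesis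
    by (rule Hm_linear_eqI[where f = "cmp F H K (cmp F G H \<phi> \<psi>)"
          and g = "\<lambda>\<chi>. cmp F G K \<phi> (cmp G H K \<psi> \<chi>)",
          OF Hm_module cmp_linear(2)[OF ob(1,3,4) cmp_closed[OF ob(1-3) assms(5,6)]]
            linear_maps_comp[OF cmp_linear(2)[OF ob(2,3,4) assms(6)] cmp_linear(2)[OF ob(1,2,4) assms(5)]]
            2[OF _ assms(5,6)] assms(7)])
qed

section \<open>The group algebras and their averaging idempotents\<close>

lemma cmp_sg_symbol:
  assumes u: "u \<in> SA A F G" and ob: "F \<in> \<G>" "G \<in> \<G>"
  shows "f \<in> carrier F \<Longrightarrow> cmp F F G (sg F f) (s F G u) = s F G (conj_subchar (F \<times>\<times> G) (f, \<one>\<^bsub>G\<^esub>) u)"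
    and "g \<in> carrier G \<Longrightarrow> cmp F G G (s F G u) (sg G g)
      = s F G (conj_subchar (F \<times>\<times> G) (\<one>\<^bsub>F\<^esub>, inv\<^bsub>G\<^esub> g) u)"
proof -
  interpret M: module R "Hm F G" by (rule Hm_module)
  show "cmp F F G (sg F f) (s F G u) = s F G (conj_subchar (F \<times>\<times> G) (f, \<one>\<^bsub>G\<^esub>) u)"
    if "f \<in> carrier F"
    using compatible_Delta_left[OF u ob that] Gamma_cap_Delta_left[OF u ob that] l_one
    by (simp add: cmp_symbols[OF Delta_closed[OF ob(1) that] u ob(1,1,2)] star_Delta_left[OF u ob that])
  show "cmp F G G (s F G u) (sg G g) = s F G (conj_subchar (F \<times>\<times> G) (\<one>\<^bsub>F\<^esub>, inv\<^bsub>G\<^esub> g) u)"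
    if "g \<in> carrier G"
    using compatible_Delta_right[OF u ob that] Gamma_cap_Delta_right[OF u ob that] l_one
    by (simp add: cmp_symbols[OF u Delta_closed[OF ob(2) that] ob(1,2,2)] star_Delta_right[OF u ob that])
qed

lemma cmp_sg_sg:
  assumes "G \<in> \<G>" "g \<in> carrier G" "h \<in> carrier G"
  shows "cmp G G G (sg G g) (sg G h) = sg G (g \<otimes>\<^bsub>G\<^esub> h)"
  using cmp_sg_symbol(1)[OF Delta_closed assms(1,1,2)] conj_Delta assms by simp

lemma cmp_sg_one:
  assumes ob: "F \<in> \<G>" "G \<in> \<G>" and \<phi>: "\<phi> \<in> carrier (Hm F G)"
  shows "cmp F F G (sg F \<one>\<^bsub>F\<^esub>) \<phi> = \<phi>" and "cmp F G G \<phi> (sg G \<one>\<^bsub>G\<^esub>) = \<phi>"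
proof -
  interpret F: group F by (rule group_object) fact
  interpret G: group G by (rule group_object) fact
  have id: "(\<lambda>\<phi>. \<phi>) \<in> linear_maps R (Hm F G) (Hm F G)" by (rule linear_mapsI) auto
  show "cmp F F G (sg F \<one>\<^bsub>F\<^esub>) \<phi> = \<phi>"
    by (rule Hm_linear_eqI[OF Hm_module cmp_linear(2)[OF ob(1,1,2)] id _ \<phi>])
      (auto simp: cmp_sg_symbol(1) conj_SA_one ob)
  show "cmp F G G \<phi> (sg G \<one>\<^bsub>G\<^esub>) = \<phi>"
    by (rule Hm_linear_eqI[OF Hm_module cmp_linear(1)[OF ob(1,2,2)] id _ \<phi>])
      (auto simp: cmp_sg_symbol(2) conj_SA_one ob)
qed

lemma sigma_linear:
  assumes "G \<in> \<G>"
  shows "sigma R A G \<in> linear_maps R (free_module R (carrier G)) (Hm G G)"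
  unfolding sigma_def by (rule R.linear_ext_linear[OF Hm_module]) simp

lemma sigma_grp_sym:
  assumes "G \<in> \<G>" "g \<in> carrier G"
  shows "sigma R A G (grp_sym R G g) = sg G g"
  unfolding sigma_def grp_sym_def using assms by (intro R.linear_ext_symbol[OF Hm_module]) simp_all

abbreviation "iord G \<equiv> inv\<^bsub>R\<^esub> of_nat_in R (order G)"

lemma order_pos: "G \<in> \<G> \<Longrightarrow> order G > 0"
  using monoid.one_closed[OF group.is_monoid[OF group_object]] finite_object by (auto simp: order_def card_gt_0_iff)

lemma iord_closed [simp]: "G \<in> \<G> \<Longrightarrow> iord G \<in> carrier R"
  using of_nat_unit[OF order_pos] by simp

lemma av_eq:
  assumes G: "G \<in> \<G>"
  shows "av G = iord G \<odot>\<^bsub>Hm G G\<^esub> finsum (Hm G G) (sg G) (carrier G)"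
proof -
  interpret M: module R "Hm G G" by (rule Hm_module)
  interpret RG: module R "free_module R (carrier G)" by (rule R.module_free_module)
  have c: "grp_sym R G \<in> carrier G \<rightarrow> carrier (free_module R (carrier G))"
    by (simp add: grp_sym_def)
  have "av G = iord G \<odot>\<^bsub>Hm G G\<^esub> sigma R A G (finsum (free_module R (carrier G)) (grp_sym R G) (carrier G))"
    unfolding e_idem_def Let_def
    by (rule linear_mapsD(3)[OF sigma_linear[OF G]]) (use c G in auto)
  also have "sigma R A G (finsum (free_module R (carrier G)) (grp_sym R G) (carrier G))
    = finsum (Hm G G) (\<lambda>g. sigma R A G (grp_sym R G g)) (carrier G)"
    by (rule linear_maps_finsum[OF R.module_free_module Hm_module sigma_linear[OF G] c])
  also have "\<dots> = finsum (Hm G G) (sg G) (carrier G)"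
    by (rule M.finsum_cong') (simp_all add: sigma_grp_sym G)
  finally show ?thesis .
qed

lemma av_closed [simp]:
  assumes "G \<in> \<G>"
  shows "av G \<in> carrier (Hm G G)"
proof -
  interpret M: module R "Hm G G" by (rule Hm_module)
  show ?thesis using assms by (simp add: av_eq)
qed

lemma linear_av:
  assumes M: "module R M" and ob: "G \<in> \<G>" and f: "f \<in> linear_maps R (Hm G G) M"
  shows "f (av G) = iord G \<odot>\<^bsub>M\<^esub> finsum M (\<lambda>g. f (sg G g)) (carrier G)"
proof -
  interpret H: module R "Hm G G" by (rule Hm_module)
  have "f (av G) = iord G \<odot>\<^bsub>M\<^esub> f (finsum (Hm G G) (sg G) (carrier G))"
    unfolding av_eq[OF ob] by (rule linear_mapsD(3)[OF f]) (use ob in auto)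
  also have "f (finsum (Hm G G) (sg G) (carrier G)) = finsum M (\<lambda>g. f (sg G g)) (carrier G)"
    by (rule linear_maps_finsum[OF Hm_module M f]) simp
  finally show ?thesis .
qed

text \<open>The averaging element acts trivially wherever all group elements do, because the factor
  \<open>1 / |G|\<close> cancels the number of terms.\<close>

lemma linear_av_const:
  assumes M: "module R M" and ob: "G \<in> \<G>" and f: "f \<in> linear_maps R (Hm G G) M"
    and x: "x \<in> carrier M" and c: "\<And>g. g \<in> carrier G \<Longrightarrow> f (sg G g) = x"
  shows "f (av G) = x"
proof -
  interpret M: module R M by (rule M)
  have "f (av G) = iord G \<odot>\<^bsub>M\<^esub> finsum M (\<lambda>_. x) (carrier G)"
    unfolding linear_av[OF M ob f] by (subst M.finsum_cong'[OF refl _ c]) (use x in auto)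
  also have "\<dots> = (iord G \<otimes>\<^bsub>R\<^esub> of_nat_in R (order G)) \<odot>\<^bsub>M\<^esub> x"
    using x ob by (simp add: finsum_constant[OF M x] order_def[symmetric] M.smult_assoc1)
  also have "\<dots> = x" using x of_nat_unit[OF order_pos[OF ob]] by simp
  finally show ?thesis .
qed

lemma av_cmp_fixed:
  assumes ob: "F \<in> \<G>" "G \<in> \<G>" and \<phi>: "\<phi> \<in> carrier (Hm F G)"
    and fixed: "\<And>f. f \<in> carrier F \<Longrightarrow> cmp F F G (sg F f) \<phi> = \<phi>"
  shows "cmp F F G (av F) \<phi> = \<phi>"
  by (rule linear_av_const[OF Hm_module ob(1) cmp_linear(1)[OF ob(1,1,2) \<phi>] \<phi> fixed])

lemma cmp_av_fixed:
  assumes ob: "F \<in> \<G>" "G \<in> \<G>" and \<phi>: "\<phi> \<in> carrier (Hm F G)"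
    and fixed: "\<And>g. g \<in> carrier G \<Longrightarrow> cmp F G G \<phi> (sg G g) = \<phi>"
  shows "cmp F G G \<phi> (av G) = \<phi>"
  by (rule linear_av_const[OF Hm_module ob(2) cmp_linear(2)[OF ob(1,2,2) \<phi>] \<phi> fixed])

lemma sg_cmp_av:
  assumes ob: "G \<in> \<G>" and h: "h \<in> carrier G"
  shows "cmp G G G (sg G h) (av G) = av G" and "cmp G G G (av G) (sg G h) = av G"
proof -
  interpret G: group G by (rule group_object) fact
  interpret M: module R "Hm G G" by (rule Hm_module)
  have "finsum (Hm G G) (\<lambda>g. cmp G G G (sg G h) (sg G g)) (carrier G)
    = finsum (Hm G G) (\<lambda>g. sg G (h \<otimes>\<^bsub>G\<^esub> g)) (carrier G)"
    using ob h by (intro M.finsum_cong') (auto simp: cmp_sg_sg)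
  also have "\<dots> = finsum (Hm G G) (sg G) ((\<lambda>g. h \<otimes>\<^bsub>G\<^esub> g) ` carrier G)"
    using h by (intro M.finsum_reindex[symmetric]) (auto simp: inj_on_def)
  also have "(\<lambda>g. h \<otimes>\<^bsub>G\<^esub> g) ` carrier G = carrier G" using h by (rule G.surj_const_mult)
  finally show "cmp G G G (sg G h) (av G) = av G"
    unfolding linear_av[OF Hm_module ob cmp_linear(2)[OF ob ob ob s_closed]] by (simp add: av_eq[OF ob])
  have "finsum (Hm G G) (\<lambda>g. cmp G G G (sg G g) (sg G h)) (carrier G)
    = finsum (Hm G G) (\<lambda>g. sg G (g \<otimes>\<^bsub>G\<^esub> h)) (carrier G)"
    using ob h by (intro M.finsum_cong') (auto simp: cmp_sg_sg)
  also have "\<dots> = finsum (Hm G G) (sg G) ((\<lambda>g. g \<otimes>\<^bsub>G\<^esub> h) ` carrier G)"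
    using h by (intro M.finsum_reindex[symmetric]) (auto simp: inj_on_def)
  also have "(\<lambda>g. g \<otimes>\<^bsub>G\<^esub> h) ` carrier G = carrier G"
  proof
    show "(\<lambda>g. g \<otimes>\<^bsub>G\<^esub> h) ` carrier G \<subseteq> carrier G" using h by auto
    show "carrier G \<subseteq> (\<lambda>g. g \<otimes>\<^bsub>G\<^esub> h) ` carrier G"
    proof
      fix x assume "x \<in> carrier G"
      thus "x \<in> (\<lambda>g. g \<otimes>\<^bsub>G\<^esub> h) ` carrier G"
        using h by (intro image_eqI[of _ _ "x \<otimes>\<^bsub>G\<^esub> inv\<^bsub>G\<^esub> h"]) (simp_all add: G.m_assoc)
    qed
  qed
  finally show "cmp G G G (av G) (sg G h) = av G"
    unfolding linear_av[OF Hm_module ob cmp_linear(1)[OF ob ob ob s_closed]] by (simp add: av_eq[OF ob])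
qed

lemma av_cmp_av:
  assumes "G \<in> \<G>"
  shows "cmp G G G (av G) (av G) = av G"
  using assms by (intro av_cmp_fixed) (simp_all add: sg_cmp_av)

section \<open>The invariant category\<close>

abbreviation "Inv \<equiv> RSbar_hom R l A"

lemma RS_act_eq:
  assumes "F \<in> \<G>" "G \<in> \<G>" "f \<in> carrier F" "g \<in> carrier G"
  shows "RS_act R l A F G (f, g) \<phi> = cmp F G G (cmp F F G (sg F f) \<phi>) (sg G (inv\<^bsub>G\<^esub> g))"
  using assms group.inv_closed[OF group_object]
  by (simp add: RS_act_def sigma_grp_sym)

text \<open>Since \<open>\<sigma>(1)\<close> is the identity, invariance under \<open>F \<times> G\<close> splits into invariance under
  multiplication from the left and from the right.\<close>

lemma Inv_iff:
  assumes ob: "F \<in> \<G>" "G \<in> \<G>"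
  shows "\<phi> \<in> carrier (Inv F G) \<longleftrightarrow> \<phi> \<in> carrier (Hm F G) \<and>
    (\<forall>f\<in>carrier F. cmp F F G (sg F f) \<phi> = \<phi>) \<and> (\<forall>g\<in>carrier G. cmp F G G \<phi> (sg G g) = \<phi>)"
    (is "_ \<longleftrightarrow> ?R")
proof -
  interpret F: group F by (rule group_object) fact
  interpret G: group G by (rule group_object) fact
  have d: "\<phi> \<in> carrier (Inv F G) \<longleftrightarrow> \<phi> \<in> carrier (Hm F G) \<and>
    (\<forall>f\<in>carrier F. \<forall>g\<in>carrier G. cmp F G G (cmp F F G (sg F f) \<phi>) (sg G (inv\<^bsub>G\<^esub> g)) = \<phi>)"
    using ob by (auto simp: RSbar_hom_def RS_act_eq)
  show ?thesis
  proof
    assume L: "\<phi> \<in> carrier (Inv F G)"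
    hence \<phi>: "\<phi> \<in> carrier (Hm F G)"
      and act: "\<And>f g. \<lbrakk>f \<in> carrier F; g \<in> carrier G\<rbrakk>
        \<Longrightarrow> cmp F G G (cmp F F G (sg F f) \<phi>) (sg G (inv\<^bsub>G\<^esub> g)) = \<phi>" by (auto simp: d)
    have "cmp F F G (sg F f) \<phi> = \<phi>" if "f \<in> carrier F" for f
      using act[OF that G.one_closed] \<phi> ob by (simp add: cmp_sg_one)
    moreover have "cmp F G G \<phi> (sg G g) = \<phi>" if "g \<in> carrier G" for g
      using act[OF F.one_closed G.inv_closed[OF that]] \<phi> ob that by (simp add: cmp_sg_one)
    ultimately show ?R using \<phi> by blast
  qed (auto simp: d)
qed

lemma Inv_D:
  assumes "\<phi> \<in> carrier (Inv F G)" "F \<in> \<G>" "G \<in> \<G>"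
  shows "\<phi> \<in> carrier (Hm F G)"
    and "f \<in> carrier F \<Longrightarrow> cmp F F G (sg F f) \<phi> = \<phi>"
    and "g \<in> carrier G \<Longrightarrow> cmp F G G \<phi> (sg G g) = \<phi>"
    and "cmp F F G (av F) \<phi> = \<phi>" and "cmp F G G \<phi> (av G) = \<phi>"
  using assms by (auto simp: Inv_iff av_cmp_fixed cmp_av_fixed)

lemma Inv_simps [simp]:
  shows "\<zero>\<^bsub>Inv F G\<^esub> = \<zero>\<^bsub>Hm F G\<^esub>" "\<phi> \<oplus>\<^bsub>Inv F G\<^esub> \<psi> = \<phi> \<oplus>\<^bsub>Hm F G\<^esub> \<psi>"
    "r \<odot>\<^bsub>Inv F G\<^esub> \<phi> = r \<odot>\<^bsub>Hm F G\<^esub> \<phi>"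
  by (simp_all add: RSbar_hom_def)

lemma Inv_module:
  assumes ob: "F \<in> \<G>" "G \<in> \<G>"
  shows "module R (Inv F G)"
proof -
  interpret M: module R "Hm F G" by (rule Hm_module)
  note I = Inv_iff[OF ob]
  note lin = linear_mapsD[OF cmp_linear(1)[OF ob(1,2,2) s_closed]]
    linear_mapsD[OF cmp_linear(2)[OF ob(1,1,2) s_closed]]
  have smult: "r \<odot>\<^bsub>Hm F G\<^esub> \<phi> \<in> carrier (Inv F G)" if "r \<in> carrier R" "\<phi> \<in> carrier (Inv F G)" for r \<phi>
    using that by (simp add: I lin)
  have "submodule (carrier (Inv F G)) R (Hm F G)"
  proof (rule M.submoduleI)
    show "carrier (Inv F G) \<subseteq> carrier (Hm F G)" by (auto simp: I)
    show "\<zero>\<^bsub>Hm F G\<^esub> \<in> carrier (Inv F G)"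
      using ob cmp_zero(1)[OF ob(1,2,2) s_closed] cmp_zero(2)[OF ob(1,1,2) s_closed] by (simp add: I)
    show "\<ominus>\<^bsub>Hm F G\<^esub> a \<in> carrier (Inv F G)" if "a \<in> carrier (Inv F G)" for a
      using smult[of "\<ominus>\<^bsub>R\<^esub> \<one>\<^bsub>R\<^esub>" a] that Inv_D(1)[OF that ob] by (simp add: M.smult_l_minus)
    show "a \<oplus>\<^bsub>Hm F G\<^esub> b \<in> carrier (Inv F G)"
      if "a \<in> carrier (Inv F G)" "b \<in> carrier (Inv F G)" for a b
      using that by (simp add: I lin)
  qed (rule smult)
  from submodule.submodule_is_module[OF this Hm_module] show ?thesis by (simp add: RSbar_hom_def)
qed

lemma Inv_incl: "\<lbrakk>F \<in> \<G>; G \<in> \<G>\<rbrakk> \<Longrightarrow> (\<lambda>\<phi>. \<phi>) \<in> linear_maps R (Inv F G) (Hm F G)"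
  by (rule linear_mapsI) (auto dest: Inv_D(1))

lemma Inv_cod:
  assumes "f \<in> linear_maps R M (Hm F G)" "\<And>x. x \<in> carrier M \<Longrightarrow> f x \<in> carrier (Inv F G)"
  shows "f \<in> linear_maps R M (Inv F G)"
  using assms(2) linear_mapsD(2,3)[OF assms(1)] by (intro linear_mapsI) simp_all

lemma cmp_Inv_closed:
  assumes ob: "F \<in> \<G>" "G \<in> \<G>" "H \<in> \<G>"
    and \<phi>: "\<phi> \<in> carrier (Inv F G)" and \<psi>: "\<psi> \<in> carrier (Inv G H)"
  shows "cmp F G H \<phi> \<psi> \<in> carrier (Inv F H)"
proof -
  note h = Inv_D[OF \<phi> ob(1,2)] and k = Inv_D[OF \<psi> ob(2,3)]
  show ?thesis
    unfolding Inv_iff[OF ob(1,3)]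
    using h(1) k(1) cmp_assoc[OF ob(1,1,2,3) s_closed h(1) k(1)] cmp_assoc[OF ob(1,2,3,3) h(1) k(1) s_closed]
    by (simp add: ob h(2) k(3)) (metis h(2))
qed

lemma RSbar_simps [simp]:
  shows "Ob (RSbar R l A \<G>) = \<G>" "Hom (RSbar R l A \<G>) = Inv" "Comp (RSbar R l A \<G>) = cmp"
    "Ident (RSbar R l A \<G>) = av"
  by (simp_all add: RSbar_def RS_def)

lemma linear_category_RSbar: "linear_category R (RSbar R l A \<G>)"
proof (intro linear_category.intro linear_category_axioms.intro, unfold RSbar_simps)
  show "cring R" by (rule R.is_cring)
next
  fix F G assume "F \<in> \<G>" "G \<in> \<G>"
  thus "module R (Inv F G)" by (rule Inv_module)
next
  fix F G H \<psi> assume ob: "F \<in> \<G>" "G \<in> \<G>" "H \<in> \<G>" and \<psi>: "\<psi> \<in> carrier (Inv G H)"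
  show "(\<lambda>\<phi>. cmp F G H \<phi> \<psi>) \<in> linear_maps R (Inv F G) (Inv F H)"
    by (rule Inv_cod[OF linear_maps_comp[OF Inv_incl[OF ob(1,2)]
          cmp_linear(1)[OF ob Inv_D(1)[OF \<psi> ob(2,3)]]] cmp_Inv_closed[OF ob _ \<psi>]])
next
  fix F G H \<phi> assume ob: "F \<in> \<G>" "G \<in> \<G>" "H \<in> \<G>" and \<phi>: "\<phi> \<in> carrier (Inv F G)"
  show "(\<lambda>\<psi>. cmp F G H \<phi> \<psi>) \<in> linear_maps R (Inv G H) (Inv F H)"
    by (rule Inv_cod[OF linear_maps_comp[OF Inv_incl[OF ob(2,3)]
          cmp_linear(2)[OF ob Inv_D(1)[OF \<phi> ob(1,2)]]] cmp_Inv_closed[OF ob \<phi>]])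
next
  show "associative_comp (RSbar R l A \<G>)"
    unfolding associative_comp_def RSbar_simps using cmp_assoc Inv_D(1) by blast
next
  fix G assume "G \<in> \<G>"
  thus "av G \<in> carrier (Inv G G)" by (simp add: Inv_iff sg_cmp_av)
qed (rule Inv_D(4,5); assumption)+

section \<open>The isomorphism and its inverse\<close>

abbreviation "Bm \<equiv> RB_hom R A"
abbreviation "d \<equiv> d_sym R A"
abbreviation "sb \<equiv> sbar R l A"

abbreviation "nat_inv n \<equiv> inv\<^bsub>R\<^esub> of_nat_in R n"

definition nu_sym ::
    "'g monoid \<Rightarrow> 'g monoid \<Rightarrow> ('g \<times> 'g, 'a) subchar \<Rightarrow> (('g \<times> 'g, 'a) subchar \<Rightarrow> 'r)" where
  "nu_sym F G u = (of_nat_in R (order G) \<otimes>\<^bsub>R\<^esub> nat_inv (card (fst u))) \<odot>\<^bsub>Hm F G\<^esub> sb F G u"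

lemma nat_inv_closed: "n > 0 \<Longrightarrow> nat_inv n \<in> carrier R"
  using of_nat_unit by simp

lemma nat_inv_cancel: "n > 0 \<Longrightarrow> nat_inv n \<otimes>\<^bsub>R\<^esub> of_nat_in R n = \<one>\<^bsub>R\<^esub>"
  "n > 0 \<Longrightarrow> of_nat_in R n \<otimes>\<^bsub>R\<^esub> nat_inv n = \<one>\<^bsub>R\<^esub>"
  using of_nat_unit by simp_all

lemma nat_inv_mult:
  assumes "m > 0" "n > 0"
  shows "nat_inv (m * n) = nat_inv m \<otimes>\<^bsub>R\<^esub> nat_inv n"
proof (rule R.comm_inv_char)
  note c = nat_inv_closed[OF assms(1)] nat_inv_closed[OF assms(2)]
  show "of_nat_in R (m * n) \<in> carrier R" "nat_inv m \<otimes>\<^bsub>R\<^esub> nat_inv n \<in> carrier R"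
    using c by simp_all
  have "of_nat_in R (m * n) \<otimes>\<^bsub>R\<^esub> (nat_inv m \<otimes>\<^bsub>R\<^esub> nat_inv n)
    = (of_nat_in R m \<otimes>\<^bsub>R\<^esub> nat_inv m) \<otimes>\<^bsub>R\<^esub> (of_nat_in R n \<otimes>\<^bsub>R\<^esub> nat_inv n)"
    using c by (simp add: R.of_nat_in_mult R.m_ac)
  thus "of_nat_in R (m * n) \<otimes>\<^bsub>R\<^esub> (nat_inv m \<otimes>\<^bsub>R\<^esub> nat_inv n) = \<one>\<^bsub>R\<^esub>"
    using nat_inv_cancel(2) assms by simp
qed

definition average :: "'g monoid \<Rightarrow> 'g monoid \<Rightarrow> (('g \<times> 'g, 'a) subchar \<Rightarrow> 'r)
    \<Rightarrow> (('g \<times> 'g, 'a) subchar \<Rightarrow> 'r)" where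
  "average F G \<phi> = cmp F G G (cmp F F G (av F) \<phi>) (av G)"

lemma sbar_eq_average: "sb F G u = average F G (s F G u)"
  by (simp add: sbar_def average_def)

lemma average_linear_Hm:
  assumes "F \<in> \<G>" "G \<in> \<G>"
  shows "average F G \<in> linear_maps R (Hm F G) (Hm F G)"
  unfolding average_def
  by (rule linear_maps_comp[OF cmp_linear(2)[OF assms(1,1,2) av_closed[OF assms(1)]]
        cmp_linear(1)[OF assms(1,2,2) av_closed[OF assms(2)]]])

lemma average_Inv:
  assumes ob: "F \<in> \<G>" "G \<in> \<G>" and \<phi>: "\<phi> \<in> carrier (Hm F G)"
  shows "average F G \<phi> \<in> carrier (Inv F G)"
  unfolding Inv_iff[OF ob]
proof (intro conjI ballI)
  show "average F G \<phi> \<in> carrier (Hm F G)" using ob \<phi> by (simp add: average_def)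
  fix f assume f: "f \<in> carrier F"
  show "cmp F F G (sg F f) (average F G \<phi>) = average F G \<phi>"
    using ob \<phi> f by (simp add: average_def cmp_assoc[symmetric] sg_cmp_av)
next
  fix g assume g: "g \<in> carrier G"
  show "cmp F G G (average F G \<phi>) (sg G g) = average F G \<phi>"
    using ob \<phi> g by (simp add: average_def cmp_assoc sg_cmp_av)
qed

lemma average_fixes_Inv:
  assumes "F \<in> \<G>" "G \<in> \<G>" "\<phi> \<in> carrier (Inv F G)"
  shows "average F G \<phi> = \<phi>"
  using assms by (simp add: average_def Inv_D)

lemma average_linear:
  assumes "F \<in> \<G>" "G \<in> \<G>"
  shows "average F G \<in> linear_maps R (Hm F G) (Inv F G)"
  by (rule Inv_cod[OF average_linear_Hm[OF assms] average_Inv[OF assms]])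

lemma average_sg:
  assumes ob: "F \<in> \<G>" "G \<in> \<G>" and \<phi>: "\<phi> \<in> carrier (Hm F G)"
  shows "f \<in> carrier F \<Longrightarrow> average F G (cmp F F G (sg F f) \<phi>) = average F G \<phi>"
    and "g \<in> carrier G \<Longrightarrow> average F G (cmp F G G \<phi> (sg G g)) = average F G \<phi>"
  using ob \<phi> by (simp add: average_def cmp_assoc[of F F F G, symmetric] sg_cmp_av,
      simp add: average_def cmp_assoc sg_cmp_av)

lemma s_conj:
  assumes u: "u \<in> SA A F G" and ob: "F \<in> \<G>" "G \<in> \<G>" and x: "f \<in> carrier F" "g \<in> carrier G"
  shows "s F G (conj_subchar (F \<times>\<times> G) (f, g) u) = cmp F G G (cmp F F G (sg F f) (s F G u)) (sg G (inv\<^bsub>G\<^esub> g))"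
proof -
  interpret F: group F by (rule group_object) fact
  interpret G: group G by (rule group_object) fact
  show ?thesis
    using x by (simp add: cmp_sg_symbol[OF _ ob] u conj_SA_closed[OF u ob] conj_SA_mult[OF u ob])
qed

text \<open>The average depends only on the orbit: conjugation multiplies \<open>s\<^sub>u\<close> by group elements on both
  sides, which averaging absorbs.\<close>

lemma orbit_of_D:
  assumes u: "u \<in> SA A F G" and ob: "F \<in> \<G>" "G \<in> \<G>" and v: "v \<in> orbit_of F G u"
  shows "v \<in> SA A F G" and "sb F G v = sb F G u" and "card (fst v) = card (fst u)"
    and "orbit_of F G v = orbit_of F G u"
proof -
  interpret F: group F by (rule group_object) fact
  interpret G: group G by (rule group_object) fact
  interpret FG: group "F \<times>\<times> G" by (rule group_pair[OF ob])
  obtain f g where x: "f \<in> carrier F" "g \<in> carrier G" and v_eq: "v = conj_subchar (F \<times>\<times> G) (f, g) u"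
    using v by (auto simp: orbit_def)
  show "v \<in> SA A F G" unfolding v_eq by (rule conj_SA_closed[OF u ob x])
  show "sb F G v = sb F G u"
    unfolding v_eq sbar_eq_average s_conj[OF u ob x]
    using x ob by (simp add: average_sg)
  have "inj_on (conj_elt (F \<times>\<times> G) (f, g)) (fst u)"
    using x conj_elt_inv_cancel[OF FG.is_group, of "(f, g)"] SA_D(1,2)[OF u ob]
    by (intro inj_on_inverseI[of _ "conj_elt (F \<times>\<times> G) (inv\<^bsub>F \<times>\<times> G\<^esub> (f, g))"]) auto
  thus "card (fst v) = card (fst u)"
    by (simp add: v_eq fst_conj_subchar[OF FG.is_group] card_image)
  show "orbit_of F G v = orbit_of F G u"
  proof
    show "orbit_of F G v \<subseteq> orbit_of F G u"
    proof
      fix w assume "w \<in> orbit_of F G v"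
      then obtain f' g' where y: "f' \<in> carrier F" "g' \<in> carrier G"
        "w = conj_subchar (F \<times>\<times> G) (f', g') v" by (auto simp: orbit_def)
      hence "w = conj_subchar (F \<times>\<times> G) (f' \<otimes>\<^bsub>F\<^esub> f, g' \<otimes>\<^bsub>G\<^esub> g) u"
        using x by (simp add: v_eq conj_SA_mult[OF u ob])
      thus "w \<in> orbit_of F G u" using x y unfolding orbit_def by fastforce
    qed
    show "orbit_of F G u \<subseteq> orbit_of F G v"
    proof
      fix w assume "w \<in> orbit_of F G u"
      then obtain f' g' where y: "f' \<in> carrier F" "g' \<in> carrier G"
        "w = conj_subchar (F \<times>\<times> G) (f', g') u" by (auto simp: orbit_def)
      have "w = conj_subchar (F \<times>\<times> G) (f' \<otimes>\<^bsub>F\<^esub> inv\<^bsub>F\<^esub> f, g' \<otimes>\<^bsub>G\<^esub> inv\<^bsub>G\<^esub> g) v"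
        using x y by (simp add: v_eq conj_SA_mult[OF u ob] F.m_assoc G.m_assoc)
      thus "w \<in> orbit_of F G v" using x y unfolding orbit_def by fastforce
    qed
  qed
qed

lemma orbit_of_self:
  assumes u: "u \<in> SA A F G" and ob: "F \<in> \<G>" "G \<in> \<G>"
  shows "u \<in> orbit_of F G u"
proof -
  interpret FG: group "F \<times>\<times> G" by (rule group_pair[OF ob])
  show ?thesis using conj_SA_one[OF assms] FG.one_closed by (force simp: orbit_def)
qed

lemma nu_sym_orbit:
  assumes "u \<in> SA A F G" "F \<in> \<G>" "G \<in> \<G>" "v \<in> orbit_of F G u"
  shows "nu_sym F G v = nu_sym F G u"
  by (simp add: nu_sym_def orbit_of_D[OF assms])

lemma orbit_in_SA_orbits: "u \<in> SA A F G \<Longrightarrow> orbit_of F G u \<in> SA_orbits A F G"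
  unfolding SA_orbits_def orbits_def by blast

lemma SA_orbits_cases:
  assumes "X \<in> SA_orbits A F G"
  obtains u where "u \<in> SA A F G" "X = orbit_of F G u"
  using assms by (auto simp: SA_orbits_def orbits_def)

lemma Bm_module: "module R (Bm F G)"
  unfolding RB_hom_def by (rule R.module_free_module)

lemma d_closed [simp]: "d F G u \<in> carrier (Bm F G)"
  by (simp add: d_sym_def RB_hom_def)

lemma Bm_linear_eqI:
  assumes "module R M" "f \<in> linear_maps R (Bm F G) M" "g \<in> linear_maps R (Bm F G) M"
    "\<And>u. u \<in> SA A F G \<Longrightarrow> f (d F G u) = g (d F G u)" "\<phi> \<in> carrier (Bm F G)"
  shows "f \<phi> = g \<phi>"
proof (rule R.linear_maps_free_eqI[OF assms(1), of f "SA_orbits A F G" g \<phi>])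
  fix X assume "X \<in> SA_orbits A F G"
  thus "f (symbol R (SA_orbits A F G) X) = g (symbol R (SA_orbits A F G) X)"
    using assms(4) by (auto simp: d_sym_def elim: SA_orbits_cases)
qed (use assms in \<open>simp_all add: RB_hom_def\<close>)

lemma sbar_Inv: "\<lbrakk>F \<in> \<G>; G \<in> \<G>\<rbrakk> \<Longrightarrow> sb F G u \<in> carrier (Inv F G)"
  unfolding sbar_eq_average by (rule average_Inv) simp_all

lemma sbar_closed [simp]: "\<lbrakk>F \<in> \<G>; G \<in> \<G>\<rbrakk> \<Longrightarrow> sb F G u \<in> carrier (Hm F G)"
  using sbar_Inv Inv_D(1) by blast

lemma nu_sym_Inv:
  assumes "u \<in> SA A F G" "F \<in> \<G>" "G \<in> \<G>"
  shows "nu_sym F G u \<in> carrier (Inv F G)"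
proof -
  interpret I: module R "Inv F G" by (rule Inv_module) fact+
  show ?thesis
    using I.smult_closed[OF _ sbar_Inv[OF assms(2,3)]] nat_inv_closed[OF card_SA_fst_pos[OF assms]]
    by (simp add: nu_sym_def)
qed

lemma nu_orbit_value:
  assumes u: "u \<in> SA A F G" and ob: "F \<in> \<G>" "G \<in> \<G>"
  shows "(THE z. \<forall>v\<in>orbit_of F G u. z = (of_nat_in R (order G) \<otimes>\<^bsub>R\<^esub> nat_inv (card (fst v)))
      \<odot>\<^bsub>Inv F G\<^esub> sb F G v) = nu_sym F G u"
  unfolding Inv_simps nu_sym_def[symmetric]
proof (rule the_equality)
  show "\<forall>v\<in>orbit_of F G u. nu_sym F G u = nu_sym F G v"
    using nu_sym_orbit[OF assms] by metis
  show "z = nu_sym F G u" if "\<forall>v\<in>orbit_of F G u. z = nu_sym F G v" for z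
    using that orbit_of_self[OF assms] by blast
qed

lemma nu_values_Inv:
  assumes ob: "F \<in> \<G>" "G \<in> \<G>"
  shows "(\<lambda>X. THE z. \<forall>v\<in>X. z = (of_nat_in R (order G) \<otimes>\<^bsub>R\<^esub> nat_inv (card (fst v)))
      \<odot>\<^bsub>Inv F G\<^esub> sb F G v) \<in> SA_orbits A F G \<rightarrow> carrier (Inv F G)"
proof
  fix X assume "X \<in> SA_orbits A F G"
  then obtain u where u: "u \<in> SA A F G" "X = orbit_of F G u" by (rule SA_orbits_cases)
  show "(THE z. \<forall>v\<in>X. z = (of_nat_in R (order G) \<otimes>\<^bsub>R\<^esub> nat_inv (card (fst v)))
      \<odot>\<^bsub>Inv F G\<^esub> sb F G v) \<in> carrier (Inv F G)"
    unfolding u(2) nu_orbit_value[OF u(1) ob] by (rule nu_sym_Inv[OF u(1) ob])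
qed

lemma nu_linear:
  assumes "F \<in> \<G>" "G \<in> \<G>"
  shows "nu_map R l A F G \<in> linear_maps R (Bm F G) (Inv F G)"
  unfolding nu_map_def RB_hom_def
  by (rule R.linear_ext_linear[OF Inv_module[OF assms] nu_values_Inv[OF assms]])

lemma nu_d:
  assumes "u \<in> SA A F G" "F \<in> \<G>" "G \<in> \<G>"
  shows "nu_map R l A F G (d F G u) = nu_sym F G u"
  unfolding nu_map_def d_sym_def
  by (subst R.linear_ext_symbol[OF Inv_module[OF assms(2,3)] nu_values_Inv[OF assms(2,3)]
        orbit_in_SA_orbits[OF assms(1)]]) (rule nu_orbit_value[OF assms])

text \<open>The inverse of \<open>\<nu>\<close>.  It is defined on the whole free module, where it can be prescribed on
  symbols; the invariant elements are not spanned by symbols.\<close>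

definition orbit_map ::
    "'g monoid \<Rightarrow> 'g monoid \<Rightarrow> (('g \<times> 'g, 'a) subchar \<Rightarrow> 'r) \<Rightarrow> (('g \<times> 'g, 'a) subchar set \<Rightarrow> 'r)" where
  "orbit_map F G = linear_ext R (SA A F G) (Bm F G)
     (\<lambda>u. (of_nat_in R (card (fst u)) \<otimes>\<^bsub>R\<^esub> iord G) \<odot>\<^bsub>Bm F G\<^esub> d F G u)"

lemma orbit_map_values:
  assumes "G \<in> \<G>"
  shows "(\<lambda>u. (of_nat_in R (card (fst u)) \<otimes>\<^bsub>R\<^esub> iord G) \<odot>\<^bsub>Bm F G\<^esub> d F G u)
    \<in> SA A F G \<rightarrow> carrier (Bm F G)"
proof
  interpret B: module R "Bm F G" by (rule Bm_module)
  fix u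
  show "(of_nat_in R (card (fst u)) \<otimes>\<^bsub>R\<^esub> iord G) \<odot>\<^bsub>Bm F G\<^esub> d F G u \<in> carrier (Bm F G)"
    by (rule B.smult_closed[OF R.m_closed[OF R.of_nat_in_closed iord_closed[OF assms]] d_closed])
qed

lemma orbit_map_linear:
  assumes "F \<in> \<G>" "G \<in> \<G>"
  shows "orbit_map F G \<in> linear_maps R (Hm F G) (Bm F G)"
  unfolding orbit_map_def RS_hom_def
  by (rule R.linear_ext_linear[OF Bm_module orbit_map_values[OF assms(2)]])

lemma orbit_map_s:
  assumes "u \<in> SA A F G" "F \<in> \<G>" "G \<in> \<G>"
  shows "orbit_map F G (s F G u) = (of_nat_in R (card (fst u)) \<otimes>\<^bsub>R\<^esub> iord G) \<odot>\<^bsub>Bm F G\<^esub> d F G u"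
  unfolding orbit_map_def s_sym_def
  by (rule R.linear_ext_symbol[OF Bm_module orbit_map_values[OF assms(3)] assms(1)])

lemma orbit_map_sg:
  assumes ob: "F \<in> \<G>" "G \<in> \<G>" and \<phi>: "\<phi> \<in> carrier (Hm F G)"
  shows "f \<in> carrier F \<Longrightarrow> orbit_map F G (cmp F F G (sg F f) \<phi>) = orbit_map F G \<phi>"
    and "g \<in> carrier G \<Longrightarrow> orbit_map F G (cmp F G G \<phi> (sg G g)) = orbit_map F G \<phi>"
proof -
  interpret F: group F by (rule group_object) fact
  interpret G: group G by (rule group_object) fact
  have inv: "orbit_map F G (s F G (conj_subchar (F \<times>\<times> G) (f, g) u)) = orbit_map F G (s F G u)"
    if "u \<in> SA A F G" "f \<in> carrier F" "g \<in> carrier G" for u f g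
  proof -
    have v: "conj_subchar (F \<times>\<times> G) (f, g) u \<in> orbit_of F G u" using that by (auto simp: orbit_def)
    note D = orbit_of_D[OF that(1) ob v]
    show ?thesis
      unfolding orbit_map_s[OF D(1) ob] orbit_map_s[OF that(1) ob] d_sym_def D(3,4) by (rule refl)
  qed
  show "orbit_map F G (cmp F F G (sg F f) \<phi>) = orbit_map F G \<phi>" if "f \<in> carrier F"
    by (rule Hm_linear_eqI[OF Bm_module
          linear_maps_comp[OF cmp_linear(2)[OF ob(1,1,2) s_closed] orbit_map_linear[OF ob]]
          orbit_map_linear[OF ob] _ \<phi>])
      (simp add: cmp_sg_symbol ob that inv)
  show "orbit_map F G (cmp F G G \<phi> (sg G g)) = orbit_map F G \<phi>" if "g \<in> carrier G"
    by (rule Hm_linear_eqI[OF Bm_module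
          linear_maps_comp[OF cmp_linear(1)[OF ob(1,2,2) s_closed] orbit_map_linear[OF ob]]
          orbit_map_linear[OF ob] _ \<phi>])
      (simp add: cmp_sg_symbol ob that inv)
qed

text \<open>Multiplication with group elements moves a symbol within its orbit, so the map does not see it, nor
  does it see averaging.\<close>

lemma orbit_map_average:
  assumes ob: "F \<in> \<G>" "G \<in> \<G>" and \<phi>: "\<phi> \<in> carrier (Hm F G)"
  shows "orbit_map F G (average F G \<phi>) = orbit_map F G \<phi>"
proof -
  note Q = orbit_map_linear[OF ob]
  have "orbit_map F G (cmp F G G (cmp F F G (av F) \<phi>) (av G)) = orbit_map F G (cmp F F G (av F) \<phi>)"
    by (rule linear_av_const[where f = "\<lambda>\<alpha>. orbit_map F G (cmp F G G (cmp F F G (av F) \<phi>) \<alpha>)",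
          OF Bm_module ob(2) linear_maps_comp[OF cmp_linear(2)[OF ob(1,2,2)] Q]])
      (use ob \<phi> linear_mapsD(1)[OF Q] in \<open>auto simp: orbit_map_sg\<close>)
  also have "\<dots> = orbit_map F G \<phi>"
    by (rule linear_av_const[where f = "\<lambda>\<alpha>. orbit_map F G (cmp F F G \<alpha> \<phi>)",
          OF Bm_module ob(1) linear_maps_comp[OF cmp_linear(1)[OF ob(1,1,2)] Q]])
      (use ob \<phi> linear_mapsD(1)[OF Q] in \<open>auto simp: orbit_map_sg\<close>)
  finally show ?thesis by (simp add: average_def)
qed

lemma orbit_map_nu:
  assumes ob: "F \<in> \<G>" "G \<in> \<G>" and \<phi>: "\<phi> \<in> carrier (Bm F G)"
  shows "orbit_map F G (nu_map R l A F G \<phi>) = \<phi>"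
proof -
  interpret B: module R "Bm F G" by (rule Bm_module)
  have id: "(\<lambda>\<phi>. \<phi>) \<in> linear_maps R (Bm F G) (Bm F G)" by (rule linear_mapsI) auto
  have Q: "orbit_map F G \<in> linear_maps R (Inv F G) (Bm F G)"
    using linear_maps_comp[OF Inv_incl[OF ob] orbit_map_linear[OF ob]] .
  show ?thesis
  proof (rule Bm_linear_eqI[OF Bm_module linear_maps_comp[OF nu_linear[OF ob] Q] id _ \<phi>])
    fix u assume u: "u \<in> SA A F G"
    let ?a = "of_nat_in R (order G)" and ?b = "of_nat_in R (card (fst u))"
    note pos = card_SA_fst_pos[OF u ob] order_pos[OF ob(2)]
    have "orbit_map F G (nu_sym F G u)
      = (?a \<otimes>\<^bsub>R\<^esub> nat_inv (card (fst u))) \<odot>\<^bsub>Bm F G\<^esub> orbit_map F G (sb F G u)"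
      unfolding nu_sym_def
      by (rule linear_mapsD(3)[OF orbit_map_linear[OF ob]]) (use ob pos nat_inv_closed in auto)
    also have "\<dots> = (?a \<otimes>\<^bsub>R\<^esub> nat_inv (card (fst u)) \<otimes>\<^bsub>R\<^esub> (?b \<otimes>\<^bsub>R\<^esub> iord G)) \<odot>\<^bsub>Bm F G\<^esub> d F G u"
      using ob nat_inv_closed[OF pos(1)]
      by (simp add: sbar_eq_average orbit_map_average orbit_map_s[OF u ob] B.smult_assoc1)
    also have "?a \<otimes>\<^bsub>R\<^esub> nat_inv (card (fst u)) \<otimes>\<^bsub>R\<^esub> (?b \<otimes>\<^bsub>R\<^esub> iord G)
      = (?a \<otimes>\<^bsub>R\<^esub> iord G) \<otimes>\<^bsub>R\<^esub> (nat_inv (card (fst u)) \<otimes>\<^bsub>R\<^esub> ?b)"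
      using ob nat_inv_closed[OF pos(1)] by (simp add: R.m_ac)
    also have "\<dots> = \<one>\<^bsub>R\<^esub>" using nat_inv_cancel[OF pos(1)] nat_inv_cancel[OF pos(2)] by simp
    finally show "orbit_map F G (nu_map R l A F G (d F G u)) = d F G u" by (simp add: nu_d[OF u ob])
  qed
qed

text \<open>On the whole free module the composite is the projection onto the invariant elements, which can
  be verified on symbols.\<close>

lemma nu_orbit_map:
  assumes ob: "F \<in> \<G>" "G \<in> \<G>" and \<phi>: "\<phi> \<in> carrier (Inv F G)"
  shows "nu_map R l A F G (orbit_map F G \<phi>) = \<phi>"
proof -
  have "nu_map R l A F G (orbit_map F G \<phi>) = average F G \<phi>"
  proof (rule Hm_linear_eqI[OF Inv_module[OF ob]
        linear_maps_comp[OF orbit_map_linear[OF ob] nu_linear[OF ob]] average_linear[OF ob]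
        _ Inv_D(1)[OF \<phi> ob]])
    fix u assume u: "u \<in> SA A F G"
    interpret M: module R "Hm F G" by (rule Hm_module)
    let ?a = "of_nat_in R (order G)" and ?b = "of_nat_in R (card (fst u))"
    note pos = card_SA_fst_pos[OF u ob] order_pos[OF ob(2)]
    have "nu_map R l A F G (orbit_map F G (s F G u))
      = (?b \<otimes>\<^bsub>R\<^esub> iord G) \<odot>\<^bsub>Inv F G\<^esub> nu_map R l A F G (d F G u)"
      unfolding orbit_map_s[OF u ob]
      by (rule linear_mapsD(3)[OF nu_linear[OF ob]]) (use ob in auto)
    also have "\<dots> = (?b \<otimes>\<^bsub>R\<^esub> iord G \<otimes>\<^bsub>R\<^esub> (?a \<otimes>\<^bsub>R\<^esub> nat_inv (card (fst u)))) \<odot>\<^bsub>Hm F G\<^esub> sb F G u"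
      using ob nat_inv_closed[OF pos(1)] by (simp add: nu_d[OF u ob] nu_sym_def M.smult_assoc1)
    also have "?b \<otimes>\<^bsub>R\<^esub> iord G \<otimes>\<^bsub>R\<^esub> (?a \<otimes>\<^bsub>R\<^esub> nat_inv (card (fst u)))
      = (?b \<otimes>\<^bsub>R\<^esub> nat_inv (card (fst u))) \<otimes>\<^bsub>R\<^esub> (iord G \<otimes>\<^bsub>R\<^esub> ?a)"
      using ob nat_inv_closed[OF pos(1)] by (simp add: R.m_ac)
    also have "\<dots> = \<one>\<^bsub>R\<^esub>" using nat_inv_cancel[OF pos(1)] nat_inv_cancel[OF pos(2)] by simp
    finally show "nu_map R l A F G (orbit_map F G (s F G u)) = average F G (s F G u)"
      using ob by (simp add: sbar_eq_average[symmetric])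
  qed
  thus ?thesis by (simp add: average_fixes_Inv[OF ob \<phi>])
qed

lemma nu_inject:
  assumes "F \<in> \<G>" "G \<in> \<G>" "\<phi> \<in> carrier (Bm F G)" "\<psi> \<in> carrier (Bm F G)"
    "nu_map R l A F G \<phi> = nu_map R l A F G \<psi>"
  shows "\<phi> = \<psi>"
  by (rule trans[OF orbit_map_nu[OF assms(1-3), symmetric]])
    (rule trans[OF arg_cong[where f = "orbit_map F G", OF assms(5)] orbit_map_nu[OF assms(1,2,4)]])

section \<open>The product of two orbit symbols\<close>

text \<open>The term at \<open>x\<close>, up to the factor \<open>1 / |G|\<close>, in the expansion of a product of two averaged
  symbols.\<close>

definition twisted_product ::
    "'g monoid \<Rightarrow> 'g monoid \<Rightarrow> 'g monoid \<Rightarrow> ('g \<times> 'g, 'a) subchar \<Rightarrow> ('g \<times> 'g, 'a) subchar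
      \<Rightarrow> 'g \<Rightarrow> (('g \<times> 'g, 'a) subchar \<Rightarrow> 'r)" where
  "twisted_product F G H u v x = average F H
     (cmp F G H (s F G u) (s G H (conj_subchar (G \<times>\<times> H) (x, \<one>\<^bsub>H\<^esub>) v)))"

lemma twisted_product_closed:
  assumes "F \<in> \<G>" "G \<in> \<G>" "H \<in> \<G>"
  shows "twisted_product F G H u v x \<in> carrier (Hm F H)"
  unfolding twisted_product_def
  by (rule linear_mapsD(1)[OF average_linear_Hm[OF assms(1,3)] cmp_closed[OF assms s_closed s_closed]])

text \<open>The two inner idempotents \<open>\<sigma>(e\<^sub>G)\<close> merge into one, which is then expanded as a sum over \<open>G\<close>.\<close>

lemma cmp_sbar_sbar:
  assumes u: "u \<in> SA A F G" and v: "v \<in> SA A G H" and ob: "F \<in> \<G>" "G \<in> \<G>" "H \<in> \<G>"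
  shows "cmp F G H (sb F G u) (sb G H v)
    = iord G \<odot>\<^bsub>Hm F H\<^esub> finsum (Hm F H) (twisted_product F G H u v) (carrier G)"
proof -
  interpret M: module R "Hm F H" by (rule Hm_module)
  define a where "a = cmp F F G (av F) (s F G u)"
  define b where "b = cmp G H H (s G H v) (av H)"
  have a: "a \<in> carrier (Hm F G)" and b: "b \<in> carrier (Hm G H)" using ob by (simp_all add: a_def b_def)
  have "cmp F G H (sb F G u) (sb G H v) = cmp F G H (cmp F G G a (av G)) (cmp G G H (av G) b)"
    using ob by (simp add: sbar_def a_def b_def cmp_assoc)
  also have "\<dots> = cmp F G H a (cmp G G H (av G) b)"
    using ob a b by (simp add: cmp_assoc cmp_assoc[of G G G H, symmetric] av_cmp_av)
  also have "\<dots> = iord G \<odot>\<^bsub>Hm F H\<^esub>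
      finsum (Hm F H) (\<lambda>x. cmp F G H a (cmp G G H (sg G x) b)) (carrier G)"
    by (rule linear_av[OF Hm_module ob(2) linear_maps_comp[OF
          cmp_linear(1)[OF ob(2,2,3) b] cmp_linear(2)[OF ob a]]])
  also have "finsum (Hm F H) (\<lambda>x. cmp F G H a (cmp G G H (sg G x) b)) (carrier G)
    = finsum (Hm F H) (twisted_product F G H u v) (carrier G)"
  proof (rule M.finsum_cong')
    fix x assume x: "x \<in> carrier G"
    let ?t = "s G H (conj_subchar (G \<times>\<times> H) (x, \<one>\<^bsub>H\<^esub>) v)"
    have "cmp G G H (sg G x) b = cmp G H H ?t (av H)"
      using ob x by (simp add: b_def cmp_assoc[symmetric] cmp_sg_symbol(1)[OF v])
    hence "cmp F G H a (cmp G G H (sg G x) b) = cmp F H H (cmp F G H a ?t) (av H)"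
      using ob a by (simp add: cmp_assoc)
    thus "cmp F G H a (cmp G G H (sg G x) b) = twisted_product F G H u v x"
      using ob by (simp add: a_def twisted_product_def average_def cmp_assoc[of F F G H])
  qed (use twisted_product_closed[OF ob] in auto)
  finally show ?thesis .
qed

text \<open>An element \<open>(f, p)\<close> of \<open>U\<close> fixes \<open>u\<close>, so that \<open>s\<^sub>u \<sigma>(p) = \<sigma>(f) s\<^sub>u\<close>; and \<open>\<sigma>(f)\<close> is
  absorbed by averaging.\<close>

lemma s_cmp_sg_stabiliser:
  assumes u: "u \<in> SA A F G" and ob: "F \<in> \<G>" "G \<in> \<G>" and p: "(f, p) \<in> fst u"
  shows "cmp F G G (s F G u) (sg G p) = cmp F F G (sg F f) (s F G u)"
proof -
  interpret F: group F by (rule group_object) fact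
  interpret G: group G by (rule group_object) fact
  note cl = SA_D(1,2)[OF u ob p]
  have self: "conj_subchar (F \<times>\<times> G) (f, p) u = u"
    using conj_subchar_self[OF group_pair[OF ob] comm_group_axioms u[unfolded SA_def] p] .
  have "conj_subchar (F \<times>\<times> G) (\<one>\<^bsub>F\<^esub>, inv\<^bsub>G\<^esub> p) u
    = conj_subchar (F \<times>\<times> G) (\<one>\<^bsub>F\<^esub>, inv\<^bsub>G\<^esub> p) (conj_subchar (F \<times>\<times> G) (f, p) u)" by (simp only: self)
  also have "\<dots> = conj_subchar (F \<times>\<times> G) (f, \<one>\<^bsub>G\<^esub>) u"
    using cl by (simp add: conj_SA_mult[OF u ob])
  finally show ?thesis using cl by (simp add: cmp_sg_symbol[OF u ob])
qed

lemma twisted_product_double_coset: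
  assumes u: "u \<in> SA A F G" and v: "v \<in> SA A G H" and ob: "F \<in> \<G>" "G \<in> \<G>" "H \<in> \<G>"
    and p: "p \<in> snd ` fst u" and x: "x \<in> carrier G" and q: "q \<in> fst ` fst v"
  shows "twisted_product F G H u v (p \<otimes>\<^bsub>G\<^esub> x \<otimes>\<^bsub>G\<^esub> q) = twisted_product F G H u v x"
proof -
  interpret F: group F by (rule group_object) fact
  interpret G: group G by (rule group_object) fact
  interpret H: group H by (rule group_object) fact
  obtain f where f: "(f, p) \<in> fst u" using p by auto
  obtain k where k: "(q, k) \<in> fst v" using q by auto
  note cl = SA_D(1,2)[OF u ob(1,2) f] SA_D(1,2)[OF v ob(2,3) k]
  let ?c = "\<lambda>y. conj_subchar (G \<times>\<times> H) (y, \<one>\<^bsub>H\<^esub>) v"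
  have cv: "?c y \<in> SA A G H" if "y \<in> carrier G" for y
    by (rule conj_SA_closed[OF v ob(2,3) that H.one_closed])
  have 1: "s G H (?c (p \<otimes>\<^bsub>G\<^esub> x \<otimes>\<^bsub>G\<^esub> q)) = cmp G G H (sg G p) (cmp G G H (sg G x) (cmp G G H (sg G q) (s G H v)))"
    using cl x by (simp add: cmp_sg_symbol(1)[OF _ ob(2,3)] v cv conj_SA_mult[OF v ob(2,3)] G.m_assoc)
  have 2: "cmp G G H (sg G q) (s G H v) = cmp G H H (s G H v) (sg H k)"
    using s_cmp_sg_stabiliser[OF v ob(2,3) k] by simp
  have 3: "cmp G G H (sg G x) (s G H v) = s G H (?c x)"
    by (rule cmp_sg_symbol(1)[OF v ob(2,3) x])
  let ?t = "cmp G H H (s G H (?c x)) (sg H k)"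
  have "s G H (?c (p \<otimes>\<^bsub>G\<^esub> x \<otimes>\<^bsub>G\<^esub> q)) = cmp G G H (sg G p) ?t"
    unfolding 1 2 using ob by (simp add: cmp_assoc[symmetric] 3)
  hence "cmp F G H (s F G u) (s G H (?c (p \<otimes>\<^bsub>G\<^esub> x \<otimes>\<^bsub>G\<^esub> q)))
    = cmp F G H (cmp F G G (s F G u) (sg G p)) ?t"
    using ob by (simp add: cmp_assoc)
  also have "\<dots> = cmp F F H (sg F f) (cmp F H H (cmp F G H (s F G u) (s G H (?c x))) (sg H k))"
    unfolding s_cmp_sg_stabiliser[OF u ob(1,2) f] using ob by (simp add: cmp_assoc)
  finally show ?thesis
    unfolding twisted_product_def using cl ob by (simp add: average_sg)
qed

text \<open>Expand the product of averages as a sum over \<open>G\<close>, collect the terms belonging to one double coset,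
  and replace the size of the double coset by means of \<open>card_double_coset\<close>.\<close>

lemma nu_d_prod:
  assumes u: "u \<in> SA A F G" and v: "v \<in> SA A G H" and ob: "F \<in> \<G>" "G \<in> \<G>" "H \<in> \<G>"
    and D: "double_coset_reps G (snd ` fst u) (fst ` fst v) D"
  shows "d_prod R l A F G H D u v \<in> carrier (Bm F H)"
    and "nu_map R l A F H (d_prod R l A F G H D u v) = cmp F G H (nu_sym F G u) (nu_sym G H v)"
proof -
  interpret M: module R "Hm F H" by (rule Hm_module)
  interpret GH: module R "Hm G H" by (rule Hm_module)
  interpret B: module R "Bm F H" by (rule Bm_module)
  interpret I: module R "Inv F H" by (rule Inv_module[OF ob(1,3)])
  interpret G: group G by (rule group_object) fact
  interpret H: group H by (rule group_object) fact
  let ?c = "\<lambda>g. conj_subchar (G \<times>\<times> H) (g, \<one>\<^bsub>H\<^esub>) v"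
  let ?n = "\<lambda>g. card (Gamma_cap F G H (fst u) (fst (?c g)))"
  let ?w = "\<lambda>g. card (fst u O fst (?c g))"
  let ?P = "\<lambda>g. card (double_coset G (snd ` fst u) (fst ` fst v) g)"
  let ?ok = "\<lambda>g. compatible A F G H u (?c g)"
  let ?D = "{g \<in> D. ?ok g}"
  let ?t = "\<lambda>g. (l (?n g) \<otimes>\<^bsub>R\<^esub> nat_inv (?n g)) \<odot>\<^bsub>Bm F H\<^esub> d F H (star A u (?c g))"
  \<comment> \<open>The factor \<open>|H| / (|U| |V|)\<close> common to all terms of the expanded product of averages.\<close>
  let ?k = "nat_inv (card (fst u)) \<otimes>\<^bsub>R\<^esub> nat_inv (card (fst v)) \<otimes>\<^bsub>R\<^esub> of_nat_in R (order H)"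
  have DG: "D \<subseteq> carrier G" using D by (simp add: double_coset_reps_def)
  hence finD: "finite D" using finite_object[OF ob(2)] by (rule finite_subset)
  have cv: "?c g \<in> SA A G H" if "g \<in> carrier G" for g
    by (rule conj_SA_closed[OF v ob(2,3) that H.one_closed])
  have n_pos: "?n g > 0" if "g \<in> carrier G" for g
    by (rule card_Gamma_cap_pos[OF u cv[OF that] ob])
  have count: "card (fst u) * card (fst v) = ?n g * ?w g * ?P g" if "g \<in> carrier G" for g
    by (rule card_double_coset[OF u v ob that])
  note uv_pos = card_SA_fst_pos[OF u ob(1,2)] card_SA_fst_pos[OF v ob(2,3)]
  have w_pos: "?w g > 0" if "g \<in> carrier G" for g
    using count[OF that] uv_pos by (metis mult_pos_pos gr0I less_not_refl mult_0_right mult_zero_left)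
  have coeff: "l (?n g) \<otimes>\<^bsub>R\<^esub> nat_inv (?n g) \<in> carrier R" if "g \<in> carrier G" for g
    using l_closed[OF n_pos[OF that]] nat_inv_closed[OF n_pos[OF that]] by simp
  have t: "?t \<in> ?D \<rightarrow> carrier (Bm F H)"
    using coeff DG by (intro Pi_I B.smult_closed) auto
  have dp: "d_prod R l A F G H D u v = finsum (Bm F H) ?t ?D"
    by (simp add: d_prod_def Let_def)
  show "d_prod R l A F G H D u v \<in> carrier (Bm F H)"
    unfolding dp using t by (rule B.finsum_closed)
  have kc: "?k \<in> carrier R"
    using nat_inv_closed[OF uv_pos(1)] nat_inv_closed[OF uv_pos(2)] by simp
  have tp: "twisted_product F G H u v g
    = (if ?ok g then l (?n g) \<odot>\<^bsub>Hm F H\<^esub> sb F H (star A u (?c g)) else \<zero>\<^bsub>Hm F H\<^esub>)"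
    if g: "g \<in> carrier G" for g
    using linear_mapsD(3)[OF average_linear_Hm[OF ob(1,3)] l_closed[OF n_pos[OF g]] s_closed]
      linear_maps_zero[OF Hm_module Hm_module average_linear_Hm[OF ob(1,3)]]
    by (simp add: twisted_product_def cmp_symbols[OF u cv[OF g] ob] sbar_eq_average)
  have nu_t: "nu_map R l A F H (?t g)
    = (?k \<otimes>\<^bsub>R\<^esub> of_nat_in R (?P g)) \<odot>\<^bsub>Hm F H\<^esub> twisted_product F G H u v g" if g: "g \<in> ?D" for g
  proof -
    have gG: "g \<in> carrier G" and ok: "?ok g" using g DG by auto
    let ?x = "star A u (?c g)"
    have x: "?x \<in> SA A F H" by (rule star_closed[OF u cv[OF gG] ob ok])
    note lc = l_closed[OF n_pos[OF gG]]
    note ic = nat_inv_closed[OF n_pos[OF gG]] nat_inv_closed[OF w_pos[OF gG]]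
      nat_inv_closed[OF uv_pos(1)] nat_inv_closed[OF uv_pos(2)]
    have "nu_map R l A F H (?t g)
      = (l (?n g) \<otimes>\<^bsub>R\<^esub> nat_inv (?n g)) \<odot>\<^bsub>Inv F H\<^esub> nu_map R l A F H (d F H ?x)"
      by (rule linear_mapsD(3)[OF nu_linear[OF ob(1,3)] coeff[OF gG] d_closed])
    also have "\<dots> = (l (?n g) \<otimes>\<^bsub>R\<^esub> nat_inv (?n g) \<otimes>\<^bsub>R\<^esub> (of_nat_in R (order H) \<otimes>\<^bsub>R\<^esub> nat_inv (?w g)))
        \<odot>\<^bsub>Hm F H\<^esub> sb F H ?x"
      using lc ic ob by (simp add: nu_d[OF x ob(1,3)] nu_sym_def fst_star M.smult_assoc1)
    also have "l (?n g) \<otimes>\<^bsub>R\<^esub> nat_inv (?n g) \<otimes>\<^bsub>R\<^esub> (of_nat_in R (order H) \<otimes>\<^bsub>R\<^esub> nat_inv (?w g))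
      = (nat_inv (?n g) \<otimes>\<^bsub>R\<^esub> nat_inv (?w g)) \<otimes>\<^bsub>R\<^esub> of_nat_in R (order H) \<otimes>\<^bsub>R\<^esub> l (?n g)"
      using lc ic by (simp add: R.m_ac)
    also have "nat_inv (?n g) \<otimes>\<^bsub>R\<^esub> nat_inv (?w g) = nat_inv (?n g * ?w g)"
      by (rule nat_inv_mult[OF n_pos[OF gG] w_pos[OF gG], symmetric])
    also have "\<dots> = nat_inv (card (fst u) * card (fst v)) \<otimes>\<^bsub>R\<^esub> of_nat_in R (?P g)"
    proof (rule R.inv_mult_eq_inv[symmetric])
      show "of_nat_in R (card (fst u) * card (fst v)) \<in> Units R" "of_nat_in R (?n g * ?w g) \<in> Units R"
        using n_pos[OF gG] w_pos[OF gG] uv_pos by (simp_all add: of_nat_unit)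
      show "of_nat_in R (card (fst u) * card (fst v))
          = of_nat_in R (?n g * ?w g) \<otimes>\<^bsub>R\<^esub> of_nat_in R (?P g)"
        unfolding count[OF gG] by (rule R.of_nat_in_mult)
    qed simp
    also have "nat_inv (card (fst u) * card (fst v)) = nat_inv (card (fst u)) \<otimes>\<^bsub>R\<^esub> nat_inv (card (fst v))"
      by (rule nat_inv_mult[OF uv_pos])
    also have "nat_inv (card (fst u)) \<otimes>\<^bsub>R\<^esub> nat_inv (card (fst v)) \<otimes>\<^bsub>R\<^esub> of_nat_in R (?P g)
        \<otimes>\<^bsub>R\<^esub> of_nat_in R (order H) \<otimes>\<^bsub>R\<^esub> l (?n g)
      = ?k \<otimes>\<^bsub>R\<^esub> of_nat_in R (?P g) \<otimes>\<^bsub>R\<^esub> l (?n g)"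
      using ic by (simp add: R.m_ac)
    finally show ?thesis
      using lc kc ob by (simp add: tp[OF gG] ok M.smult_assoc1)
  qed
  let ?r = "\<lambda>g. (?k \<otimes>\<^bsub>R\<^esub> of_nat_in R (?P g)) \<odot>\<^bsub>Hm F H\<^esub> twisted_product F G H u v g"
  let ?q = "\<lambda>g. of_nat_in R (?P g) \<odot>\<^bsub>Hm F H\<^esub> twisted_product F G H u v g"
  have r: "?r g \<in> carrier (Hm F H)" for g
    using kc twisted_product_closed[OF ob] by simp
  have "nu_map R l A F H (finsum (Bm F H) ?t ?D) = finsum (Hm F H) (\<lambda>g. nu_map R l A F H (?t g)) ?D"
    by (rule linear_maps_finsum[OF Bm_module Hm_module
          linear_maps_comp[OF nu_linear[OF ob(1,3)] Inv_incl[OF ob(1,3)]] t])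
  also have "\<dots> = finsum (Hm F H) ?r ?D"
    using nu_t r by (intro M.finsum_cong') auto
  also have "\<dots> = finsum (Hm F H) ?r D"
    using finD kc DG r
    by (intro M.add.finprod_mono_neutral_cong_left) (auto simp: tp subset_iff)
  also have "\<dots> = finsum (Hm F H) (\<lambda>g. ?k \<odot>\<^bsub>Hm F H\<^esub> ?q g) D"
    using kc twisted_product_closed[OF ob] by (simp add: M.smult_assoc1)
  also have "\<dots> = ?k \<odot>\<^bsub>Hm F H\<^esub> finsum (Hm F H) ?q D"
    using finD kc twisted_product_closed[OF ob] by (intro M.finsum_smult_ldistr[symmetric]) auto
  also have "finsum (Hm F H) ?q D = finsum (Hm F H) (twisted_product F G H u v) (carrier G)"
    using twisted_product_closed[OF ob] twisted_product_double_coset[OF u v ob]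
    by (intro finsum_double_cosets[OF G.is_group Hm_module finite_object[OF ob(2)]
          subgroup_snd_SA[OF u ob(1,2)] subgroup_fst_SA[OF v ob(2,3)] D, symmetric]) auto
  finally have left: "nu_map R l A F H (d_prod R l A F G H D u v)
    = ?k \<odot>\<^bsub>Hm F H\<^esub> finsum (Hm F H) (twisted_product F G H u v) (carrier G)" unfolding dp .
  let ?S = "finsum (Hm F H) (twisted_product F G H u v) (carrier G)"
  have S: "?S \<in> carrier (Hm F H)" using twisted_product_closed[OF ob] by (intro M.finsum_closed) auto
  note ic = nat_inv_closed[OF uv_pos(1)] nat_inv_closed[OF uv_pos(2)] iord_closed[OF ob(2)]
  have "cmp F G H (nu_sym F G u) (nu_sym G H v)
    = (of_nat_in R (order G) \<otimes>\<^bsub>R\<^esub> nat_inv (card (fst u)) \<otimes>\<^bsub>R\<^esub>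
       (of_nat_in R (order H) \<otimes>\<^bsub>R\<^esub> nat_inv (card (fst v))) \<otimes>\<^bsub>R\<^esub> iord G) \<odot>\<^bsub>Hm F H\<^esub> ?S"
    using ic ob S GH.smult_closed[OF R.m_closed[OF R.of_nat_in_closed ic(2)] sbar_closed[OF ob(2,3)]]
    by (simp add: nu_sym_def cmp_smult cmp_sbar_sbar[OF u v ob] M.smult_assoc1)
  also have "of_nat_in R (order G) \<otimes>\<^bsub>R\<^esub> nat_inv (card (fst u)) \<otimes>\<^bsub>R\<^esub>
       (of_nat_in R (order H) \<otimes>\<^bsub>R\<^esub> nat_inv (card (fst v))) \<otimes>\<^bsub>R\<^esub> iord G
    = ?k \<otimes>\<^bsub>R\<^esub> (of_nat_in R (order G) \<otimes>\<^bsub>R\<^esub> iord G)"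
    using ic by (simp add: R.m_ac)
  also have "of_nat_in R (order G) \<otimes>\<^bsub>R\<^esub> iord G = \<one>\<^bsub>R\<^esub>"
    by (rule nat_inv_cancel(2)[OF order_pos[OF ob(2)]])
  finally show "nu_map R l A F H (d_prod R l A F G H D u v) = cmp F G H (nu_sym F G u) (nu_sym G H v)"
    using kc by (simp add: left)
qed

text \<open>All choices give the same product, because their images under the injective map agree.\<close>

lemma orbit_product_value:
  assumes u: "u \<in> SA A F G" and v: "v \<in> SA A G H" and ob: "F \<in> \<G>" "G \<in> \<G>" "H \<in> \<G>"
    and D: "double_coset_reps G (snd ` fst u) (fst ` fst v) D"
  shows "(THE z. \<forall>u'\<in>orbit_of F G u. \<forall>v'\<in>orbit_of G H v. \<forall>D.
      double_coset_reps G (snd ` fst u') (fst ` fst v') D \<longrightarrow> z = d_prod R l A F G H D u' v')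
    = d_prod R l A F G H D u v"
proof (rule the_equality)
  show "\<forall>u'\<in>orbit_of F G u. \<forall>v'\<in>orbit_of G H v. \<forall>D'.
      double_coset_reps G (snd ` fst u') (fst ` fst v') D' \<longrightarrow>
      d_prod R l A F G H D u v = d_prod R l A F G H D' u' v'"
  proof (intro ballI allI impI)
    fix u' v' D' assume u': "u' \<in> orbit_of F G u" and v': "v' \<in> orbit_of G H v"
      and D': "double_coset_reps G (snd ` fst u') (fst ` fst v') D'"
    note su = orbit_of_D(1)[OF u ob(1,2) u'] and sv = orbit_of_D(1)[OF v ob(2,3) v']
    show "d_prod R l A F G H D u v = d_prod R l A F G H D' u' v'"
    proof (rule nu_inject[OF ob(1,3) nu_d_prod(1)[OF u v ob D] nu_d_prod(1)[OF su sv ob D']])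
      show "nu_map R l A F H (d_prod R l A F G H D u v) = nu_map R l A F H (d_prod R l A F G H D' u' v')"
        unfolding nu_d_prod(2)[OF u v ob D] nu_d_prod(2)[OF su sv ob D']
          nu_sym_orbit[OF u ob(1,2) u'] nu_sym_orbit[OF v ob(2,3) v'] by (rule refl)
    qed
  qed
next
  fix z assume "\<forall>u'\<in>orbit_of F G u. \<forall>v'\<in>orbit_of G H v. \<forall>D.
      double_coset_reps G (snd ` fst u') (fst ` fst v') D \<longrightarrow> z = d_prod R l A F G H D u' v'"
  thus "z = d_prod R l A F G H D u v"
    using orbit_of_self[OF u ob(1,2)] orbit_of_self[OF v ob(2,3)] D by blast
qed

abbreviation "bcmp \<equiv> RB_comp R l A"

abbreviation orbit_product :: "'g monoid \<Rightarrow> 'g monoid \<Rightarrow> 'g monoid \<Rightarrow> ('g \<times> 'g, 'a) subchar set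
    \<Rightarrow> ('g \<times> 'g, 'a) subchar set \<Rightarrow> (('g \<times> 'g, 'a) subchar set \<Rightarrow> 'r)" where
  "orbit_product F G H X Y \<equiv> (THE z. \<forall>u\<in>X. \<forall>v\<in>Y. \<forall>D.
     double_coset_reps G (snd ` fst u) (fst ` fst v) D \<longrightarrow> z = d_prod R l A F G H D u v)"

lemma orbit_product_nu:
  assumes u: "u \<in> SA A F G" and v: "v \<in> SA A G H" and ob: "F \<in> \<G>" "G \<in> \<G>" "H \<in> \<G>"
  shows "orbit_product F G H (orbit_of F G u) (orbit_of G H v) \<in> carrier (Bm F H)"
    and "nu_map R l A F H (orbit_product F G H (orbit_of F G u) (orbit_of G H v))
      = cmp F G H (nu_sym F G u) (nu_sym G H v)"
proof -
  obtain D where D: "double_coset_reps G (snd ` fst u) (fst ` fst v) D"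
    using double_coset_reps_exist[OF group_object[OF ob(2)] subgroup_snd_SA[OF u ob(1,2)]
      subgroup_fst_SA[OF v ob(2,3)]] by blast
  show "orbit_product F G H (orbit_of F G u) (orbit_of G H v) \<in> carrier (Bm F H)"
    unfolding orbit_product_value[OF u v ob D] by (rule nu_d_prod(1)[OF u v ob D])
  show "nu_map R l A F H (orbit_product F G H (orbit_of F G u) (orbit_of G H v))
      = cmp F G H (nu_sym F G u) (nu_sym G H v)"
    unfolding orbit_product_value[OF u v ob D] by (rule nu_d_prod(2)[OF u v ob D])
qed

lemma orbit_product_closed:
  assumes "X \<in> SA_orbits A F G" "Y \<in> SA_orbits A G H" "F \<in> \<G>" "G \<in> \<G>" "H \<in> \<G>"
  shows "orbit_product F G H X Y \<in> carrier (Bm F H)"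
proof -
  obtain u v where u: "u \<in> SA A F G" "X = orbit_of F G u" and v: "v \<in> SA A G H" "Y = orbit_of G H v"
    using assms(1,2) by (auto elim!: SA_orbits_cases)
  show ?thesis unfolding u(2) v(2) by (rule orbit_product_nu(1)[OF u(1) v(1) assms(3-5)])
qed

lemma bcmp_linear:
  assumes "F \<in> \<G>" "G \<in> \<G>" "H \<in> \<G>"
  shows "\<psi> \<in> carrier (Bm G H) \<Longrightarrow> (\<lambda>\<phi>. bcmp F G H \<phi> \<psi>) \<in> linear_maps R (Bm F G) (Bm F H)"
    and "\<phi> \<in> carrier (Bm F G) \<Longrightarrow> bcmp F G H \<phi> \<in> linear_maps R (Bm G H) (Bm F H)"
  using R.bilinear_ext_linear[OF Bm_module[of F H] orbit_product_closed[OF _ _ assms],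
      of "SA_orbits A F G" "SA_orbits A G H"]
  by (simp_all add: RB_comp_def RB_hom_def[of R A F G] RB_hom_def[of R A G H])

lemma bcmp_closed:
  assumes "F \<in> \<G>" "G \<in> \<G>" "H \<in> \<G>" "\<phi> \<in> carrier (Bm F G)" "\<psi> \<in> carrier (Bm G H)"
  shows "bcmp F G H \<phi> \<psi> \<in> carrier (Bm F H)"
  by (rule linear_mapsD(1)[OF bcmp_linear(2)[OF assms(1-4)] assms(5)])

lemma nu_bcmp_d:
  assumes u: "u \<in> SA A F G" and v: "v \<in> SA A G H" and ob: "F \<in> \<G>" "G \<in> \<G>" "H \<in> \<G>"
  shows "nu_map R l A F H (bcmp F G H (d F G u) (d G H v)) = cmp F G H (nu_sym F G u) (nu_sym G H v)"
proof -
  have "bcmp F G H (d F G u) (d G H v) = orbit_product F G H (orbit_of F G u) (orbit_of G H v)"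
    unfolding RB_comp_def d_sym_def
    by (rule R.bilinear_ext_symbol[OF Bm_module orbit_product_closed[OF _ _ ob]
          orbit_in_SA_orbits[OF u] orbit_in_SA_orbits[OF v]])
  thus ?thesis by (simp only: orbit_product_nu(2)[OF u v ob])
qed

lemma nu_bcmp:
  assumes ob: "F \<in> \<G>" "G \<in> \<G>" "H \<in> \<G>" and \<phi>: "\<phi> \<in> carrier (Bm F G)" and \<psi>: "\<psi> \<in> carrier (Bm G H)"
  shows "nu_map R l A F H (bcmp F G H \<phi> \<psi>) = cmp F G H (nu_map R l A F G \<phi>) (nu_map R l A G H \<psi>)"
proof -
  have nu: "nu_map R l A F G \<in> linear_maps R (Bm F G) (Hm F G)" if "F \<in> \<G>" "G \<in> \<G>" for F G
    by (rule linear_maps_comp[OF nu_linear[OF that] Inv_incl[OF that]])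
  have 1: "nu_map R l A F H (bcmp F G H (d F G u) \<psi>) = cmp F G H (nu_map R l A F G (d F G u)) (nu_map R l A G H \<psi>)"
    if u: "u \<in> SA A F G" for u
  proof (rule Bm_linear_eqI[OF Hm_module
        linear_maps_comp[OF bcmp_linear(2)[OF ob d_closed] nu[OF ob(1,3)]]
        linear_maps_comp[OF nu[OF ob(2,3)] cmp_linear(2)[OF ob linear_mapsD(1)[OF nu[OF ob(1,2)] d_closed]]]
        _ \<psi>])
    fix v assume v: "v \<in> SA A G H"
    show "nu_map R l A F H (bcmp F G H (d F G u) (d G H v))
        = cmp F G H (nu_map R l A F G (d F G u)) (nu_map R l A G H (d G H v))"
      unfolding nu_bcmp_d[OF u v ob] nu_d[OF u ob(1,2)] nu_d[OF v ob(2,3)] by (rule refl)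
  qed
  show ?thesis
    by (rule Bm_linear_eqI[where f = "\<lambda>\<phi>. nu_map R l A F H (bcmp F G H \<phi> \<psi>)"
          and g = "\<lambda>\<phi>. cmp F G H (nu_map R l A F G \<phi>) (nu_map R l A G H \<psi>)", OF Hm_module
          linear_maps_comp[OF bcmp_linear(1)[OF ob \<psi>] nu[OF ob(1,3)]]
          linear_maps_comp[OF nu[OF ob(1,2)] cmp_linear(1)[OF ob linear_mapsD(1)[OF nu[OF ob(2,3)] \<psi>]]]
          1 \<phi>])
qed

lemma RB_simps [simp]:
  shows "Ob (RB R l A \<G>) = \<G>" "Hom (RB R l A \<G>) = Bm" "Comp (RB R l A \<G>) = bcmp"
  by (simp_all add: RB_def)

text \<open>The preimage of the identity of the invariant category is a two-sided identity; a second one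
  agrees with it by composing the two.\<close>

lemma RB_Ident:
  assumes G: "G \<in> \<G>"
  shows "Ident (RB R l A \<G>) G = orbit_map G G (av G)"
proof -
  let ?e = "orbit_map G G (av G)"
  have avI: "av G \<in> carrier (Inv G G)" using G by (simp add: Inv_iff sg_cmp_av)
  have e: "?e \<in> carrier (Bm G G)" by (rule linear_mapsD(1)[OF orbit_map_linear[OF G G] av_closed[OF G]])
  have nu_e: "nu_map R l A G G ?e = av G" by (rule nu_orbit_map[OF G G avI])
  have nuI: "nu_map R l A F K \<phi> \<in> carrier (Inv F K)"
    if "F \<in> \<G>" "K \<in> \<G>" "\<phi> \<in> carrier (Bm F K)" for F K \<phi>
    by (rule linear_mapsD(1)[OF nu_linear[OF that(1,2)] that(3)])
  have left: "bcmp G G F ?e \<phi> = \<phi>" if F: "F \<in> \<G>" and \<phi>: "\<phi> \<in> carrier (Bm G F)" for F \<phi>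
    by (rule nu_inject[OF G F bcmp_closed[OF G G F e \<phi>] \<phi>])
      (simp only: nu_bcmp[OF G G F e \<phi>] nu_e Inv_D(4)[OF nuI[OF G F \<phi>] G F])
  have right: "bcmp F G G \<phi> ?e = \<phi>" if F: "F \<in> \<G>" and \<phi>: "\<phi> \<in> carrier (Bm F G)" for F \<phi>
    by (rule nu_inject[OF F G bcmp_closed[OF F G G \<phi> e] \<phi>])
      (simp only: nu_bcmp[OF F G G \<phi> e] nu_e Inv_D(5)[OF nuI[OF F G \<phi>] F G])
  have "(THE e. e \<in> carrier (Bm G G) \<and>
       (\<forall>F\<in>\<G>. (\<forall>\<phi>\<in>carrier (Bm G F). bcmp G G F e \<phi> = \<phi>) \<and>
               (\<forall>\<phi>\<in>carrier (Bm F G). bcmp F G G \<phi> e = \<phi>))) = ?e"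
  proof (rule the_equality)
    show "?e \<in> carrier (Bm G G) \<and>
       (\<forall>F\<in>\<G>. (\<forall>\<phi>\<in>carrier (Bm G F). bcmp G G F ?e \<phi> = \<phi>) \<and>
               (\<forall>\<phi>\<in>carrier (Bm F G). bcmp F G G \<phi> ?e = \<phi>))"
      using e left right by blast
    fix e' assume "e' \<in> carrier (Bm G G) \<and>
       (\<forall>F\<in>\<G>. (\<forall>\<phi>\<in>carrier (Bm G F). bcmp G G F e' \<phi> = \<phi>) \<and>
               (\<forall>\<phi>\<in>carrier (Bm F G). bcmp F G G \<phi> e' = \<phi>))"
    hence "e' \<in> carrier (Bm G G)" "bcmp G G G e' ?e = ?e" using G e by blast+
    thus "e' = ?e" using right[OF G, of e'] by metis
  qed
  thus ?thesis by (simp add: RB_def)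
qed

theorem RB_isomorphic_RSbar:
  shows "linear_category R (RB R l A \<G>)"
    and "object_identical_isomorphism R (RB R l A \<G>) (RSbar R l A \<G>) (nu_map R l A)"
proof -
  have 1: "orbit_map F G \<psi> \<in> carrier (Bm F G) \<and> nu_map R l A F G (orbit_map F G \<psi>) = \<psi>"
    if "F \<in> \<G>" "G \<in> \<G>" "\<psi> \<in> carrier (Inv F G)" for F G \<psi>
    using linear_mapsD(1)[OF orbit_map_linear[OF that(1,2)] Inv_D(1)[OF that(3,1,2)]]
      nu_orbit_map[OF that] by blast
  note transport = transport_linear_category[OF linear_category_RSbar, of "RB R l A \<G>" "nu_map R l A" orbit_map,
    unfolded RB_simps RSbar_simps, OF refl Bm_module nu_linear 1 orbit_map_nu bcmp_closed nu_bcmp RB_Ident]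
  show "linear_category R (RB R l A \<G>)" by (rule transport(1))
  show "object_identical_isomorphism R (RB R l A \<G>) (RSbar R l A \<G>) (nu_map R l A)"
    by (rule transport(2))
qed

end

theorem theorem5p1:
  fixes R :: "('r, 'x) ring_scheme"
    and A :: "('a, 'z) monoid_scheme"
    and \<G> :: "'g monoid set"
    and l :: "nat \<Rightarrow> 'r"
  assumes "\<G> \<noteq> {}"
    and "\<And>G. G \<in> \<G> \<Longrightarrow> group G \<and> finite (carrier G)"
    and "cring R"
    and "\<one>\<^bsub>R\<^esub> \<noteq> \<zero>\<^bsub>R\<^esub>"
    and "\<And>n. n > 0 \<Longrightarrow> of_nat_in R n \<in> Units R"
    and "comm_group A"
    and "\<And>n. n > 0 \<Longrightarrow> l n \<in> Units R"
    and "l 1 = \<one>\<^bsub>R\<^esub>"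
    and "\<And>m n. \<lbrakk>m > 0; n > 0\<rbrakk> \<Longrightarrow> l (m * n) = l m \<otimes>\<^bsub>R\<^esub> l n"
  shows "associative_comp (RB R l A \<G>) \<and>
    linear_category R (RB R l A \<G>) \<and>
    object_identical_isomorphism R (RB R l A \<G>) (RSbar R l A \<G>) (nu_map R l A)"
proof -
  interpret R: cring R by (rule assms(3))
  have "subcharacter_algebra A \<G> R l"
    using assms by (auto intro!: subcharacter_algebra.intro subcharacters.intro
        subcharacters_axioms.intro subcharacter_algebra_axioms.intro)
  note iso = subcharacter_algebra.RB_isomorphic_RSbar[OF this]
  from iso linear_category.comp_assoc[OF iso(1)] show ?thesis by blast
qed

end
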